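(* Every Spherical Diagram has at least two clockwise swirls, at least two counterclockwise swirls, and at least six arcs. Every Spherical Occlusion Diagram has at least eight arcs. Moreover, these bounds are matched by $6$-oriented examples with alignment $(3,3,3,3,3,3)$: there exists a $6$-oriented SD with alignment $(3,3,3,3,3,3)$ having exactly two clockwise swirls, two counterclockwise swirls and six arcs, and there exists a $6$-oriented SOD with alignment $(3,3,3,3,3,3)$ having exactly two clockwise swirls, two counterclockwise swirls and eight arcs.
   Context: A geodesic arc on the unit sphere in $\mathbb R^3$ is the unique shortest curve joining two non-antipodal points. An arc $a$ blocks an arc $b$ (equivalently, $b$ hits $a$) if an endpoint of $b$ lies in the relative interior of $a$. A Spherical Diagram (SD) is a finite non-empty collection $\mathcal D$ of pairwise interior-disjoint geodesic arcs on the unit sphere such that each arc of $\mathcal D$ is blocked by arcs of $\mathcal D$ at each of its endpoints. A Spherical Occlusion Diagram (SOD) is an SD such that all arcs of $\mathcal D$ that hit the same arc of $\mathcal D$ reach it from the same side. A swirl of an SD is a cycle of arcs, each of which hits the next (and the last hits the first), going either all clockwise (clockwise swirl) or all counterclockwise (counterclockwise swirl). An SD $\mathcal D$ is $k$-oriented if there exist a set $P$ of $k$ points on the unit sphere (poles), no two antipodal, and a function $f\colon\mathcal D\to P$ such that each arc $a\in\mathcal D$ lies on a great circle through $f(a)$ but contains neither $f(a)$ nor its antipode $-f(a)$. A $k$-oriented SD with poles $p_1,\dots,p_k$ has alignment $(d_1,\dots,d_k)$ (listed in nondecreasing order) if, for each $i$, there are exactly $d_i$ distinct great circles containing $p_i$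 and at least one other pole. *)

theory Defs
  imports "HOL-Analysis.Analysis"
begin

type_synonym pt = "real^3"
type_synonym arc = "pt \<times> pt"

definition S2 :: "pt set" where
  "S2 = {x. norm x = 1}"

definition det3 :: "pt \<Rightarrow> pt \<Rightarrow> pt \<Rightarrow> real" where
  "det3 a b c = (cross3 a b) \<bullet> c"

definition valid_arc :: "arc \<Rightarrow> bool" where
  "valid_arc a \<longleftrightarrow> fst a \<in> S2 \<and> snd a \<in> S2 \<and> fst a \<noteq> snd a \<and> fst a \<noteq> - snd a"

definition arc_set :: "arc \<Rightarrow> pt set" where
  "arc_set a = {sgn ((1 - t) *\<^sub>R fst a + t *\<^sub>R snd a) | t. 0 \<le> t \<and> t \<le> 1}"

definition arc_int :: "arc \<Rightarrow> pt set" where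
  "arc_int a = {sgn ((1 - t) *\<^sub>R fst a + t *\<^sub>R snd a) | t. 0 < t \<and> t < 1}"

definition hits_at :: "arc \<Rightarrow> arc \<Rightarrow> pt \<Rightarrow> pt \<Rightarrow> bool" where
  "hits_at b a p q \<longleftrightarrow>
     ((p = fst b \<and> q = snd b) \<or> (p = snd b \<and> q = fst b)) \<and> p \<in> arc_int a"

definition hits :: "arc \<Rightarrow> arc \<Rightarrow> bool" where
  "hits b a \<longleftrightarrow> fst b \<in> arc_int a \<or> snd b \<in> arc_int a"

definition SD :: "arc set \<Rightarrow> bool" where
  "SD D \<longleftrightarrow> finite D \<and> D \<noteq> {} \<and> (\<forall>a\<in>D. valid_arc a)
     \<and> (\<forall>a\<in>D. \<forall>b\<in>D. a \<noteq> b \<longrightarrow> arc_int a \<inter> arc_int b = {})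
     \<and> (\<forall>b\<in>D. (\<exists>a\<in>D. fst b \<in> arc_int a) \<and> (\<exists>a\<in>D. snd b \<in> arc_int a))"

text \<open>The side of the great circle of a = (u,v) from which b reaches a:
  the sign of det(u,v,q) where q is the endpoint of b not lying on a.\<close>
definition SOD :: "arc set \<Rightarrow> bool" where
  "SOD D \<longleftrightarrow> SD D \<and>
     (\<forall>a\<in>D. \<forall>b\<in>D. \<forall>c\<in>D. \<forall>p q p' q'.
        hits_at b a p q \<and> hits_at c a p' q' \<longrightarrow>
        sgn (det3 (fst a) (snd a) q) = sgn (det3 (fst a) (snd a) q'))"

text \<open>Turn at the junction: arc b (coming from q, ending at p) hits arc c, and
  one proceeds along c towards its endpoint e at which c hits the next arc.
  Seen from outside the sphere, the turn is to the left iff det(q,p,e) > 0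
  and to the right iff det(q,p,e) < 0.\<close>
definition swirl_dir :: "arc set \<Rightarrow> (real \<Rightarrow> bool) \<Rightarrow> arc list \<Rightarrow> bool" where
  "swirl_dir D good xs \<longleftrightarrow> xs \<noteq> [] \<and> distinct xs \<and> set xs \<subseteq> D \<and>
     (\<forall>i < length xs. \<exists>p q e r.
        hits_at (xs ! i) (xs ! ((i + 1) mod length xs)) p q \<and>
        hits_at (xs ! ((i + 1) mod length xs)) (xs ! ((i + 2) mod length xs)) e r \<and>
        good (det3 q p e))"

definition cw_swirl :: "arc set \<Rightarrow> arc list \<Rightarrow> bool" where
  "cw_swirl D xs \<longleftrightarrow> swirl_dir D (\<lambda>x. x < 0) xs"

definition ccw_swirl :: "arc set \<Rightarrow> arc list \<Rightarrow> bool" where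
  "ccw_swirl D xs \<longleftrightarrow> swirl_dir D (\<lambda>x. x > 0) xs"

text \<open>Swirls are cycles, i.e. lists up to rotation.\<close>
definition cyc :: "'a list \<Rightarrow> 'a list set" where
  "cyc xs = range (\<lambda>k. rotate k xs)"

definition num_cw_swirls :: "arc set \<Rightarrow> nat" where
  "num_cw_swirls D = card (cyc ` {xs. cw_swirl D xs})"

definition num_ccw_swirls :: "arc set \<Rightarrow> nat" where
  "num_ccw_swirls D = card (cyc ` {xs. ccw_swirl D xs})"

definition oriented_by :: "arc set \<Rightarrow> nat \<Rightarrow> pt set \<Rightarrow> (arc \<Rightarrow> pt) \<Rightarrow> bool" where
  "oriented_by D k P f \<longleftrightarrow> finite P \<and> card P = k \<and> P \<subseteq> S2 \<and>
     (\<forall>p\<in>P. - p \<notin> P) \<and>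
     (\<forall>a\<in>D. f a \<in> P \<and> f a \<in> span {fst a, snd a} \<and>
            f a \<notin> arc_set a \<and> - f a \<notin> arc_set a)"

text \<open>Number of distinct great circles (identified with 2-dim subspaces)
  through pole p and at least one other pole.\<close>
definition align_count :: "pt set \<Rightarrow> pt \<Rightarrow> nat" where
  "align_count P p = card ((\<lambda>q. span {p, q}) ` (P - {p}))"

definition six_oriented_align3 :: "arc set \<Rightarrow> bool" where
  "six_oriented_align3 D \<longleftrightarrow>
     (\<exists>P f. oriented_by D 6 P f \<and> (\<forall>p\<in>P. align_count P p = 3))"

end

theory Submission
  imports Defs
begin

text \<open>Walk along the arcs of an SD and turn left whenever the current arc ends on another one.  This walk
  is eventually periodic.  In cylindrical coordinates about a point \<open>v\<close> off all great circles of the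
  diagram, the arcs become graphs over intervals, and the walk moves eastwards or westwards.  It cannot
  start on a topmost point going east, turn back to the west and ever return, since it stays trapped
  between the purely eastbound walk from the start and the purely westbound walk from the turning point.
  With \<open>v\<close> above a point of a periodic arc this shows that a periodic left-turning walk
  keeps \<open>v\<close> on its left throughout, so it is a swirl; with \<open>v\<close> above the last stretch of
  an arbitrary directed arc it yields a periodic walk avoiding that arc.  Hence there are two
  counterclockwise swirls, and by the antipodal map two clockwise ones.

  An arc hits distinct arcs at its two ends and no two arcs hit each other, so \<open>n\<close> arcs give
  \<open>2n\<close> hitting pairs and \<open>n \<ge> 5\<close>; if \<open>n = 5\<close> all pairs touch, but then two
  counterclockwise swirls are arc-disjoint and need six arcs.  In a SOD equally oriented swirls are
  arc-disjoint, and a triangular swirl shares at most one arc with an oppositely oriented swirl of length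
  three or four, which forces eight arcs.\<close>

subsection \<open>Left-turning walks among graphs over intervals\<close>

text \<open>A left-turning walk may wind around \<open>v\<close> many times and revisit arcs, so
  "above the walk" has no meaning on the sphere. On the universal cover abscissas are real and the
  order of two graphs is constant over their common interval. The price is an infinite set of lifts;
  the uniform \<open>\<delta>\<close> replaces finiteness and lets every purely eastbound walk pass
  over all later abscissas.

  Height grows towards \<open>v\<close>: left is up for an eastbound traveller and down for a
  westbound one. The half-turn of the covering plane keeps left turns and exchanges east and west,
  so only eastbound boundaries have to be studied directly.

  The pole is put infinitesimally close to a point of a directed arc because nothing then passes
  between them: the arc is topmost there, which is exactly what a walk confined below a boundary
  cannot reach. Choosing the point beyond all hits on the arc ensures that every arrival on the arc
  still has this point ahead.

  The examples rest on the invariance of all notions under positive scaling of endpoints: integer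
  vectors stand for directions, and signs of integer determinants decide everything.\<close>

text \<open>The arcs of a diagram lifted to the universal cover of a cylinder: \<open>a\<close> lies over
  \<open>[l a, r a]\<close> at height \<open>h a\<close> and is blocked by \<open>L a\<close> and \<open>R a\<close> at its ends;
  \<open>h a\<close> is continued beyond the interval.  A pair \<open>(a, True)\<close> is \<open>a\<close> traversed eastwards.\<close>

locale strip =
  fixes A :: "'a set" and l r :: "'a \<Rightarrow> real" and h :: "'a \<Rightarrow> real \<Rightarrow> real"
    and L R :: "'a \<Rightarrow> 'a" and \<delta> :: real
  assumes l_less_r: "a \<in> A \<Longrightarrow> l a < r a"
    and cont: "a \<in> A \<Longrightarrow> continuous_on UNIV (h a)"
    and differ: "\<lbrakk>a \<in> A; b \<in> A; l a < t; t < r a; l b < t; t < r b; h a t = h b t\<rbrakk> \<Longrightarrow> a = b"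
    and R_in: "a \<in> A \<Longrightarrow> R a \<in> A" and R_l: "a \<in> A \<Longrightarrow> l (R a) < r a"
    and R_r: "a \<in> A \<Longrightarrow> r a + \<delta> \<le> r (R a)" and R_h: "a \<in> A \<Longrightarrow> h (R a) (r a) = h a (r a)"
    and L_in: "a \<in> A \<Longrightarrow> L a \<in> A" and L_r: "a \<in> A \<Longrightarrow> l a < r (L a)"
    and L_l: "a \<in> A \<Longrightarrow> l (L a) + \<delta> \<le> l a" and L_h: "a \<in> A \<Longrightarrow> h (L a) (l a) = h a (l a)"
    and \<delta>_pos: "0 < \<delta>"
begin

definition bel :: "'a \<Rightarrow> 'a \<Rightarrow> bool" where
  "bel a b \<longleftrightarrow> (\<exists>t. l a < t \<and> t < r a \<and> l b < t \<and> t < r b \<and> h a t < h b t)"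

text \<open>If the new arc lies below the old one over their common interval, a left turn leads
  eastwards in both cases: at a right end the part beyond the junction is on the upper side, and at
  a left end the lower part is the one to the east. One test therefore serves both directions of
  travel.\<close>

definition nxt :: "'a \<times> bool \<Rightarrow> 'a \<times> bool" where
  "nxt s = (let b = (if snd s then R (fst s) else L (fst s)) in (b, bel b (fst s)))"

definition switch :: "(nat \<Rightarrow> 'a) \<Rightarrow> real \<Rightarrow> nat \<Rightarrow> real" where
  "switch e \<theta> i = (case i of 0 \<Rightarrow> \<theta> | Suc j \<Rightarrow> r (e j))"

text \<open>For a \<open>walk\<close>, the half-open intervals from
  \<open>switch e \<theta> i\<close> to \<open>r (e i)\<close> tile everything from
  \<open>\<theta>\<close> on, so \<open>t\<close> determines the active index
  \<open>i\<close>.\<close>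

definition above :: "(nat \<Rightarrow> 'a) \<Rightarrow> real \<Rightarrow> 'a \<Rightarrow> real \<Rightarrow> bool" where
  "above e \<theta> c t \<longleftrightarrow> (\<exists>i. switch e \<theta> i \<le> t \<and> t < r (e i) \<and> h (e i) t < h c t)"

definition weakly_above :: "(nat \<Rightarrow> 'a) \<Rightarrow> real \<Rightarrow> 'a \<Rightarrow> real \<Rightarrow> bool" where
  "weakly_above e \<theta> c t \<longleftrightarrow> (\<exists>i. switch e \<theta> i \<le> t \<and> t < r (e i) \<and> (c = e i \<or> h (e i) t < h c t))"

definition walk :: "(nat \<Rightarrow> 'a) \<Rightarrow> real \<Rightarrow> bool" where
  "walk e \<theta> \<longleftrightarrow> e 0 \<in> A \<and> l (e 0) < \<theta> \<and> \<theta> < r (e 0) \<and> (\<forall>i. e (Suc i) = R (e i))"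

text \<open>The half-turn \<open>(t, z) \<mapsto> (- t, - z)\<close>. It preserves orientation,
  hence left turns, and swaps the two ends of each graph. In the mirrored strip,
  \<open>above\<close> means strictly below a westbound walk.\<close>

lemma mirror: "strip A (\<lambda>a. - r a) (\<lambda>a. - l a) (\<lambda>a t. - h a (- t)) R L \<delta>"
proof
  fix a assume "a \<in> A"
  show "continuous_on UNIV (\<lambda>t. - h a (- t))"
    by (intro continuous_intros continuous_on_compose2[OF cont[OF \<open>a \<in> A\<close>]]) auto
next
  fix a b t
  assume "a \<in> A" "b \<in> A" "- r a < t" "t < - l a" "- r b < t" "t < - l b" "- h a (- t) = - h b (- t)"
  then show "a = b" using differ[of a b "- t"] by simp
qed (use l_less_r R_in R_l R_r R_h L_in L_l L_r L_h \<delta>_pos in \<open>auto simp: algebra_simps less_imp_le\<close>)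

text \<open>A change of order would produce a common interior point by the intermediate value
  theorem, against \<open>differ\<close>.\<close>

lemma order_kept:
  assumes "a \<in> A" "b \<in> A" "l a < s" "s < r a" "l b < s" "s < r b" "h a s < h b s"
    and "l a < t" "t < r a" "l b < t" "t < r b"
  shows "h a t < h b t"
proof (rule ccontr)
  assume "\<not> h a t < h b t"
  define f where "f = (\<lambda>x. h a x - h b x)"
  have cf: "continuous_on X f" for X
    unfolding f_def by (intro continuous_intros continuous_on_subset[OF cont] assms) auto
  have fs: "f s < 0" and ft: "f t \<ge> 0" using assms \<open>\<not> h a t < h b t\<close> by (auto simp: f_def)
  have "\<exists>x. min s t \<le> x \<and> x \<le> max s t \<and> f x = 0"
  proof (cases "s \<le> t")
    case True
    then show ?thesis using IVT'[of f s 0 t] fs ft cf by (auto simp: min_def max_def)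
  next
    case False
    then show ?thesis using IVT2'[of f s 0 t] fs ft cf by (auto simp: min_def max_def)
  qed
  then obtain x where x: "min s t \<le> x" "x \<le> max s t" "f x = 0" by blast
  have "a = b" by (rule differ[of a b x]) (use assms x in \<open>auto simp: f_def min_def max_def split: if_splits\<close>)
  with fs show False by (simp add: f_def)
qed

lemma order_kept_closed:
  assumes "a \<in> A" "b \<in> A" "l a < s" "s < r a" "l b < s" "s < r b" "h a s < h b s"
    and "l a \<le> t" "t \<le> r a" "l b \<le> t" "t \<le> r b"
  shows "h a t \<le> h b t"
proof -
  define f where "f = (\<lambda>x. h a x - h b x)"
  define m where "m = max (l a) (l b)"
  define n where "n = min (r a) (r b)"
  have mn: "m < n" using assms by (auto simp: m_def n_def)
  have cf: "continuous_on (closure {m<..<n}) f"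
    unfolding f_def by (intro continuous_intros continuous_on_subset[OF cont] assms) auto
  have le: "f x \<le> 0" if "x \<in> {m<..<n}" for x
    using order_kept[OF assms(1-7), of x] that by (auto simp: f_def m_def n_def)
  have "t \<in> closure {m<..<n}" using mn assms by (auto simp: m_def n_def)
  then have "f t \<le> 0" using continuous_le_on_closure[OF cf _ le] by blast
  then show ?thesis by (simp add: f_def)
qed

lemma bel_iff:
  assumes "a \<in> A" "b \<in> A" "l a < t" "t < r a" "l b < t" "t < r b"
  shows "bel a b \<longleftrightarrow> h a t < h b t"
  using assms order_kept[OF assms(1,2)] unfolding bel_def by blast

lemma not_bel_iff:
  assumes "a \<in> A" "b \<in> A" "l a < t" "t < r a" "l b < t" "t < r b" "a \<noteq> b"
  shows "\<not> bel a b \<longleftrightarrow> h b t < h a t"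
  using bel_iff[OF assms(1-6)] differ[OF assms(1-6)] assms(7) by force

lemma R_neq: "a \<in> A \<Longrightarrow> R a \<noteq> a" using R_r[of a] \<delta>_pos by force
lemma L_neq: "a \<in> A \<Longrightarrow> L a \<noteq> a" using L_l[of a] \<delta>_pos by force

lemma nxt_in: "fst s \<in> A \<Longrightarrow> fst (nxt s) \<in> A"
  by (auto simp: nxt_def Let_def R_in L_in)

section \<open>Position of a graph relative to a purely eastbound walk\<close>

context
  fixes e :: "nat \<Rightarrow> 'a" and \<theta> :: real
  assumes e: "walk e \<theta>"
begin

lemma walk_in: "e i \<in> A"
  by (induction i) (use e R_in in \<open>auto simp: walk_def\<close>)

lemma walk_Suc: "e (Suc i) = R (e i)" using e by (auto simp: walk_def)

lemma switch_bounds: "l (e i) < switch e \<theta> i" "switch e \<theta> i < r (e i)"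
proof -
  have "l (e i) < switch e \<theta> i \<and> switch e \<theta> i < r (e i)"
  proof (cases i)
    case 0 then show ?thesis using e by (auto simp: walk_def switch_def)
  next
    case (Suc j)
    then show ?thesis using R_l[OF walk_in[of j]] R_r[OF walk_in[of j]] \<delta>_pos by (auto simp: switch_def walk_Suc)
  qed
  then show "l (e i) < switch e \<theta> i" "switch e \<theta> i < r (e i)" by auto
qed

lemma switch_Suc: "switch e \<theta> (Suc i) = r (e i)" by (simp add: switch_def)

lemma switch_0: "switch e \<theta> 0 = \<theta>" by (simp add: switch_def)

lemma switch_h: "h (e (Suc i)) (r (e i)) = h (e i) (r (e i))"
  using R_h[OF walk_in] by (simp add: walk_Suc)

lemma switch_mono: "i \<le> j \<Longrightarrow> switch e \<theta> i \<le> switch e \<theta> j"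
proof (induction j)
  case (Suc j)
  then show ?case using switch_bounds(2)[of j] by (auto simp: switch_Suc le_Suc_eq)
qed auto

text \<open>The switch points tend to infinity, because each step gains at least
  \<open>\<delta>\<close>; hence some arc of the walk is active over every abscissa from
  \<open>\<theta>\<close> on.\<close>

lemma switch_grows: "\<theta> + real i * \<delta> \<le> switch e \<theta> (Suc i)"
proof (induction i)
  case 0 then show ?case using e by (auto simp: walk_def switch_def)
next
  case (Suc i)
  then show ?case using R_r[OF walk_in[of i]] by (simp add: switch_Suc walk_Suc algebra_simps)
qed

lemma active_exists:
  assumes "\<theta> \<le> t" obtains i where "switch e \<theta> i \<le> t" "t < r (e i)"
proof -
  obtain n where n: "t - \<theta> < real n * \<delta>" using reals_Archimedean3[OF \<delta>_pos] by blast
  have ex: "t < switch e \<theta> (Suc n)" using n switch_grows[of n] by simp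
  define i where "i = (LEAST i. t < switch e \<theta> (Suc i))"
  have 1: "t < switch e \<theta> (Suc i)" unfolding i_def by (rule LeastI, rule ex)
  have 2: "switch e \<theta> i \<le> t"
  proof (cases i)
    case 0 then show ?thesis using assms by (simp add: switch_0)
  next
    case (Suc j)
    then have "\<not> t < switch e \<theta> (Suc j)" unfolding i_def by (metis lessI not_less_Least)
    then show ?thesis using Suc by simp
  qed
  show thesis using that[of i] 1 2 by (simp add: switch_Suc)
qed

lemma active_unique:
  assumes "switch e \<theta> i \<le> t" "t < r (e i)" "switch e \<theta> j \<le> t" "t < r (e j)"
  shows "i = j"
proof (rule ccontr)
  assume "i \<noteq> j"
  then consider "Suc i \<le> j" | "Suc j \<le> i" by linarith
  then show False using switch_mono[of "Suc i" j] switch_mono[of "Suc j" i] assms by cases (auto simp: switch_Suc)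
qed

lemma weakly_above_forward:
  assumes c: "c \<in> A" and t: "l c < t" "t \<le> t'" "t' < r c" and "weakly_above e \<theta> c t"
  shows "weakly_above e \<theta> c t'"
proof -
  obtain i where i: "switch e \<theta> i \<le> t" "t < r (e i)" "c = e i \<or> h (e i) t < h c t"
    using assms by (auto simp: weakly_above_def)
  have "\<theta> \<le> t'" using switch_mono[of 0 i] i t by (simp add: switch_0)
  then obtain j where j: "switch e \<theta> j \<le> t'" "t' < r (e j)" using active_exists by blast
  have ij: "i \<le> j"
  proof (rule ccontr)
    assume "\<not> i \<le> j"
    then have "switch e \<theta> (Suc j) \<le> switch e \<theta> i" by (intro switch_mono) auto
    then show False using i j t by (simp add: switch_Suc)
  qed
  \<comment> \<open>The first abscissa from \<open>t\<close> on at which \<open>e k\<close> is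
    active.\<close>
  define q where "q = (\<lambda>k. max t (switch e \<theta> k))"
  have main: "k \<le> j \<Longrightarrow> c = e k \<or> h (e k) (q k) < h c (q k)" if "i \<le> k" for k
    using that
  proof (induction k rule: dec_induct)
    case base then show ?case using i by (auto simp: q_def max_def)
  next
    case (step k)
    have le: "r (e k) \<le> t'" using switch_mono[of "Suc k" j] step j by (simp add: switch_Suc)
    have lt: "t < r (e k)" using switch_mono[of "Suc i" "Suc k"] step i by (simp add: switch_Suc)
    have "c \<noteq> e k" using le t by auto
    then have less: "h (e k) (q k) < h c (q k)" using step by auto
    have "h (e k) (r (e k)) \<le> h c (r (e k))"
      by (rule order_kept_closed[OF walk_in c _ _ _ _ less])
         (use switch_bounds[of k] lt le t l_less_r[OF walk_in[of k]] in \<open>auto simp: q_def\<close>)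
    then have *: "h (e (Suc k)) (r (e k)) \<le> h c (r (e k))" by (simp add: switch_h)
    have qk: "q (Suc k) = r (e k)" using lt by (simp add: q_def switch_Suc)
    show ?case
    proof (cases "h (e (Suc k)) (r (e k)) = h c (r (e k))")
      case True
      have "e (Suc k) = c"
        by (rule differ[OF walk_in c _ _ _ _ True])
           (use switch_bounds[of "Suc k"] lt le t in \<open>auto simp: switch_Suc\<close>)
      then show ?thesis by simp
    next
      case False then show ?thesis using * qk by auto
    qed
  qed
  have "c = e j \<or> h (e j) (q j) < h c (q j)" using main[OF ij] by simp
  moreover have "h (e j) t' < h c t'" if "h (e j) (q j) < h c (q j)"
    by (rule order_kept[OF walk_in c _ _ _ _ that])
       (use switch_bounds[of j] j t in \<open>auto simp: q_def\<close>)
  ultimately show ?thesis using j by (auto simp: weakly_above_def)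
qed

text \<open>Crossing a junction backwards, \<open>e (Suc k)\<close> is replaced by
  \<open>e k\<close>, which has the same height there; by continuity a strict inequality survives
  just to the left. Equality would not: \<open>c = e (Suc k)\<close> may lie below
  \<open>e k\<close> on that side.\<close>

lemma above_backward:
  assumes c: "c \<in> A" and t: "l c < t'" "t' \<le> t" "t < r c" and "\<theta> \<le> t'" and "above e \<theta> c t"
  shows "above e \<theta> c t'"
proof -
  obtain i where i: "switch e \<theta> i \<le> t" "t < r (e i)" "h (e i) t < h c t"
    using assms by (auto simp: above_def)
  obtain j where j: "switch e \<theta> j \<le> t'" "t' < r (e j)" using active_exists \<open>\<theta> \<le> t'\<close> by blast
  have ij: "j \<le> i"
  proof (rule ccontr)
    assume "\<not> j \<le> i"
    then have "switch e \<theta> (Suc i) \<le> switch e \<theta> j" by (intro switch_mono) auto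
    then show False using i j t by (simp add: switch_Suc)
  qed
  have main: "j \<le> k \<Longrightarrow> \<exists>s. switch e \<theta> k \<le> s \<and> s < r (e k) \<and> t' \<le> s \<and> s \<le> t \<and> h (e k) s < h c s" if "k \<le> i" for k
    using that
  proof (induction k rule: inc_induct)
    case base then show ?case using i t by auto
  next
    case (step k)
    then obtain s where s: "switch e \<theta> (Suc k) \<le> s" "s < r (e (Suc k))" "t' \<le> s" "s \<le> t" "h (e (Suc k)) s < h c s" by auto
    define \<rho> where "\<rho> = r (e k)"
    have t\<rho>: "t' < \<rho>" using switch_mono[of "Suc j" "Suc k"] step j by (simp add: switch_Suc \<rho>_def)
    have \<rho>s: "\<rho> \<le> s" using s by (simp add: switch_Suc \<rho>_def)
    have "h (e (Suc k)) \<rho> < h c \<rho>"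
      by (rule order_kept[OF walk_in c _ _ _ _ s(5)])
         (use switch_bounds[of "Suc k"] s t t\<rho> \<rho>s in \<open>auto simp: switch_Suc \<rho>_def\<close>)
    then have less: "h (e k) \<rho> - h c \<rho> < 0" by (simp add: switch_h \<rho>_def)
    have "isCont (\<lambda>x. h (e k) x - h c x) \<rho>"
      using cont[OF walk_in[of k]] cont[OF c] by (auto simp: continuous_on_eq_continuous_at intro!: continuous_intros)
    then have "((\<lambda>x. h (e k) x - h c x) \<longlongrightarrow> h (e k) \<rho> - h c \<rho>) (at_left \<rho>)"
      by (simp add: isCont_def filterlim_at_split)
    then have "\<forall>\<^sub>F x in at_left \<rho>. h (e k) x - h c x < 0" using less by (rule order_tendstoD(2))
    moreover have "\<forall>\<^sub>F x in at_left \<rho>. x \<in> {max t' (switch e \<theta> k)<..<\<rho>}"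
      by (rule eventually_at_leftI[of "max t' (switch e \<theta> k)"]) (use t\<rho> switch_bounds[of k] in \<open>auto simp: \<rho>_def\<close>)
    ultimately have "\<forall>\<^sub>F x in at_left \<rho>. h (e k) x - h c x < 0 \<and> x \<in> {max t' (switch e \<theta> k)<..<\<rho>}"
      by (rule eventually_conj)
    then obtain x where "h (e k) x - h c x < 0 \<and> x \<in> {max t' (switch e \<theta> k)<..<\<rho>}"
      using eventually_happens'[of "at_left \<rho>"] by (metis (no_types, lifting) trivial_limit_at_left_real)
    then show ?case using \<rho>s s t by (intro exI[of _ x]) (auto simp: \<rho>_def)
  qed
  obtain s where s: "switch e \<theta> j \<le> s" "s < r (e j)" "t' \<le> s" "s \<le> t" "h (e j) s < h c s"
    using main[OF ij] by auto
  have "h (e j) t' < h c t'"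
    by (rule order_kept[OF walk_in c _ _ _ _ s(5)]) (use switch_bounds[of j] s j t in auto)
  then show ?thesis using j by (auto simp: above_def)
qed

lemma weakly_above_R:
  assumes c: "c \<in> A" and b: "bel (R c) c" and s: "l c \<le> s" "\<theta> \<le> s" "s < r c"
    and w: "\<And>t. s < t \<Longrightarrow> t < r c \<Longrightarrow> weakly_above e \<theta> c t"
  shows "weakly_above e \<theta> (R c) (r c)"
proof -
  define \<rho> where "\<rho> = r c"
  obtain i0 where i0: "switch e \<theta> i0 \<le> \<rho>" "\<rho> < r (e i0)" using active_exists[of \<rho>] s by (auto simp: \<rho>_def)
  \<comment> \<open>The arc active just before \<open>r c\<close> is wanted; it may end exactly at
    \<open>r c\<close>, in which case \<open>i0\<close> is its successor.\<close>
  have "\<exists>i. switch e \<theta> i < \<rho> \<and> \<rho> \<le> r (e i)"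
  proof (cases "switch e \<theta> i0 < \<rho>")
    case True then show ?thesis using i0 by (intro exI[of _ i0]) auto
  next
    case False
    then have eq: "switch e \<theta> i0 = \<rho>" using i0 by auto
    then obtain j where "i0 = Suc j" using s by (cases i0) (auto simp: switch_0 \<rho>_def)
    then show ?thesis using eq switch_bounds(2)[of j] by (intro exI[of _ j]) (auto simp: switch_Suc)
  qed
  then obtain i where i: "switch e \<theta> i < \<rho>" "\<rho> \<le> r (e i)" by blast
  obtain t where t: "max s (switch e \<theta> i) < t" "t < \<rho>" using dense[of "max s (switch e \<theta> i)" \<rho>] s i by (auto simp: \<rho>_def)
  have "weakly_above e \<theta> c t" using w t by (auto simp: \<rho>_def)
  then obtain i' where i': "switch e \<theta> i' \<le> t" "t < r (e i')" "c = e i' \<or> h (e i') t < h c t" by (auto simp: weakly_above_def)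
  have "i' = i" by (rule active_unique[of _ t]) (use i i' t in auto)
  with i' have ci: "c = e i \<or> h (e i) t < h c t" by simp
  have RcA: "R c \<in> A" using R_in c by auto
  have hb: "h (R c) \<rho> = h c \<rho>" using R_h c by (simp add: \<rho>_def)
  have Rr: "\<rho> < r (R c)" using R_r[OF c] \<delta>_pos by (simp add: \<rho>_def)
  have Rl: "l (R c) < \<rho>" using R_l[OF c] by (simp add: \<rho>_def)
  have lei: "h (e i) \<rho> \<le> h c \<rho>"
  proof (cases "c = e i")
    case False
    then have "h (e i) t < h c t" using ci by simp
    from order_kept_closed[OF walk_in c _ _ _ _ this] show ?thesis
      using switch_bounds[of i] i t s l_less_r[OF c] by (auto simp: \<rho>_def)
  qed auto
  show ?thesis
  proof (cases "\<rho> < r (e i)")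
    case True
    show ?thesis
    proof (cases "h (e i) \<rho> = h (R c) \<rho>")
      case eq: True
      have "e i = R c" by (rule differ[OF walk_in RcA _ _ _ _ eq]) (use switch_bounds[of i] i True Rr Rl in auto)
      then show ?thesis using i True unfolding weakly_above_def \<rho>_def by (intro exI[of _ i]) auto
    next
      case False
      then show ?thesis using lei hb i True unfolding weakly_above_def \<rho>_def by (intro exI[of _ i]) auto
    qed
  next
    case False
    then have eq: "r (e i) = \<rho>" using i by simp
    have *: "h (e (Suc i)) \<rho> \<le> h (R c) \<rho>" using lei hb switch_h[of i] eq by simp
    have b': "switch e \<theta> (Suc i) = \<rho>" using eq by (simp add: switch_Suc)
    show ?thesis
    proof (cases "h (e (Suc i)) \<rho> = h (R c) \<rho>")
      case eq: True
      have "e (Suc i) = R c" by (rule differ[OF walk_in RcA _ _ _ _ eq]) (use switch_bounds[of "Suc i"] b' Rr Rl in auto)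
      then show ?thesis using b' switch_bounds[of "Suc i"] unfolding weakly_above_def \<rho>_def by (intro exI[of _ "Suc i"]) auto
    next
      case False
      then show ?thesis using * b' switch_bounds[of "Suc i"] unfolding weakly_above_def \<rho>_def by (intro exI[of _ "Suc i"]) auto
    qed
  qed
qed

lemma weakly_above_L:
  assumes c: "c \<in> A" and b: "bel (L c) c" and s: "\<theta> \<le> l c" "l c < s" "s \<le> r c"
    and w: "\<And>t. l c < t \<Longrightarrow> t < s \<Longrightarrow> above e \<theta> c t"
  shows "weakly_above e \<theta> (L c) (l c)"
proof -
  define \<rho> where "\<rho> = l c"
  obtain i where i: "switch e \<theta> i \<le> \<rho>" "\<rho> < r (e i)" using active_exists[of \<rho>] s by (auto simp: \<rho>_def)
  obtain t where t: "\<rho> < t" "t < min s (r (e i))" using dense[of \<rho> "min s (r (e i))"] s i by (auto simp: \<rho>_def)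
  have "above e \<theta> c t" using w t by (auto simp: \<rho>_def)
  then obtain i' where i': "switch e \<theta> i' \<le> t" "t < r (e i')" "h (e i') t < h c t" by (auto simp: above_def)
  have "i' = i" by (rule active_unique[of _ t]) (use i i' t in auto)
  with i' have ci: "h (e i) t < h c t" by simp
  have LcA: "L c \<in> A" using L_in c by auto
  have le: "h (e i) \<rho> \<le> h c \<rho>"
    using order_kept_closed[OF walk_in c _ _ _ _ ci, of \<rho>] switch_bounds[of i] i t s l_less_r[OF c] by (auto simp: \<rho>_def)
  have hb: "h (L c) \<rho> = h c \<rho>" using L_h c by (simp add: \<rho>_def)
  show ?thesis
  proof (cases "h (e i) \<rho> = h (L c) \<rho>")
    case eq: True
    have "e i = L c" by (rule differ[OF walk_in LcA _ _ _ _ eq]) (use switch_bounds[of i] i L_r[OF c] L_l[OF c] \<delta>_pos in \<open>auto simp: \<rho>_def\<close>)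
    then show ?thesis using i unfolding weakly_above_def \<rho>_def by (intro exI[of _ i]) auto
  next
    case False
    then show ?thesis using le hb i unfolding weakly_above_def \<rho>_def by (intro exI[of _ i]) auto
  qed
qed

end

end

section \<open>The pocket between an eastbound and a westbound walk\<close>

lemma (in strip) stepE:
  defines "mabove \<equiv> strip.above (\<lambda>a. - l a) (\<lambda>a t. - h a (- t))"
    and "mweakly_above \<equiv> strip.weakly_above (\<lambda>a. - l a) (\<lambda>a t. - h a (- t))"
  assumes e: "walk e u" and g: "strip.walk A (\<lambda>a. - r a) (\<lambda>a. - l a) L g (- \<phi>)"
    and c: "c \<in> A" "l c < p" "p < r c" "u \<le> p" "r c \<le> \<phi>"
    and inv: "\<And>t. p < t \<Longrightarrow> t < r c \<Longrightarrow> weakly_above e u c t \<and> mabove g (- \<phi>) c (- t)"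
  shows "bel (R c) c \<Longrightarrow> r c < t \<Longrightarrow> t < r (R c) \<Longrightarrow> t < \<phi> \<Longrightarrow>
           weakly_above e u (R c) t \<and> mabove g (- \<phi>) (R c) (- t)"
    and "\<not> bel (R c) c \<Longrightarrow> l (R c) < t \<Longrightarrow> t < r c \<Longrightarrow> u \<le> t \<Longrightarrow>
           above e u (R c) t \<and> mweakly_above g (- \<phi>) (R c) (- t)"
proof -
  interpret m: strip A "\<lambda>a. - r a" "\<lambda>a. - l a" "\<lambda>a t. - h a (- t)" R L \<delta> by (rule mirror)
  let ?b = "R c"
  have b: "?b \<in> A" "l ?b < r c" "r c < r ?b" "?b \<noteq> c"
    using R_in R_l R_r[of c] R_neq \<delta>_pos c by auto
  obtain q where q: "max p (l ?b) < q" "q < r c" using dense[of "max p (l ?b)" "r c"] b c by auto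
  have qinv: "weakly_above e u c q" "m.above g (- \<phi>) c (- q)"
    using inv[of q] q by (auto simp: mabove_def)
  \<comment> \<open>Turning to the east: the junction is weakly above \<open>e\<close>, which is
    carried forward along \<open>e\<close>. Near the junction \<open>R c\<close> lies below
    \<open>c\<close>, hence below \<open>g\<close>, and going east is going backwards along
    \<open>g\<close>, where strictness persists.\<close>
  show "weakly_above e u (R c) t \<and> mabove g (- \<phi>) (R c) (- t)"
    if "bel (R c) c" "r c < t" "t < r (R c)" "t < \<phi>"
  proof
    have "weakly_above e u ?b (r c)"
      by (rule weakly_above_R[OF e c(1) that(1), of p]) (use c inv in auto)
    then show "weakly_above e u ?b t"
      by (rule weakly_above_forward[OF e b(1), rotated 3]) (use that b in auto)
    have "h ?b q < h c q" using bel_iff[OF b(1) c(1), of q] that(1) q b c by auto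
    then have "m.above g (- \<phi>) ?b (- q)" using qinv(2) unfolding m.above_def by force
    then have "m.above g (- \<phi>) ?b (- t)"
      by (rule m.above_backward[OF g b(1), rotated 4]) (use that b q in auto)
    then show "mabove g (- \<phi>) ?b (- t)" by (simp add: mabove_def)
  qed
  \<comment> \<open>Turning to the west exchanges the boundaries: \<open>R c\<close> is above
    \<open>c\<close>, hence strictly above \<open>e\<close>, and this is carried backwards along
    \<open>e\<close>; for \<open>g\<close> west is forward, so only the weak relation is
    kept.\<close>
  show "above e u (R c) t \<and> mweakly_above g (- \<phi>) (R c) (- t)"
    if asm: "\<not> bel (R c) c" "l (R c) < t" "t < r c" "u \<le> t"
  proof
    have cb: "h c q < h ?b q" using not_bel_iff[OF b(1) c(1), of q] that(1) q b c by auto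
    obtain q' where q': "max q t < q'" "q' < r c" using dense[of "max q t" "r c"] q asm by auto
    have cb': "h c q' < h ?b q'" by (rule order_kept[OF c(1) b(1) _ _ _ _ cb]) (use q q' b c in auto)
    have "weakly_above e u c q'" using inv[of q'] q q' by auto
    then have "above e u ?b q'" using cb' unfolding above_def weakly_above_def by force
    then show "above e u ?b t"
      by (rule above_backward[OF e b(1), rotated 4]) (use that b q' in auto)
    have mb: "m.bel ?b c"
      unfolding m.bel_def using q b c cb by (intro exI[of _ "- q"]) auto
    have "m.above g (- \<phi>) c t" if "- r c < t" "t < - p" for t
      using inv[of "- t"] that by (simp add: mabove_def)
    then have "m.weakly_above g (- \<phi>) ?b (- r c)"
      by (intro m.weakly_above_L[OF g c(1) mb, of "- p"]) (use c in auto)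
    then have "m.weakly_above g (- \<phi>) ?b (- t)"
      by (rule m.weakly_above_forward[OF g b(1), rotated 3]) (use that b in auto)
    then show "mweakly_above g (- \<phi>) ?b (- t)" by (simp add: mweakly_above_def)
  qed
qed

lemma (in strip) mirror_bel:
  assumes "a \<in> A" "b \<in> A"
  shows "strip.bel (\<lambda>a. - r a) (\<lambda>a. - l a) (\<lambda>a t. - h a (- t)) a b \<longleftrightarrow> bel b a"
proof -
  interpret m: strip A "\<lambda>a. - r a" "\<lambda>a. - l a" "\<lambda>a t. - h a (- t)" R L \<delta> by (rule mirror)
  show ?thesis unfolding m.bel_def bel_def
    by (metis minus_less_iff minus_minus neg_less_iff_less)
qed

text \<open>The half-turn of \<open>stepE\<close>: in the mirrored strip \<open>g\<close> is the
  eastbound boundary, and \<open>e\<close>, mirrored twice and thus unchanged, is the westbound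
  one.\<close>

lemma (in strip) stepW:
  defines "mabove \<equiv> strip.above (\<lambda>a. - l a) (\<lambda>a t. - h a (- t))"
    and "mweakly_above \<equiv> strip.weakly_above (\<lambda>a. - l a) (\<lambda>a t. - h a (- t))"
  assumes e: "walk e u" and g: "strip.walk A (\<lambda>a. - r a) (\<lambda>a. - l a) L g (- \<phi>)"
    and c: "c \<in> A" "l c < p" "p < r c" "p \<le> \<phi>" "u \<le> l c"
    and inv: "\<And>t. l c < t \<Longrightarrow> t < p \<Longrightarrow> above e u c t \<and> mweakly_above g (- \<phi>) c (- t)"
  shows "\<not> bel (L c) c \<Longrightarrow> t < l c \<Longrightarrow> l (L c) < t \<Longrightarrow> u < t \<Longrightarrow>
           above e u (L c) t \<and> mweakly_above g (- \<phi>) (L c) (- t)"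
    and "bel (L c) c \<Longrightarrow> t < r (L c) \<Longrightarrow> l c < t \<Longrightarrow> t \<le> \<phi> \<Longrightarrow>
           weakly_above e u (L c) t \<and> mabove g (- \<phi>) (L c) (- t)"
proof -
  interpret m: strip A "\<lambda>a. - r a" "\<lambda>a. - l a" "\<lambda>a t. - h a (- t)" R L \<delta> by (rule mirror)
  have LA: "L c \<in> A" using L_in c by auto
  have 0: "m.walk g (- \<phi>)" by (rule g)
  have 1: "strip.walk A (\<lambda>a. - (- l a)) (\<lambda>a. - (- r a)) R e (- (- u))" using e by simp
  have mirror_bel': "m.bel (L c) c \<longleftrightarrow> \<not> bel (L c) c"
  proof -
    have "max (l c) (l (L c)) < min (r c) (r (L c))" "L c \<noteq> c"
      using L_r[of c] L_l[of c] L_neq l_less_r[of c] l_less_r[OF LA] \<delta>_pos c by auto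
    then obtain q where "max (l c) (l (L c)) < q" "q < min (r c) (r (L c))" using dense by blast
    then show ?thesis using mirror_bel[OF LA c(1)] bel_iff[OF c(1) LA, of q] not_bel_iff[OF LA c(1), of q] \<open>L c \<noteq> c\<close> by auto
  qed
  have inv': "m.weakly_above g (- \<phi>) c t \<and> strip.above (\<lambda>a. - (- r a)) (\<lambda>a t. - (- h a (- (- t)))) e (- (- u)) c (- t)"
    if "- p < t" "t < - l c" for t
    using inv[of "- t"] that by (simp add: mweakly_above_def)
  have a: "- r c < - p" "- p < - l c" "- \<phi> \<le> - p" "- l c \<le> - u" using c by auto
  note st = m.stepE[OF 0 1 c(1) a inv']
  show "above e u (L c) t \<and> mweakly_above g (- \<phi>) (L c) (- t)"
    if "\<not> bel (L c) c" "t < l c" "l (L c) < t" "u < t"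
    using st(1)[of "- t"] that mirror_bel' by (simp add: mweakly_above_def)
  show "weakly_above e u (L c) t \<and> mabove g (- \<phi>) (L c) (- t)"
    if "bel (L c) c" "t < r (L c)" "l c < t" "t \<le> \<phi>"
    using st(2)[of "- t"] that mirror_bel' by (simp add: mabove_def)
qed

definition (in strip) entry :: "'a \<times> bool \<Rightarrow> real" where
  "entry s = (if snd s then r (fst s) else l (fst s))"

lemma (in strip) entry_bounds:
  assumes "fst s \<in> A"
  shows "l (fst (nxt s)) < entry s" "entry s < r (fst (nxt s))"
  using assms R_l[of "fst s"] R_r[of "fst s"] L_l[of "fst s"] L_r[of "fst s"] \<delta>_pos
  by (auto simp: nxt_def entry_def Let_def)

lemma (in strip) bel_asym:
  assumes "a \<in> A" "b \<in> A" "bel a b"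
  shows "\<not> bel b a"
proof -
  obtain t where "l a < t" "t < r a" "l b < t" "t < r b" "h a t < h b t" using assms(3) by (auto simp: bel_def)
  then show ?thesis using bel_iff[OF assms(2,1), of t] by auto
qed

text \<open>Over the fold abscissa the pocket closes to a point, where \<open>e j\<close> from below
  meets \<open>b\<close> from above. An arc of the pocket that reaches \<open>\<phi>\<close> has to
  pass through this point.\<close>

lemma (in strip) squeeze:
  assumes e: "walk e u" and \<phi>: "\<phi> = r (e j)" "b = R (e j)"
    and g: "strip.walk A (\<lambda>a. - r a) (\<lambda>a. - l a) L g (- \<phi>)" "g 0 = b"
    and c: "c \<in> A" "l c \<le> s" "u \<le> s" "s < \<phi>" "\<phi> \<le> r c"
    and inv: "\<And>t. s < t \<Longrightarrow> t < \<phi> \<Longrightarrow>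
      weakly_above e u c t \<and> strip.above (\<lambda>a. - l a) (\<lambda>a t. - h a (- t)) g (- \<phi>) c (- t)"
  shows "h c \<phi> = h b \<phi>" "bel c b"
proof -
  interpret m: strip A "\<lambda>a. - r a" "\<lambda>a. - l a" "\<lambda>a t. - h a (- t)" R L \<delta> by (rule mirror)
  have bA: "b \<in> A" using \<phi> R_in walk_in[OF e] by auto
  have ej: "e j \<in> A" "switch e u j < \<phi>" using walk_in[OF e] switch_bounds[OF e] \<phi> by auto
  have lb: "l b < \<phi>" "\<phi> < r b" using \<phi> R_l R_r[OF ej(1)] \<delta>_pos ej by auto
  obtain t where t: "max (max s (switch e u j)) (l b) < t" "t < \<phi>"
    using dense[of "max (max s (switch e u j)) (l b)" \<phi>] c ej lb by auto
  have I: "weakly_above e u c t" "m.above g (- \<phi>) c (- t)" using inv[of t] t by auto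
  obtain i where i: "switch e u i \<le> t" "t < r (e i)" "c = e i \<or> h (e i) t < h c t"
    using I(1) by (auto simp: weakly_above_def)
  have "i = j" by (rule active_unique[OF e, of _ t]) (use i t \<phi> in auto)
  with i have cj: "c = e j \<or> h (e j) t < h c t" by simp
  obtain k where k: "m.switch g (- \<phi>) k \<le> - t" "- t < - l (g k)" "- h (g k) (- (- t)) < - h c (- (- t))"
    using I(2) by (auto simp: m.above_def)
  have "k = 0" by (rule m.active_unique[OF g(1), of _ "- t"]) (use k t g in \<open>auto simp: m.switch_def\<close>)
  with k g have cb: "h c t < h b t" by simp
  show "bel c b" unfolding bel_def using t c cb lb by (intro exI[of _ t]) auto
  have 1: "h c \<phi> \<le> h b \<phi>"
    by (rule order_kept_closed[OF c(1) bA _ _ _ _ cb]) (use t c lb in auto)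
  have 2: "h (e j) \<phi> \<le> h c \<phi>"
  proof (cases "c = e j")
    case False
    then have "h (e j) t < h c t" using cj by simp
    from order_kept_closed[OF ej(1) c(1) _ _ _ _ this] show ?thesis
      using t c switch_bounds[OF e, of j] \<phi> by auto
  qed auto
  show "h c \<phi> = h b \<phi>" using 1 2 R_h[OF ej(1)] \<phi> by simp
qed

text \<open>If the left-turning walk leaves \<open>x\<close> eastwards and folds back to the west at \<open>\<phi>\<close>, it stays
  forever in the pocket between the eastbound walk from \<open>x\<close> and the westbound walk from the fold.
  A topmost point of an arc traversed eastwards cannot lie in this pocket.\<close>

lemma (in strip) no_fold:
  assumes s: "s 0 = (x, True)" "\<And>i. s (Suc i) = nxt (s i)" and x: "x \<in> A" "l x < u" "u < r x"
    and top: "\<And>c. c \<in> A \<Longrightarrow> l c < u \<Longrightarrow> u < r c \<Longrightarrow> h c u \<le> h x u"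
    and p: "s p = (x', True)" "entry (s (p - 1)) < u'" "u' < r x'"
    and top': "\<And>c. c \<in> A \<Longrightarrow> l c < u' \<Longrightarrow> u' < r c \<Longrightarrow> h c u' \<le> h x' u'"
    and "i \<le> p"
  shows "snd (s i)"
proof (rule ccontr)
  assume "\<not> snd (s i)"
  \<comment> \<open>The fold: the first westbound index, reached from the right end of
    \<open>e j\<close>.\<close>
  define n where "n = (LEAST i. \<not> snd (s i))"
  have n: "\<not> snd (s n)" unfolding n_def by (rule LeastI[of _ i]) fact
  have "n \<le> i" unfolding n_def by (rule Least_le) fact
  have n_min: "k < n \<Longrightarrow> snd (s k)" for k unfolding n_def using not_less_Least by blast
  have "n \<noteq> 0" using n s by (cases n) auto
  then obtain j where j: "n = Suc j" by (cases n) auto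
  have "p > n" using \<open>n \<le> i\<close> \<open>i \<le> p\<close> n p by (cases "n = p") auto
  have sA: "fst (s k) \<in> A" for k by (induction k) (use s x nxt_in in auto)
  define e where "e = (\<lambda>k. (R ^^ k) x)"
  have e: "walk e u" using x by (auto simp: walk_def e_def)
  note walk_in[OF e, simp]
  have es: "k \<le> j \<Longrightarrow> fst (s k) = e k" for k
  proof (induction k)
    case 0 then show ?case using s by (simp add: e_def)
  next
    case (Suc k)
    then show ?case using n_min[of k] j by (simp add: s nxt_def Let_def e_def)
  qed
  define b where "b = R (e j)"
  define \<phi> where "\<phi> = r (e j)"
  have bA: "b \<in> A" and lb: "l b < \<phi>" "\<phi> < r b" "b \<noteq> e j"
    using R_in R_l R_r[of "e j"] R_neq \<delta>_pos by (auto simp: b_def \<phi>_def)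
  have sn: "s n = (b, False)" and nb: "\<not> bel b (e j)"
    using n n_min[of j] es[of j] j by (auto simp: s nxt_def Let_def b_def)
  have u\<phi>: "u < \<phi>" using switch_mono[OF e, of 0 j] switch_bounds[OF e, of j] by (auto simp: switch_def \<phi>_def)
  interpret m: strip A "\<lambda>a. - r a" "\<lambda>a. - l a" "\<lambda>a t. - h a (- t)" R L \<delta> by (rule mirror)
  define g where "g = (\<lambda>k. (L ^^ k) b)"
  have g: "m.walk g (- \<phi>)" using bA lb by (auto simp: m.walk_def g_def)
  have g0: "g 0 = b" by (simp add: g_def)
  note sq = squeeze[OF e \<phi>_def b_def g g0]
  define en where "en = (\<lambda>k. entry (s (k - 1)))"
  define c where "c = (\<lambda>k. fst (s k))"
  have cA: "c k \<in> A" for k using sA by (simp add: c_def)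
  have en: "l (c k) < en k" "en k < r (c k)" if "k > 0" for k
    using entry_bounds[OF sA, of "k - 1"] s(2)[of "k - 1"] that by (auto simp: en_def c_def)
  \<comment> \<open>\<open>en k\<close> is the abscissa at which the walk enters \<open>c k\<close>.
    Only the part of the arc still ahead is confined, strictly below \<open>g\<close> when going
    east and strictly above \<open>e\<close> when going west.\<close>
  define E where "E = (\<lambda>k. \<forall>t. en k < t \<and> t < r (c k) \<longrightarrow>
      t < \<phi> \<and> weakly_above e u (c k) t \<and> m.above g (- \<phi>) (c k) (- t))"
  define W where "W = (\<lambda>k. \<forall>t. l (c k) < t \<and> t < en k \<longrightarrow>
      u < t \<and> above e u (c k) t \<and> m.weakly_above g (- \<phi>) (c k) (- t))"
  \<comment> \<open>The pocket is closed on the left because \<open>x\<close> is topmost over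
    \<open>u\<close>: an arc strictly above \<open>e\<close> cannot extend across
    \<open>u\<close>.\<close>
  have not_above_u: False if "above e u a u" "a \<in> A" "l a < u" "u < r a" for a
  proof -
    obtain k where k: "switch e u k \<le> u" "u < r (e k)" "h (e k) u < h a u" using \<open>above e u a u\<close> by (auto simp: above_def)
    have "k = 0" by (rule active_unique[OF e, of _ u]) (use k x in \<open>auto simp: switch_def e_def\<close>)
    then show False using k top[OF that(2-4)] by (simp add: e_def)
  qed
  have "u \<le> en k \<and> en k \<le> \<phi> \<and> (if snd (s k) then E k else W k)" if "n \<le> k" for k
    using that
  proof (induction k rule: dec_induct)
    case base
    have en: "en n = \<phi>" using es[of j] n_min[of j] j by (simp add: en_def entry_def \<phi>_def)
    have cn: "c n = b" using sn by (simp add: c_def)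
    obtain q where q: "max (max (l b) (switch e u j)) u < q" "q < \<phi>"
      using dense[of "max (max (l b) (switch e u j)) u" \<phi>] u\<phi> lb switch_bounds[OF e, of j] by (auto simp: \<phi>_def)
    have "h (e j) q < h b q"
      using not_bel_iff[OF bA walk_in[OF e], of q j] nb lb q switch_bounds[OF e, of j] by (auto simp: \<phi>_def)
    then have ab: "above e u b q" using q unfolding above_def by (intro exI[of _ j]) (auto simp: \<phi>_def)
    have ab_all: "above e u b t" if "l b < t" "t < \<phi>" "u \<le> t" for t
    proof (cases "t \<le> q")
      case True
      show ?thesis by (rule above_backward[OF e bA that(1) True _ that(3) ab]) (use q lb in auto)
    next
      case False
      have "h (e j) t < h b t"
        by (rule order_kept[OF walk_in[OF e] bA _ _ _ _ \<open>h (e j) q < h b q\<close>])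
           (use False q lb switch_bounds[OF e, of j] that in \<open>auto simp: \<phi>_def\<close>)
      then show ?thesis using that False q unfolding above_def by (intro exI[of _ j]) (auto simp: \<phi>_def)
    qed
    have "u \<le> l b" using not_above_u[OF ab_all[of u] bA] u\<phi> lb by force
    moreover have "m.weakly_above g (- \<phi>) b (- t)" if "l b < t" "t < \<phi>" for t
      unfolding m.weakly_above_def using that by (intro exI[of _ 0]) (auto simp: g0 m.switch_def)
    ultimately have "W n" using ab_all by (auto simp: W_def en cn)
    then show ?case using n en u\<phi> by simp
  next
    case (step k)
    have k0: "k > 0" using step j by auto
    have sk: "s (Suc k) = nxt (s k)" by (rule s)
    show ?case
    proof (cases "snd (s k)")
      case True
      have Ek: "E k" using step True by simp
      have enS: "en (Suc k) = r (c k)" using True by (simp add: en_def entry_def c_def)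
      have cS: "c (Suc k) = R (c k)" and dS: "snd (s (Suc k)) = bel (R (c k)) (c k)"
        using True by (auto simp: sk c_def nxt_def Let_def)
      have r\<phi>: "r (c k) \<le> \<phi>"
      proof (rule ccontr)
        assume "\<not> r (c k) \<le> \<phi>"
        then obtain t where "max (en k) \<phi> < t" "t < r (c k)" using dense[of "max (en k) \<phi>" "r (c k)"] en[OF k0] by auto
        then show False using Ek by (auto simp: E_def)
      qed
      have inv: "weakly_above e u (c k) t \<and> m.above g (- \<phi>) (c k) (- t)" if "en k < t" "t < r (c k)" for t
        using Ek that by (auto simp: E_def)
      have uen: "u \<le> en k" using step by simp
      have st1: "weakly_above e u (R (c k)) t \<and> m.above g (- \<phi>) (R (c k)) (- t)"
        if "bel (R (c k)) (c k)" "r (c k) < t" "t < r (R (c k))" "t < \<phi>" for t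
        by (rule stepE(1)[OF e g cA en(1)[OF k0] en(2)[OF k0] uen r\<phi> _ that]) (use inv in blast)
      have st2: "above e u (R (c k)) t \<and> m.weakly_above g (- \<phi>) (R (c k)) (- t)"
        if "\<not> bel (R (c k)) (c k)" "l (R (c k)) < t" "t < r (c k)" "u \<le> t" for t
        by (rule stepE(2)[OF e g cA en(1)[OF k0] en(2)[OF k0] uen r\<phi> _ that]) (use inv in blast)
      have Rc: "R (c k) \<in> A" "l (R (c k)) < r (c k)" "r (c k) < r (R (c k))" "h (R (c k)) (r (c k)) = h (c k) (r (c k))"
        using R_in[OF cA] R_l[OF cA] R_r[OF cA, of k] R_h[OF cA] \<delta>_pos by auto
      have goal1: "u \<le> en (Suc k) \<and> en (Suc k) \<le> \<phi>" using enS r\<phi> uen en[OF k0] by auto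
      show ?thesis
      proof (cases "bel (R (c k)) (c k)")
        case b: True
        \<comment> \<open>An arc ending exactly at the fold would be blocked by \<open>b\<close>
          lying below it, whereas \<open>squeeze\<close> puts it below \<open>b\<close>.\<close>
        have "r (c k) < \<phi>"
        proof (rule ccontr)
          assume "\<not> r (c k) < \<phi>"
          then have eq: "r (c k) = \<phi>" using r\<phi> by simp
          have *: "h (c k) \<phi> = h b \<phi>" "bel (c k) b"
            using sq[OF cA, of k "en k"] en[OF k0] uen inv eq by auto
          have "R (c k) = b" by (rule differ[OF Rc(1) bA, of \<phi>]) (use Rc lb * eq in auto)
          then show False using b *(2) bel_asym[OF cA bA] by simp
        qed
        \<comment> \<open>Running across the fold, the new arc would coincide with \<open>b\<close>
          and yet lie below it.\<close>
        moreover have "r (R (c k)) \<le> \<phi>"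
        proof (rule ccontr)
          assume "\<not> r (R (c k)) \<le> \<phi>"
          then have lt: "\<phi> < r (R (c k))" by simp
          have *: "h (R (c k)) \<phi> = h b \<phi>" "bel (R (c k)) b"
            using sq[OF Rc(1), of "r (c k)"] st1[OF b] Rc lt \<open>r (c k) < \<phi>\<close> uen en[OF k0] by auto
          have "R (c k) = b" by (rule differ[OF Rc(1) bA, of \<phi>]) (use Rc lb * lt \<open>r (c k) < \<phi>\<close> in auto)
          then show False using *(2) by (auto simp: bel_def)
        qed
        ultimately have "E (Suc k)" unfolding E_def enS cS using st1[OF b] by force
        then show ?thesis using goal1 b dS by simp
      next
        case b: False
        have lu: "u \<le> l (R (c k))"
        proof (rule ccontr)
          assume "\<not> u \<le> l (R (c k))"
          then show False using not_above_u[of "R (c k)"] st2[OF b, of u] Rc uen en[OF k0] by auto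
        qed
        then have "W (Suc k)" unfolding W_def enS cS using st2[OF b] by force
        then show ?thesis using goal1 b dS by simp
      qed
    next
      case False
      have Wk: "W k" using step False by simp
      have enS: "en (Suc k) = l (c k)" using False by (simp add: en_def entry_def c_def)
      have cS: "c (Suc k) = L (c k)" and dS: "snd (s (Suc k)) = bel (L (c k)) (c k)"
        using False by (auto simp: sk c_def nxt_def Let_def)
      have lu: "u \<le> l (c k)"
      proof (rule ccontr)
        assume "\<not> u \<le> l (c k)"
        then obtain t where "l (c k) < t" "t < min (en k) u" using dense[of "l (c k)" "min (en k) u"] en[OF k0] by auto
        then show False using Wk by (auto simp: W_def)
      qed
      have inv: "above e u (c k) t \<and> m.weakly_above g (- \<phi>) (c k) (- t)" if "l (c k) < t" "t < en k" for t
        using Wk that by (auto simp: W_def)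
      have en\<phi>: "en k \<le> \<phi>" using step by simp
      have st1: "above e u (L (c k)) t \<and> m.weakly_above g (- \<phi>) (L (c k)) (- t)"
        if "\<not> bel (L (c k)) (c k)" "t < l (c k)" "l (L (c k)) < t" "u < t" for t
        by (rule stepW(1)[OF e g cA en(1)[OF k0] en(2)[OF k0] en\<phi> lu _ that]) (use inv in blast)
      have st2: "weakly_above e u (L (c k)) t \<and> m.above g (- \<phi>) (L (c k)) (- t)"
        if "bel (L (c k)) (c k)" "t < r (L (c k))" "l (c k) < t" "t \<le> \<phi>" for t
        by (rule stepW(2)[OF e g cA en(1)[OF k0] en(2)[OF k0] en\<phi> lu _ that]) (use inv in blast)
      have Lc: "L (c k) \<in> A" "l (L (c k)) < l (c k)" "l (c k) < r (L (c k))" "h (L (c k)) (l (c k)) = h (c k) (l (c k))"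
        using L_in[OF cA] L_r[OF cA] L_l[OF cA, of k] L_h[OF cA] \<delta>_pos by auto
      have goal1: "u \<le> en (Suc k) \<and> en (Suc k) \<le> \<phi>" using enS lu en\<phi> en[OF k0] by auto
      show ?thesis
      proof (cases "bel (L (c k)) (c k)")
        case b: True
        have lt\<phi>: "l (c k) < \<phi>" using en\<phi> en[OF k0] by simp
        have "r (L (c k)) \<le> \<phi>"
        proof (rule ccontr)
          assume "\<not> r (L (c k)) \<le> \<phi>"
          then have lt: "\<phi> < r (L (c k))" by simp
          have *: "h (L (c k)) \<phi> = h b \<phi>" "bel (L (c k)) b"
            using sq[OF Lc(1), of "l (c k)"] st2[OF b] Lc lt lt\<phi> lu by auto
          have "L (c k) = b" by (rule differ[OF Lc(1) bA, of \<phi>]) (use Lc lb * lt lt\<phi> in auto)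
          then show False using *(2) by (auto simp: bel_def)
        qed
        then have "E (Suc k)" unfolding E_def enS cS using st2[OF b] by force
        then show ?thesis using goal1 b dS by simp
      next
        case b: False
        \<comment> \<open>An arc with left end exactly over \<open>u\<close> would end on
          \<open>x\<close>, the topmost arc there. Since \<open>x\<close> lies below it, the walk
          would turn east, contrary to the case at hand.\<close>
        have "u < l (c k)"
        proof (rule ccontr)
          assume "\<not> u < l (c k)"
          then have eq: "l (c k) = u" using lu by simp
          obtain q where q: "l (c k) < q" "q < Min {en k, r (e 0), r (c k)}"
            using dense[of "l (c k)" "Min {en k, r (e 0), r (c k)}"] en[OF k0] eq x l_less_r[OF cA, of k] by (auto simp: e_def)
          have "above e u (c k) q" using inv[of q] q by auto
          then obtain i where i: "switch e u i \<le> q" "q < r (e i)" "h (e i) q < h (c k) q" by (auto simp: above_def)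
          have "i = 0" by (rule active_unique[OF e, of _ q]) (use i q eq in \<open>auto simp: switch_def\<close>)
          then have xq: "h x q < h (c k) q" using i by (simp add: e_def)
          have "h x u \<le> h (c k) u"
            by (rule order_kept_closed[OF x(1) cA _ _ _ _ xq]) (use q x eq l_less_r[OF cA, of k] in \<open>auto simp: e_def\<close>)
          then have "h (L (c k)) u = h x u" using top[OF Lc(1)] Lc eq by simp
          then have "L (c k) = x" by (intro differ[OF Lc(1) x(1), of u]) (use Lc eq x in auto)
          moreover have "bel x (c k)" unfolding bel_def using xq q x eq by (intro exI[of _ q]) (auto simp: e_def)
          ultimately show False using b by simp
        qed
        have "u \<le> l (L (c k))"
        proof (rule ccontr)
          assume "\<not> u \<le> l (L (c k))"
          obtain q where q: "u < q" "q < l (c k)" using dense \<open>u < l (c k)\<close> by blast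
          have "above e u (L (c k)) q" using st1[OF b, of q] q \<open>\<not> u \<le> l (L (c k))\<close> by auto
          then have "above e u (L (c k)) u"
            by (rule above_backward[OF e Lc(1), rotated 4]) (use q Lc \<open>\<not> u \<le> l (L (c k))\<close> in auto)
          then show False using not_above_u[of "L (c k)"] Lc \<open>\<not> u \<le> l (L (c k))\<close> q by auto
        qed
        then have "W (Suc k)" unfolding W_def enS cS using st1[OF b] by force
        then show ?thesis using goal1 b dS by simp
      qed
    qed
  qed
  \<comment> \<open>At step \<open>p\<close> the walk is eastbound, hence strictly below an arc of
    \<open>g\<close> over \<open>u'\<close>, against \<open>top'\<close>.\<close>
  from this[of p] have "E p" using \<open>p > n\<close> p by simp
  then have "m.above g (- \<phi>) x' (- u')" using p by (auto simp: E_def en_def c_def)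
  then obtain k where k: "m.switch g (- \<phi>) k \<le> - u'" "- u' < - l (g k)" "h x' u' < h (g k) u'"
    by (auto simp: m.above_def)
  have "l (g k) < u'" "u' < r (g k)" using k m.switch_bounds[OF g, of k] by auto
  then show False using top'[OF m.walk_in[OF g]] k by force
qed

text \<open>One step changes the entry abscissa by at most \<open>\<Lambda>\<close>. A walk released
  on the boundary \<open>e\<close> at distance \<open>N * \<Lambda>\<close> from the beginning of
  \<open>e\<close> thus cannot slip around that beginning within \<open>N\<close> steps, and it
  cannot cross \<open>e\<close>. A westbound arc is then strictly above \<open>e\<close> ahead, so
  it is bottommost nowhere on that part.\<close>

lemma (in strip) stay_above:
  assumes e: "walk e \<theta>" and len: "\<And>a. a \<in> A \<Longrightarrow> r a - l a \<le> \<Lambda>"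
    and start: "\<theta> + real N * \<Lambda> \<le> switch e \<theta> m"
    and s: "s 0 = (e m, True)" "\<And>i. s (Suc i) = nxt (s i)"
    and i: "0 < i" "i < N" "s i = (x, False)" "l x < u" "u < entry (s (i - 1))"
    and bottom: "\<And>c. c \<in> A \<Longrightarrow> l c < u \<Longrightarrow> u < r c \<Longrightarrow> h x u \<le> h c u"
  shows False
proof -
  note walk_in[OF e, simp]
  define en where "en = (\<lambda>k. if k = 0 then switch e \<theta> m else entry (s (k - 1)))"
  define c where "c = (\<lambda>k. fst (s k))"
  have cA: "c k \<in> A" for k unfolding c_def by (induction k) (use s nxt_in in auto)
  have en: "l (c k) < en k \<and> en k < r (c k)" for k
  proof (cases k)
    case 0 then show ?thesis using switch_bounds[OF e, of m] s by (simp add: en_def c_def)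
  next
    case (Suc j)
    then show ?thesis using entry_bounds[OF cA[of j, unfolded c_def]] s(2)[of j] by (simp add: en_def c_def)
  qed
  have \<Lambda>: "\<Lambda> > 0" using len[of "e 0"] l_less_r[of "e 0"] by force
  define J where "J = (\<lambda>k. if snd (s k) then \<forall>t. en k < t \<and> t < r (c k) \<longrightarrow> weakly_above e \<theta> (c k) t
      else \<forall>t. l (c k) < t \<and> t < en k \<and> \<theta> \<le> t \<longrightarrow> above e \<theta> (c k) t)"
  have main: "\<theta> + real (N - k) * \<Lambda> \<le> en k \<and> J k" if "k < N" for k
    using that
  proof (induction k)
    case 0
    have "weakly_above e \<theta> (e m) t" if "switch e \<theta> m < t" "t < r (e m)" for t
      unfolding weakly_above_def using that by (intro exI[of _ m]) auto
    then show ?case using start s by (simp add: J_def en_def c_def)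
  next
    case (Suc k)
    have IH: "\<theta> + real (N - k) * \<Lambda> \<le> en k" "J k" using Suc by auto
    have Nk: "real (N - k) * \<Lambda> = real (N - Suc k) * \<Lambda> + \<Lambda>"
      using Suc.prems by (simp add: of_nat_diff algebra_simps)
    have "0 \<le> real (N - Suc k) * \<Lambda>" using \<Lambda> by simp
    have sk: "s (Suc k) = nxt (s k)" by (rule s)
    show ?case
    proof (cases "snd (s k)")
      case True
      have E: "weakly_above e \<theta> (c k) t" if "en k < t" "t < r (c k)" for t
        using IH(2) True that by (simp add: J_def)
      have enS: "en (Suc k) = r (c k)" using True by (simp add: en_def entry_def c_def)
      have cS: "c (Suc k) = R (c k)" and dS: "snd (s (Suc k)) = bel (R (c k)) (c k)"
        using True by (auto simp: sk c_def nxt_def Let_def)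
      have Rc: "R (c k) \<in> A" "l (R (c k)) < r (c k)" "r (c k) < r (R (c k))" "R (c k) \<noteq> c k"
        using R_in[OF cA] R_l[OF cA] R_r[OF cA, of k] R_neq[OF cA] \<delta>_pos by auto
      have bound: "\<theta> + real (N - Suc k) * \<Lambda> \<le> en (Suc k)" using IH(1) Nk en[of k] enS \<Lambda> by linarith
      have \<theta>en: "\<theta> \<le> en k" using IH(1) \<Lambda> Nk \<open>0 \<le> real (N - Suc k) * \<Lambda>\<close> by linarith
      have "J (Suc k)"
      proof (cases "bel (R (c k)) (c k)")
        case b: True
        have w: "weakly_above e \<theta> (R (c k)) (r (c k))"
          by (rule weakly_above_R[OF e cA b, of "en k"]) (use en[of k] \<theta>en E in auto)
        have "weakly_above e \<theta> (R (c k)) t" if "r (c k) < t" "t < r (R (c k))" for t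
          by (rule weakly_above_forward[OF e Rc(1) _ _ _ w]) (use that Rc in auto)
        then show ?thesis using b by (simp add: J_def dS cS enS)
      next
        case b: False
        have "above e \<theta> (R (c k)) t" if t: "l (R (c k)) < t" "t < r (c k)" "\<theta> \<le> t" for t
        proof -
          obtain q where q: "max (en k) t < q" "q < r (c k)" using dense[of "max (en k) t" "r (c k)"] en[of k] t by auto
          have "h (c k) q < h (R (c k)) q" using not_bel_iff[OF Rc(1) cA, of q] b q en[of k] t Rc by auto
          then have "above e \<theta> (R (c k)) q" using E[of q] q unfolding above_def weakly_above_def by force
          then show ?thesis by (rule above_backward[OF e Rc(1), rotated 4]) (use q t Rc in auto)
        qed
        then show ?thesis using b by (simp add: J_def dS cS enS)
      qed
      then show ?thesis using bound by simp
    next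
      case False
      have W: "above e \<theta> (c k) t" if "l (c k) < t" "t < en k" "\<theta> \<le> t" for t
        using IH(2) False that by (simp add: J_def)
      have enS: "en (Suc k) = l (c k)" using False by (simp add: en_def entry_def c_def)
      have cS: "c (Suc k) = L (c k)" and dS: "snd (s (Suc k)) = bel (L (c k)) (c k)"
        using False by (auto simp: sk c_def nxt_def Let_def)
      have Lc: "L (c k) \<in> A" "l (L (c k)) < l (c k)" "l (c k) < r (L (c k))" "L (c k) \<noteq> c k"
        using L_in[OF cA] L_r[OF cA] L_l[OF cA, of k] L_neq[OF cA] \<delta>_pos by auto
      have bound: "\<theta> + real (N - Suc k) * \<Lambda> \<le> en (Suc k)"
        using IH(1) Nk en[of k] enS len[OF cA, of k] by linarith
      have \<theta>l: "\<theta> \<le> l (c k)" using bound enS \<open>0 \<le> real (N - Suc k) * \<Lambda>\<close> by linarith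
      have "J (Suc k)"
      proof (cases "bel (L (c k)) (c k)")
        case b: True
        have w: "weakly_above e \<theta> (L (c k)) (l (c k))"
          by (rule weakly_above_L[OF e cA b \<theta>l, of "en k"]) (use en[of k] \<theta>l W in auto)
        have "weakly_above e \<theta> (L (c k)) t" if "l (c k) < t" "t < r (L (c k))" for t
          by (rule weakly_above_forward[OF e Lc(1) _ _ _ w]) (use that Lc in auto)
        then show ?thesis using b by (simp add: J_def dS cS enS)
      next
        case b: False
        have "above e \<theta> (L (c k)) t" if t: "l (L (c k)) < t" "t < l (c k)" "\<theta> \<le> t" for t
        proof -
          obtain q where q: "l (c k) < q" "q < min (en k) (r (L (c k)))"
            using dense[of "l (c k)" "min (en k) (r (L (c k)))"] en[of k] Lc by auto
          have "h (c k) q < h (L (c k)) q" using not_bel_iff[OF Lc(1) cA, of q] b q en[of k] Lc by auto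
          then have "above e \<theta> (L (c k)) q" using W[of q] q \<theta>l unfolding above_def by force
          then show ?thesis by (rule above_backward[OF e Lc(1), rotated 4]) (use q t Lc in auto)
        qed
        then show ?thesis using b by (simp add: J_def dS cS enS)
      qed
      then show ?thesis using bound by simp
    qed
  qed
  have ci: "c i = x" "en i = entry (s (i - 1))" using i by (auto simp: c_def en_def)
  have "\<Lambda> \<le> real (N - i) * \<Lambda>" using i \<Lambda> by simp
  then have "\<theta> \<le> l (c i)" using conjunct1[OF main[OF i(2)]] len[OF cA, of i] en[of i] by linarith
  then have "\<theta> \<le> l x" using ci by simp
  then have "above e \<theta> x u" using main[OF i(2)] i ci by (auto simp: J_def)
  then obtain k where "switch e \<theta> k \<le> u" "u < r (e k)" "h (e k) u < h x u" by (auto simp: above_def)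
  then show False using bottom[of "e k"] switch_bounds[OF e, of k] by auto
qed

lemma (in strip) mirror_nxt:
  assumes "fst s \<in> A"
  shows "strip.nxt (\<lambda>a. - r a) (\<lambda>a. - l a) (\<lambda>a t. - h a (- t)) R L (fst s, \<not> snd s) = (fst (nxt s), \<not> snd (nxt s))"
proof -
  interpret m: strip A "\<lambda>a. - r a" "\<lambda>a. - l a" "\<lambda>a t. - h a (- t)" R L \<delta> by (rule mirror)
  define b where "b = fst (nxt s)"
  have b: "b \<in> A" using nxt_in assms by (simp add: b_def)
  have "max (l (fst s)) (l b) < min (r (fst s)) (r b)" "b \<noteq> fst s"
    using R_l[OF assms] R_r[OF assms] L_l[OF assms] L_r[OF assms] l_less_r[OF assms] l_less_r[OF b] \<delta>_pos
      R_neq[OF assms] L_neq[OF assms] by (auto simp: b_def nxt_def Let_def)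
  then obtain q where "max (l (fst s)) (l b) < q" "q < min (r (fst s)) (r b)" using dense by blast
  then have "m.bel b (fst s) \<longleftrightarrow> \<not> bel b (fst s)"
    using mirror_bel[OF b assms] bel_iff[OF assms b, of q] not_bel_iff[OF b assms, of q] \<open>b \<noteq> fst s\<close> by auto
  then show ?thesis by (auto simp: nxt_def m.nxt_def Let_def b_def)
qed

text \<open>The half-turn of \<open>stay_above\<close>; \<open>l (g (m - 1))\<close> is the abscissa
  at which the westbound walk moves onto \<open>g m\<close>.\<close>

lemma (in strip) stay_below:
  assumes g: "strip.walk A (\<lambda>a. - r a) (\<lambda>a. - l a) L g (- \<phi>)" and len: "\<And>a. a \<in> A \<Longrightarrow> r a - l a \<le> \<Lambda>"
    and start: "0 < m" "l (g (m - 1)) \<le> \<phi> - real N * \<Lambda>"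
    and s: "s 0 = (g m, False)" "\<And>i. s (Suc i) = nxt (s i)"
    and i: "0 < i" "i < N" "s i = (x, True)" "entry (s (i - 1)) < u" "u < r x"
    and top: "\<And>c. c \<in> A \<Longrightarrow> l c < u \<Longrightarrow> u < r c \<Longrightarrow> h c u \<le> h x u"
  shows False
proof -
  interpret m: strip A "\<lambda>a. - r a" "\<lambda>a. - l a" "\<lambda>a t. - h a (- t)" R L \<delta> by (rule mirror)
  define s' where "s' = (\<lambda>i. (fst (s i), \<not> snd (s i)))"
  have sA: "fst (s k) \<in> A" for k by (induction k) (use s m.walk_in[OF g] nxt_in in auto)
  have s': "s' (Suc k) = m.nxt (s' k)" for k
    using mirror_nxt[OF sA[of k]] by (simp add: s'_def s(2))
  have en: "m.entry (s' k) = - entry (s k)" for k by (simp add: m.entry_def entry_def s'_def)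
  have sw: "- \<phi> + real N * \<Lambda> \<le> m.switch g (- \<phi>) m" using start by (cases m) (auto simp: m.switch_def)
  show False
    by (rule m.stay_above[OF g _ sw, of s' i x "- u"])
       (use len s s' i en top in \<open>auto simp: s'_def\<close>)
qed

subsection \<open>Directed arcs and left turns\<close>

lemma det3_coords:
  "det3 a b c = a$1 * (b$2 * c$3 - b$3 * c$2) + a$2 * (b$3 * c$1 - b$1 * c$3) + a$3 * (b$1 * c$2 - b$2 * c$1)"
  by (simp add: det3_def cross3_def inner_vec_def sum_3 algebra_simps)

lemma det3_linear:
  "det3 (x *\<^sub>R a + y *\<^sub>R b) c d = x * det3 a c d + y * det3 b c d"
  "det3 c (x *\<^sub>R a + y *\<^sub>R b) d = x * det3 c a d + y * det3 c b d"
  "det3 c d (x *\<^sub>R a + y *\<^sub>R b) = x * det3 c d a + y * det3 c d b"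
  by (simp_all add: det3_coords algebra_simps)

lemma det3_scaleR:
  "det3 (x *\<^sub>R a) b c = x * det3 a b c" "det3 a (x *\<^sub>R b) c = x * det3 a b c" "det3 a b (x *\<^sub>R c) = x * det3 a b c"
  by (simp_all add: det3_coords algebra_simps)

lemma det3_same: "det3 a a c = 0" "det3 a b a = 0" "det3 a b b = 0"
  by (simp_all add: det3_coords algebra_simps)

lemma det3_swap: "det3 b a c = - det3 a b c" "det3 a c b = - det3 a b c" "det3 c b a = - det3 a b c"
  by (simp_all add: det3_coords algebra_simps)

lemma det3_rotate: "det3 b c a = det3 a b c"
  by (simp add: det3_coords algebra_simps)

definition indep :: "pt \<Rightarrow> pt \<Rightarrow> bool" where
  "indep a b \<longleftrightarrow> cross3 a b \<noteq> 0"

lemma indep_sym: "indep a b \<longleftrightarrow> indep b a"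
  using cross_skew[of a b] by (auto simp: indep_def)

lemma indep_comb_eq_0:
  assumes "indep a b" "x *\<^sub>R a + y *\<^sub>R b = 0"
  shows "x = 0" "y = 0"
proof -
  have "cross3 (x *\<^sub>R a + y *\<^sub>R b) b = x *\<^sub>R cross3 a b" "cross3 a (x *\<^sub>R a + y *\<^sub>R b) = y *\<^sub>R cross3 a b"
    by (simp_all add: cross_add_left cross_add_right cross_mult_left cross_mult_right)
  then show "x = 0" "y = 0" using assms by (auto simp: indep_def)
qed

lemma indep_comb_unique:
  assumes "indep a b" "x *\<^sub>R a + y *\<^sub>R b = x' *\<^sub>R a + y' *\<^sub>R b"
  shows "x = x'" "y = y'"
proof -
  have "(x - x') *\<^sub>R a + (y - y') *\<^sub>R b = 0" using assms(2) by (simp add: algebra_simps)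
  then show "x = x'" "y = y'" using indep_comb_eq_0[OF assms(1)] by fastforce+
qed

lemma indep_decompose:
  assumes "indep a b" "det3 a b c = 0"
  obtains x y where "c = x *\<^sub>R a + y *\<^sub>R b"
proof -
  \<comment> \<open>Cramer's rule in the basis \<open>a\<close>, \<open>b\<close>, \<open>m\<close>,
    whose determinant is \<open>k\<close>; the component of \<open>c\<close> along \<open>m\<close>
    vanishes.\<close>
  define m where "m = cross3 a b"
  define k where "k = inner m m"
  have k: "k \<noteq> 0" using assms(1) by (simp add: k_def m_def indep_def)
  have z: "c$1 * (a$2*b$3 - a$3*b$2) + c$2 * (a$3*b$1 - a$1*b$3) + c$3 * (a$1*b$2 - a$2*b$1) = 0"
    using assms(2) by (simp add: det3_coords algebra_simps)
  have "k *\<^sub>R c = det3 c b m *\<^sub>R a + det3 a c m *\<^sub>R b"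
  proof (simp add: vec_eq_iff forall_3, intro conjI)
    show "k * c$1 = det3 c b m * a$1 + det3 a c m * b$1" "k * c$2 = det3 c b m * a$2 + det3 a c m * b$2"
      "k * c$3 = det3 c b m * a$3 + det3 a c m * b$3"
      unfolding k_def m_def det3_coords inner_vec_def sum_3 cross3_def using z
      by (simp, algebra)+
  qed
  then have "c = (det3 c b m / k) *\<^sub>R a + (det3 a c m / k) *\<^sub>R b"
    using k by (metis (no_types, lifting) divide_inverse_commute scaleR_add_right scaleR_scaleR scaleR_one left_inverse mult.commute)
  then show thesis using that by blast
qed

lemma valid_arc_indep:
  assumes "valid_arc a" shows "indep (fst a) (snd a)"
  unfolding indep_def
proof
  assume "cross3 (fst a) (snd a) = 0"
  then have "collinear {0, fst a, snd a}" by (simp add: cross_eq_0)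
  then consider "fst a = 0" | "snd a = 0" | c where "snd a = c *\<^sub>R fst a" by (auto simp: collinear_lemma)
  then show False
  proof cases
    case 1 then show False using assms by (auto simp: valid_arc_def S2_def)
  next
    case 2 then show False using assms by (auto simp: valid_arc_def S2_def)
  next
    case 3
    then have "\<bar>c\<bar> = 1" using assms by (auto simp: valid_arc_def S2_def)
    then have "c = 1 \<or> c = -1" by linarith
    then show False using assms 3 by (auto simp: valid_arc_def)
  qed
qed

text \<open>The interior of an arc up to positive scaling. The open planar cone is given by linear
  conditions, which avoids normalisation by \<open>sgn\<close>.\<close>

definition in_cone :: "pt \<Rightarrow> arc \<Rightarrow> bool" where
  "in_cone p a \<longleftrightarrow> (\<exists>x>0. \<exists>y>0. p = x *\<^sub>R fst a + y *\<^sub>R snd a)"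

lemma det3_in_cone: "in_cone p s \<Longrightarrow> det3 (fst s) (snd s) p = 0"
  by (auto simp: in_cone_def det3_linear det3_same)

lemma in_cone_swap: "in_cone p (prod.swap a) \<longleftrightarrow> in_cone p a"
  unfolding in_cone_def fst_swap snd_swap by (metis add.commute)

lemma in_cone_scaleR:
  assumes "in_cone p a" "c > 0" shows "in_cone (c *\<^sub>R p) a"
proof -
  obtain x y where "x > 0" "y > 0" "p = x *\<^sub>R fst a + y *\<^sub>R snd a" using assms(1) by (auto simp: in_cone_def)
  then show ?thesis unfolding in_cone_def using assms(2)
    by (intro exI[of _ "c * x"] conjI exI[of _ "c * y"]) (auto simp: scaleR_add_right)
qed

lemma sgn_scaleR_S2: "p \<in> S2 \<Longrightarrow> c > 0 \<Longrightarrow> sgn (c *\<^sub>R p) = p"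
  by (auto simp: S2_def sgn_div_norm)

lemma arc_int_iff:
  assumes "valid_arc a"
  shows "p \<in> arc_int a \<longleftrightarrow> p \<in> S2 \<and> in_cone p a"
proof
  assume "p \<in> arc_int a"
  then obtain t where t: "0 < t" "t < 1" and p: "p = sgn ((1 - t) *\<^sub>R fst a + t *\<^sub>R snd a)" by (auto simp: arc_int_def)
  define q where "q = (1 - t) *\<^sub>R fst a + t *\<^sub>R snd a"
  have "q \<noteq> 0" using indep_comb_eq_0[OF valid_arc_indep[OF assms], of "1 - t" t] t by (auto simp: q_def)
  moreover have "in_cone q a" using t unfolding in_cone_def q_def by (intro exI[of _ "1 - t"] conjI exI[of _ t]) auto
  ultimately show "p \<in> S2 \<and> in_cone p a"
    using in_cone_scaleR[of q a "inverse (norm q)"] p by (auto simp: S2_def norm_sgn sgn_div_norm q_def[symmetric])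
next
  assume "p \<in> S2 \<and> in_cone p a"
  then obtain x y where xy: "x > 0" "y > 0" "p = x *\<^sub>R fst a + y *\<^sub>R snd a" and pS: "p \<in> S2" by (auto simp: in_cone_def)
  define t where "t = y / (x + y)"
  have "1 - t = x / (x + y)" using xy by (simp add: t_def field_simps)
  then have "(1 - t) *\<^sub>R fst a + t *\<^sub>R snd a = (1 / (x + y)) *\<^sub>R p" using xy by (simp add: t_def scaleR_add_right)
  then have "p = sgn ((1 - t) *\<^sub>R fst a + t *\<^sub>R snd a)" using sgn_scaleR_S2[OF pS, of "1 / (x + y)"] xy by simp
  then show "p \<in> arc_int a" using xy unfolding arc_int_def by (auto intro!: exI[of _ t] simp: t_def)
qed

definition states :: "arc set \<Rightarrow> arc set" where
  "states D = D \<union> prod.swap ` D"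

lemma states_cases:
  assumes "s \<in> states D" obtains a where "a \<in> D" "s = a" | a where "a \<in> D" "s = prod.swap a"
  using assms unfolding states_def by blast

lemma swap_states: "s \<in> states D \<Longrightarrow> prod.swap s \<in> states D"
  by (auto simp: states_def)

definition blocker :: "arc set \<Rightarrow> pt \<Rightarrow> arc" where
  "blocker D p = (THE a. a \<in> D \<and> p \<in> arc_int a)"

text \<open>The arc blocking \<open>s\<close> at its head, directed away to the left.\<close>

definition turn :: "arc set \<Rightarrow> arc \<Rightarrow> arc" where
  "turn D s = (let a = blocker D (snd s) in if det3 (fst s) (snd s) (snd a) > 0 then a else prod.swap a)"

locale diagram =
  fixes D :: "arc set"
  assumes SD: "SD D"
begin

lemma finite_D: "finite D" and valid: "a \<in> D \<Longrightarrow> valid_arc a"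
  using SD by (auto simp: SD_def)

lemma finite_states: "finite (states D)" using finite_D by (simp add: states_def)

lemma state_indep: "s \<in> states D \<Longrightarrow> indep (fst s) (snd s)"
  using valid_arc_indep[OF valid] by (auto simp: states_def indep_sym)

lemma state_S2: assumes "s \<in> states D" shows "fst s \<in> S2" "snd s \<in> S2"
proof -
  have "fst s \<in> S2 \<and> snd s \<in> S2"
    using assms by (rule states_cases) (use valid in \<open>auto simp: valid_arc_def\<close>)
  then show "fst s \<in> S2" "snd s \<in> S2" by auto
qed

lemma swap_not_in: assumes "a \<in> D" shows "prod.swap a \<notin> D"
proof
  assume s: "prod.swap a \<in> D"
  have ne: "a \<noteq> prod.swap a" using valid[OF assms] by (cases a) (auto simp: valid_arc_def)
  define p where "p = sgn ((1 - 1/2) *\<^sub>R fst a + (1/2) *\<^sub>R snd a)"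
  have "p \<in> arc_int a" "p \<in> arc_int (prod.swap a)"
    unfolding arc_int_def p_def by (auto intro!: exI[of _ "1/2"] simp: add.commute)
  then show False using SD assms s ne by (auto simp: SD_def)
qed

lemma cones_disjoint:
  assumes "a \<in> states D" "b \<in> states D" "in_cone p a" "in_cone p b"
  shows "b = a \<or> b = prod.swap a"
proof -
  obtain a' where a': "a' \<in> D" "a = a' \<or> a = prod.swap a'" using assms(1) states_cases by metis
  obtain b' where b': "b' \<in> D" "b = b' \<or> b = prod.swap b'" using assms(2) states_cases by metis
  have c: "in_cone p a'" "in_cone p b'" using assms a' b' in_cone_swap by metis+
  have "p \<noteq> 0" using c(1) indep_comb_eq_0[OF valid_arc_indep[OF valid[OF a'(1)]]]
    unfolding in_cone_def by (metis less_irrefl)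
  then have "sgn p \<in> S2" by (simp add: S2_def norm_sgn)
  moreover have "in_cone (sgn p) a'" "in_cone (sgn p) b'"
    using in_cone_scaleR[OF c(1)] in_cone_scaleR[OF c(2)] \<open>p \<noteq> 0\<close> by (auto simp: sgn_div_norm)
  ultimately have "sgn p \<in> arc_int a' \<inter> arc_int b'" using arc_int_iff valid a' b' by auto
  then have "a' = b'" using SD a' b' by (auto simp: SD_def)
  then show ?thesis using a' b' by auto
qed

lemma blocked:
  assumes "s \<in> states D" obtains b where "b \<in> D" "in_cone (snd s) b"
proof -
  have "\<exists>b\<in>D. snd s \<in> arc_int b" using assms SD by (auto simp: states_def SD_def)
  then show thesis using that arc_int_iff valid by blast
qed

lemma blocker:
  assumes "s \<in> states D"
  shows "blocker D (snd s) \<in> D" "in_cone (snd s) (blocker D (snd s))"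
proof -
  obtain b where b: "b \<in> D" "in_cone (snd s) b" using blocked[OF assms] .
  have "blocker D (snd s) = b"
    unfolding blocker_def
  proof (rule the_equality)
    show "b \<in> D \<and> snd s \<in> arc_int b" using b arc_int_iff[OF valid] state_S2(2)[OF assms] by blast
    fix a assume "a \<in> D \<and> snd s \<in> arc_int a"
    then have "a \<in> D" "in_cone (snd s) a" using arc_int_iff[OF valid[of a]] by auto
    then have "a = b \<or> a = prod.swap b" using cones_disjoint[of b a] b by (auto simp: states_def)
    then show "a = b" using swap_not_in[OF b(1)] \<open>a \<in> D\<close> by auto
  qed
  then show "blocker D (snd s) \<in> D" "in_cone (snd s) (blocker D (snd s))" using b by auto
qed

lemma not_in_own_cone: "s \<in> states D \<Longrightarrow> \<not> in_cone (snd s) s" "s \<in> states D \<Longrightarrow> \<not> in_cone (fst s) s"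
proof -
  assume s: "s \<in> states D"
  show "\<not> in_cone (snd s) s"
  proof
    assume "in_cone (snd s) s"
    then obtain x y where "x > 0" "0 *\<^sub>R fst s + 1 *\<^sub>R snd s = x *\<^sub>R fst s + y *\<^sub>R snd s" by (auto simp: in_cone_def)
    then show False using indep_comb_unique[OF state_indep[OF s]] by (metis less_irrefl)
  qed
  show "\<not> in_cone (fst s) s"
  proof
    assume "in_cone (fst s) s"
    then obtain x y where "y > 0" "1 *\<^sub>R fst s + 0 *\<^sub>R snd s = x *\<^sub>R fst s + y *\<^sub>R snd s" by (auto simp: in_cone_def)
    then show False using indep_comb_unique[OF state_indep[OF s]] by (metis less_irrefl)
  qed
qed

text \<open>A coplanar blocked arc would overlap its blocker near the blocked endpoint.\<close>

lemma transversal: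
  assumes s: "s \<in> states D" and a: "a \<in> states D" "in_cone (snd s) a"
  shows "det3 (fst s) (snd s) (fst a) \<noteq> 0"
proof
  assume 0: "det3 (fst s) (snd s) (fst a) = 0"
  obtain x y where xy: "x > 0" "y > 0" "snd s = x *\<^sub>R fst a + y *\<^sub>R snd a" using a by (auto simp: in_cone_def)
  have "det3 (fst s) (snd s) (fst a) = - y * det3 (fst a) (snd a) (fst s)"
    unfolding xy(3) by (simp add: det3_coords algebra_simps)
  then have "det3 (fst a) (snd a) (fst s) = 0" using 0 xy by simp
  then obtain x' y' where f: "fst s = x' *\<^sub>R fst a + y' *\<^sub>R snd a" using indep_decompose[OF state_indep[OF a(1)]] by blast
  have "\<forall>\<^sub>F e in at_right 0. 0 < x + e * x'" "\<forall>\<^sub>F e in at_right 0. 0 < y + e * y'"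
    by (rule order_tendstoD(1)[of _ x], (auto intro!: tendsto_eq_intros xy)[2],
        rule order_tendstoD(1)[of _ y], (auto intro!: tendsto_eq_intros xy)[2])
  moreover have "\<forall>\<^sub>F e in at_right 0. 0 < (e::real)" by (rule eventually_at_right_less)
  ultimately have "\<forall>\<^sub>F e in at_right 0. 0 < x + e * x' \<and> 0 < y + e * y' \<and> 0 < (e::real)"
    by eventually_elim auto
  then obtain e where e: "0 < x + e * x'" "0 < y + e * y'" "0 < (e::real)"
    using eventually_happens'[of "at_right (0::real)"] trivial_limit_at_right_real by blast
  \<comment> \<open>This point lies in the cone of \<open>s\<close>; being close to
    \<open>snd s\<close> in the common plane, it also lies in the cone of \<open>a\<close>.\<close>
  define p where "p = e *\<^sub>R fst s + 1 *\<^sub>R snd s"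
  have "in_cone p s" unfolding in_cone_def p_def using e by (intro exI[of _ e] conjI exI[of _ 1]) auto
  moreover have "p = (x + e * x') *\<^sub>R fst a + (y + e * y') *\<^sub>R snd a"
    by (simp add: p_def f xy(3) algebra_simps)
  then have "in_cone p a" using e by (auto simp: in_cone_def)
  ultimately have "a = s \<or> a = prod.swap s" using cones_disjoint s a by blast
  then show False using not_in_own_cone(1)[OF s] a(2) in_cone_swap by metis
qed

lemma turn:
  assumes s: "s \<in> states D"
  shows "turn D s \<in> states D" "in_cone (snd s) (turn D s)"
    "det3 (fst s) (snd s) (snd (turn D s)) > 0" "det3 (fst s) (snd s) (fst (turn D s)) < 0"
proof -
  define a where "a = blocker D (snd s)"
  have a: "a \<in> D" "in_cone (snd s) a" using blocker[OF s] by (auto simp: a_def)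
  obtain x y where xy: "x > 0" "y > 0" "snd s = x *\<^sub>R fst a + y *\<^sub>R snd a" using a by (auto simp: in_cone_def)
  \<comment> \<open>The head of \<open>s\<close> is strictly between the ends of \<open>a\<close>,
    so the determinants at these ends have opposite signs, or both vanish, which
    \<open>transversal\<close> excludes.\<close>
  have *: "x * det3 (fst s) (snd s) (fst a) + y * det3 (fst s) (snd s) (snd a) = 0"
    using det3_linear(3)[of "fst s" "snd s" x "fst a" y "snd a"] xy(3) det3_same(3) by metis
  have n0: "det3 (fst s) (snd s) (fst a) \<noteq> 0" using transversal[OF s, of a] a by (auto simp: states_def)
  have t: "turn D s = (if det3 (fst s) (snd s) (snd a) > 0 then a else prod.swap a)"
    by (simp add: turn_def a_def Let_def)
  show "turn D s \<in> states D" using a by (auto simp: t states_def)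
  show "in_cone (snd s) (turn D s)" using a in_cone_swap by (auto simp: t)
  have "det3 (fst s) (snd s) (snd a) > 0 \<longleftrightarrow> det3 (fst s) (snd s) (fst a) < 0"
    using * n0 xy by (smt (verit) mult_pos_pos mult_neg_neg mult_pos_neg zero_less_mult_iff)
  moreover have "det3 (fst s) (snd s) (snd a) \<noteq> 0" using * n0 xy by auto
  ultimately show "det3 (fst s) (snd s) (snd (turn D s)) > 0" "det3 (fst s) (snd s) (fst (turn D s)) < 0"
    using n0 by (auto simp: t)
qed

lemma turn_unique:
  assumes "s \<in> states D" "b \<in> states D" "in_cone (snd s) b" "det3 (fst s) (snd s) (snd b) > 0"
  shows "b = turn D s"
proof -
  have "b = turn D s \<or> b = prod.swap (turn D s)" using cones_disjoint[OF _ assms(2) _ assms(3)] turn[OF assms(1)] by blast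
  then show ?thesis using turn(4)[OF assms(1)] assms(4) by auto
qed

lemma turn_funpow_in: "s \<in> states D \<Longrightarrow> (turn D ^^ i) s \<in> states D"
  by (induction i) (auto simp: turn)

end

subsection \<open>Cylindrical coordinates about a generic point\<close>

text \<open>The frame \<open>e1\<close>, \<open>e2\<close>, \<open>v\<close> is orthonormal and
  positively oriented, so arguments in the plane of \<open>e1\<close>, \<open>e2\<close> grow
  counterclockwise about \<open>v\<close>: a directed arc with \<open>v\<close> on its left runs
  eastwards.\<close>

locale pole = diagram +
  fixes e1 e2 v :: pt
  assumes frame: "norm e1 = 1" "norm e2 = 1" "e1 \<bullet> e2 = 0" "v = cross3 e1 e2"
    and generic: "s \<in> states D \<Longrightarrow> det3 (fst s) (snd s) v \<noteq> 0"
begin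

definition pnt :: "real \<Rightarrow> real \<Rightarrow> pt" where
  "pnt \<theta> z = cos \<theta> *\<^sub>R e1 + sin \<theta> *\<^sub>R e2 + z *\<^sub>R v"

definition is_arg :: "pt \<Rightarrow> real \<Rightarrow> bool" where
  "is_arg p \<theta> \<longleftrightarrow> (\<exists>\<rho>>0. p \<bullet> e1 = \<rho> * cos \<theta> \<and> p \<bullet> e2 = \<rho> * sin \<theta>)"

text \<open>Each arc is stored in its eastward direction, once for every real representative of the
  argument of its tail; the bound by \<open>pi\<close> then fixes the argument of its head.\<close>

definition lifts :: "(arc \<times> real \<times> real) set" where
  "lifts = {(s, \<alpha>, \<beta>). s \<in> states D \<and> det3 (fst s) (snd s) v > 0 \<and> \<alpha> < \<beta> \<and> \<beta> < \<alpha> + pi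
     \<and> is_arg (fst s) \<alpha> \<and> is_arg (snd s) \<beta>}"

definition lo :: "arc \<times> real \<times> real \<Rightarrow> real" where "lo a = fst (snd a)"
definition hi :: "arc \<times> real \<times> real \<Rightarrow> real" where "hi a = snd (snd a)"

text \<open>The great circle through the arc contains \<open>pnt \<theta> (hgt a \<theta>)\<close>.\<close>

definition hgt :: "arc \<times> real \<times> real \<Rightarrow> real \<Rightarrow> real" where
  "hgt a \<theta> = - det3 (fst (fst a)) (snd (fst a)) (pnt \<theta> 0) / det3 (fst (fst a)) (snd (fst a)) v"

lemma inner_frame: "e1 \<bullet> e1 = 1" "e2 \<bullet> e2 = 1" "e2 \<bullet> e1 = 0" "v \<bullet> e1 = 0" "v \<bullet> e2 = 0" "v \<bullet> v = 1"
  "e1 \<bullet> v = 0" "e2 \<bullet> v = 0"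
proof -
  show *: "e1 \<bullet> e1 = 1" "e2 \<bullet> e2 = 1" "e2 \<bullet> e1 = 0" by (simp_all only: power2_norm_eq_inner[symmetric] frame inner_commute[of e2] power_one)
  show "v \<bullet> e1 = 0" "v \<bullet> e2 = 0" "e1 \<bullet> v = 0" "e2 \<bullet> v = 0" unfolding frame(4) by (simp_all add: dot_cross_self)
  show "v \<bullet> v = 1" unfolding frame(4) dot_cross * frame(3) by simp
qed

lemma frame_decompose: "p = (p \<bullet> e1) *\<^sub>R e1 + (p \<bullet> e2) *\<^sub>R e2 + (p \<bullet> v) *\<^sub>R v"
proof -
  define q where "q = p - ((p \<bullet> e1) *\<^sub>R e1 + (p \<bullet> e2) *\<^sub>R e2 + (p \<bullet> v) *\<^sub>R v)"
  have q: "q \<bullet> e1 = 0" "q \<bullet> e2 = 0" "q \<bullet> v = 0"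
    by (simp_all add: q_def inner_diff_left inner_add_left inner_frame frame(3))
  have "cross3 q v = 0" unfolding frame(4) Lagrange q by simp
  then have "cross3 q v \<bullet> cross3 q v = 0" by simp
  then have "q \<bullet> q = 0" unfolding dot_cross q(3) inner_frame by simp
  then have "q = 0" by simp
  then show ?thesis unfolding q_def by (simp only: right_minus_eq)
qed

lemma det3_v: "det3 p q v = (p \<bullet> e1) * (q \<bullet> e2) - (p \<bullet> e2) * (q \<bullet> e1)"
  unfolding det3_def frame(4) dot_cross by (simp add: mult.commute)

lemma pnt_inner: "pnt \<theta> z \<bullet> e1 = cos \<theta>" "pnt \<theta> z \<bullet> e2 = sin \<theta>" "pnt \<theta> z \<bullet> v = z"
  by (simp_all add: pnt_def inner_add_left inner_frame frame(1-3))

lemma pnt_shift: "pnt \<theta> z = pnt \<theta> z' + (z - z') *\<^sub>R v"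
  by (simp add: pnt_def algebra_simps)

lemma is_arg_pnt:
  assumes "is_arg p \<theta>" obtains \<rho> z where "\<rho> > 0" "p = \<rho> *\<^sub>R pnt \<theta> z"
proof -
  obtain \<rho> where \<rho>: "\<rho> > 0" "p \<bullet> e1 = \<rho> * cos \<theta>" "p \<bullet> e2 = \<rho> * sin \<theta>" using assms by (auto simp: is_arg_def)
  have "p = \<rho> *\<^sub>R pnt \<theta> ((p \<bullet> v) / \<rho>)"
    using \<rho>(1) by (subst frame_decompose[of p]) (simp add: pnt_def \<rho>(2,3) scaleR_add_right)
  then show thesis using that \<rho> by blast
qed

lemma pnt_is_arg: "\<rho> > 0 \<Longrightarrow> is_arg (\<rho> *\<^sub>R pnt \<theta> z) \<theta>"
  by (auto simp: is_arg_def pnt_inner)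

lemma is_arg_complex: "is_arg p \<theta> \<longleftrightarrow> (\<exists>\<rho>>0. Complex (p \<bullet> e1) (p \<bullet> e2) = of_real \<rho> * cis \<theta>)"
  by (auto simp: is_arg_def complex_eq_iff)

lemma is_arg_shift:
  assumes "is_arg p \<theta>" "is_arg p \<theta>'" shows "cis \<theta> = cis \<theta>'"
proof -
  obtain \<rho> \<rho>' where *: "\<rho> > 0" "\<rho>' > 0" "of_real \<rho> * cis \<theta> = of_real \<rho>' * cis \<theta>'"
    using assms unfolding is_arg_complex by metis
  then have "\<rho> = \<rho>'" by (metis norm_mult norm_cis mult.right_neutral norm_of_real abs_of_pos)
  then show ?thesis using * by simp
qed

lemma cis_inj_near:
  assumes "cis \<theta> = cis \<theta>'" "\<bar>\<theta> - \<theta>'\<bar> < 2 * pi" shows "\<theta> = \<theta>'"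
proof -
  have "sin \<theta> = sin \<theta>' \<and> cos \<theta> = cos \<theta>'" using assms(1) by (simp add: complex_eq_iff)
  then obtain n :: int where n: "\<theta> = \<theta>' + 2 * pi * of_int n" unfolding sin_cos_eq_iff by blast
  then have "\<bar>of_int (2 * n) * pi\<bar> < 2 * pi" using assms(2) by (simp add: algebra_simps)
  then have "\<bar>of_int n :: real\<bar> < 1" by (simp add: abs_mult)
  then have "n = 0" by linarith
  then show ?thesis using n by simp
qed

lemma det3_v_args:
  assumes "is_arg p \<alpha>" "is_arg q \<beta>" obtains c where "c > 0" "det3 p q v = c * sin (\<beta> - \<alpha>)"
proof -
  obtain \<rho> \<rho>' where "\<rho> > 0" "\<rho>' > 0" "p \<bullet> e1 = \<rho> * cos \<alpha>" "p \<bullet> e2 = \<rho> * sin \<alpha>"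
    "q \<bullet> e1 = \<rho>' * cos \<beta>" "q \<bullet> e2 = \<rho>' * sin \<beta>" using assms by (auto simp: is_arg_def)
  then show thesis by (intro that[of "\<rho> * \<rho>'"]) (auto simp: det3_v sin_diff algebra_simps)
qed

text \<open>Among the arguments of \<open>p\<close>, which differ by multiples of
  \<open>2 * pi\<close>, the one within \<open>pi\<close> of \<open>\<phi>\<close> is taken; its
  side of \<open>\<phi>\<close> is then the sign of a sine, hence of the determinant.\<close>

lemma arg_exists:
  assumes "is_arg q \<phi>" "det3 p q v \<noteq> 0"
  obtains \<alpha> where "is_arg p \<alpha>" "\<phi> - pi < \<alpha>" "\<alpha> < \<phi> + pi" "\<alpha> < \<phi> \<longleftrightarrow> det3 p q v > 0" "\<alpha> > \<phi> \<longleftrightarrow> det3 p q v < 0"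
proof -
  obtain \<rho> where \<rho>: "\<rho> > 0" "Complex (q \<bullet> e1) (q \<bullet> e2) = of_real \<rho> * cis \<phi>" using assms by (auto simp: is_arg_complex)
  define w where "w = Complex (p \<bullet> e1) (p \<bullet> e2) * cis (- \<phi>)"
  define \<alpha> where "\<alpha> = \<phi> + Arg w"
  have "Complex (p \<bullet> e1) (p \<bullet> e2) \<noteq> 0" using assms(2) by (auto simp: det3_v complex_eq_iff)
  then have w0: "w \<noteq> 0" using cis_neq_zero by (simp add: w_def)
  have w: "w = of_real (norm w) * cis (Arg w)" using rcis_cmod_Arg[of w] by (simp add: rcis_def)
  have "Complex (p \<bullet> e1) (p \<bullet> e2) = w * cis \<phi>" by (simp add: w_def mult.assoc cis_mult)
  also have "\<dots> = of_real (norm w) * (cis (Arg w) * cis \<phi>)" by (metis w mult.assoc)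
  also have "\<dots> = of_real (norm w) * cis \<alpha>" by (simp add: \<alpha>_def cis_mult add.commute)
  finally have a: "is_arg p \<alpha>" using w0 by (auto simp: is_arg_complex)
  have "-pi < Arg w" "Arg w \<le> pi" using Arg_bounded by auto
  obtain c where c: "c > 0" "det3 p q v = c * sin (\<phi> - \<alpha>)" using det3_v_args[OF a assms(1)] .
  have s: "det3 p q v = - c * sin (Arg w)" using c by (simp add: \<alpha>_def)
  have ne: "Arg w \<noteq> pi" using s assms(2) by auto
  have sgns: "Arg w > 0 \<longleftrightarrow> sin (Arg w) > 0" "Arg w < 0 \<longleftrightarrow> sin (Arg w) < 0"
  proof -
    consider "Arg w > 0" | "Arg w = 0" | "Arg w < 0" by linarith
    then have "(Arg w > 0 \<longleftrightarrow> sin (Arg w) > 0) \<and> (Arg w < 0 \<longleftrightarrow> sin (Arg w) < 0)"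
    proof cases
      case 1
      then have "sin (Arg w) > 0" using \<open>Arg w \<le> pi\<close> ne by (intro sin_gt_zero) auto
      then show ?thesis using 1 by simp
    next
      case 3
      then have "sin (- Arg w) > 0" using \<open>-pi < Arg w\<close> by (intro sin_gt_zero) auto
      then show ?thesis using 3 by simp
    qed simp
    then show "Arg w > 0 \<longleftrightarrow> sin (Arg w) > 0" "Arg w < 0 \<longleftrightarrow> sin (Arg w) < 0" by blast+
  qed
  show thesis
    by (rule that[OF a]) (use \<open>-pi < Arg w\<close> \<open>Arg w \<le> pi\<close> ne sgns s c(1) in \<open>auto simp: \<alpha>_def mult_less_0_iff zero_less_mult_iff\<close>)
qed

lemma arg_exists_plain:
  assumes "det3 p q v \<noteq> 0" obtains \<alpha> where "is_arg p \<alpha>"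
proof -
  have "Complex (p \<bullet> e1) (p \<bullet> e2) \<noteq> 0" using assms by (auto simp: det3_v complex_eq_iff)
  then show thesis using that[of "Arg (Complex (p \<bullet> e1) (p \<bullet> e2))"] rcis_cmod_Arg[of "Complex (p \<bullet> e1) (p \<bullet> e2)"]
    unfolding is_arg_complex rcis_def by (metis zero_less_norm_iff)
qed

text \<open>The link between the two pictures: since the factor \<open>det3 ... v\<close> is
  positive for a lift, being to the left of the directed arc is the same as being above its
  graph.\<close>

lemma height_det3:
  assumes "a \<in> lifts"
  shows "det3 (fst (fst a)) (snd (fst a)) (pnt \<theta> z) = det3 (fst (fst a)) (snd (fst a)) v * (z - hgt a \<theta>)"
proof -
  have "det3 (fst (fst a)) (snd (fst a)) (pnt \<theta> z) = det3 (fst (fst a)) (snd (fst a)) (pnt \<theta> 0) + z * det3 (fst (fst a)) (snd (fst a)) v"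
    using pnt_shift[of \<theta> z 0] det3_linear(3)[of "fst (fst a)" "snd (fst a)" 1 "pnt \<theta> 0" z v] by simp
  then show ?thesis using assms by (auto simp: hgt_def lifts_def algebra_simps)
qed

lemma on_lift:
  assumes a: "a \<in> lifts" and \<theta>: "lo a < \<theta>" "\<theta> < hi a"
  obtains x y where "x > 0" "y > 0" "pnt \<theta> (hgt a \<theta>) = x *\<^sub>R fst (fst a) + y *\<^sub>R snd (fst a)"
proof -
  obtain t h \<alpha> \<beta> where at: "a = ((t, h), \<alpha>, \<beta>)" by (metis surj_pair)
  have A: "(t, h) \<in> states D" "det3 t h v > 0" "\<alpha> < \<beta>" "\<beta> < \<alpha> + pi" "is_arg t \<alpha>" "is_arg h \<beta>" and \<theta>': "\<alpha> < \<theta>" "\<theta> < \<beta>"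
    using a \<theta> by (auto simp: lifts_def at lo_def hi_def)
  obtain \<rho> z where t: "\<rho> > 0" "t = \<rho> *\<^sub>R pnt \<alpha> z" using is_arg_pnt[OF A(5)] .
  obtain \<rho>' z' where h: "\<rho>' > 0" "h = \<rho>' *\<^sub>R pnt \<beta> z'" using is_arg_pnt[OF A(6)] .
  have S: "sin (\<beta> - \<alpha>) > 0" "sin (\<beta> - \<theta>) > 0" "sin (\<theta> - \<alpha>) > 0" using A \<theta>' by (auto intro!: sin_gt_zero)
  \<comment> \<open>The sine rule: up to the lengths \<open>\<rho>\<close> and
    \<open>\<rho>'\<close>, these are the coordinates of the unit vector at angle
    \<open>\<theta>\<close> with respect to those at \<open>\<alpha>\<close> and
    \<open>\<beta>\<close>.\<close>
  define x where "x = sin (\<beta> - \<theta>) / (\<rho> * sin (\<beta> - \<alpha>))"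
  define y where "y = sin (\<theta> - \<alpha>) / (\<rho>' * sin (\<beta> - \<alpha>))"
  have xy: "x > 0" "y > 0" using S t h by (auto simp: x_def y_def)
  define P where "P = x *\<^sub>R t + y *\<^sub>R h"
  have xr: "x * \<rho> = sin (\<beta> - \<theta>) / sin (\<beta> - \<alpha>)" "y * \<rho>' = sin (\<theta> - \<alpha>) / sin (\<beta> - \<alpha>)" using t h by (auto simp: x_def y_def)
  have "P \<bullet> e1 = (x * \<rho>) * cos \<alpha> + (y * \<rho>') * cos \<beta>" by (simp add: P_def t h inner_add_left pnt_inner)
  also have "\<dots> = (sin (\<beta> - \<theta>) * cos \<alpha> + sin (\<theta> - \<alpha>) * cos \<beta>) / sin (\<beta> - \<alpha>)" by (simp add: xr add_divide_distrib)
  also have "sin (\<beta> - \<theta>) * cos \<alpha> + sin (\<theta> - \<alpha>) * cos \<beta> = cos \<theta> * sin (\<beta> - \<alpha>)" by (simp add: sin_diff algebra_simps)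
  finally have P1: "P \<bullet> e1 = cos \<theta>" using S by simp
  have "P \<bullet> e2 = (x * \<rho>) * sin \<alpha> + (y * \<rho>') * sin \<beta>" by (simp add: P_def t h inner_add_left pnt_inner)
  also have "\<dots> = (sin (\<beta> - \<theta>) * sin \<alpha> + sin (\<theta> - \<alpha>) * sin \<beta>) / sin (\<beta> - \<alpha>)" by (simp add: xr add_divide_distrib)
  also have "sin (\<beta> - \<theta>) * sin \<alpha> + sin (\<theta> - \<alpha>) * sin \<beta> = sin \<theta> * sin (\<beta> - \<alpha>)" by (simp add: sin_diff algebra_simps)
  finally have P2: "P \<bullet> e2 = sin \<theta>" using S by simp
  have P: "P = pnt \<theta> (P \<bullet> v)" using frame_decompose[of P] by (simp add: P1 P2 pnt_def)
  have "det3 t h P = 0" by (simp add: P_def det3_linear det3_same)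
  then have "P \<bullet> v = hgt a \<theta>" using height_det3[OF a, of \<theta> "P \<bullet> v"] A(2) P by (simp add: at)
  then show thesis using that[of x y] xy P by (simp add: at P_def)
qed

lemma hgt_hit:
  assumes a: "a \<in> lifts" and p: "is_arg p \<theta>" "det3 (fst (fst a)) (snd (fst a)) p = 0"
  obtains \<rho> where "\<rho> > 0" "p = \<rho> *\<^sub>R pnt \<theta> (hgt a \<theta>)"
proof -
  obtain \<rho> z where r: "\<rho> > 0" "p = \<rho> *\<^sub>R pnt \<theta> z" using is_arg_pnt[OF p(1)] .
  have "det3 (fst (fst a)) (snd (fst a)) (pnt \<theta> z) = 0" using p(2) r by (simp add: det3_scaleR)
  then have "z = hgt a \<theta>" using height_det3[OF a, of \<theta> z] a by (auto simp: lifts_def)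
  then show thesis using that r by simp
qed

lemma lift_at:
  assumes s: "s \<in> states D" "det3 (fst s) (snd s) v > 0" and p: "in_cone p s" "is_arg p \<phi>"
  obtains \<alpha> \<beta> where "(s, \<alpha>, \<beta>) \<in> lifts" "\<alpha> < \<phi>" "\<phi> < \<beta>"
proof -
  obtain x y where xy: "x > 0" "y > 0" "p = x *\<^sub>R fst s + y *\<^sub>R snd s" using p by (auto simp: in_cone_def)
  have 1: "det3 (fst s) p v > 0" "det3 (snd s) p v < 0"
    using s xy det3_swap(1)[of "fst s" "snd s" v] by (simp_all add: det3_linear det3_same mult_pos_neg)
  obtain \<alpha> where a: "is_arg (fst s) \<alpha>" "\<phi> - pi < \<alpha>" "\<alpha> < \<phi>" using arg_exists[OF p(2), of "fst s"] 1 by (metis less_irrefl)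
  obtain \<beta> where b: "is_arg (snd s) \<beta>" "\<beta> < \<phi> + pi" "\<phi> < \<beta>" using arg_exists[OF p(2), of "snd s"] 1 by (metis less_irrefl)
  obtain c where c: "c > 0" "det3 (fst s) (snd s) v = c * sin (\<beta> - \<alpha>)" using det3_v_args[OF a(1) b(1)] .
  have "sin (\<beta> - \<alpha>) > 0" using c s by (simp add: zero_less_mult_iff)
  have "\<beta> - \<alpha> < pi"
  proof (rule ccontr)
    assume "\<not> \<beta> - \<alpha> < pi"
    then have "sin (\<beta> - \<alpha> - pi) \<ge> 0" using a b by (intro sin_ge_zero) auto
    then show False using \<open>sin (\<beta> - \<alpha>) > 0\<close> by (simp add: sin_diff)
  qed
  then show thesis using that[of \<alpha> \<beta>] a b s by (auto simp: lifts_def)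
qed

end

section \<open>The lifts form a strip whose walk projects to \<open>turn\<close>\<close>

context pole
begin

definition right_blocker :: "arc \<times> real \<times> real \<Rightarrow> arc \<times> real \<times> real" where
  "right_blocker a = (SOME b. b \<in> lifts \<and> lo b < hi a \<and> hi a < hi b \<and> in_cone (snd (fst a)) (fst b))"

definition left_blocker :: "arc \<times> real \<times> real \<Rightarrow> arc \<times> real \<times> real" where
  "left_blocker a = (SOME b. b \<in> lifts \<and> lo b < lo a \<and> lo a < hi b \<and> in_cone (fst (fst a)) (fst b))"

lemma liftsD:
  assumes "a \<in> lifts"
  shows "fst a \<in> states D" "det3 (fst (fst a)) (snd (fst a)) v > 0" "lo a < hi a" "hi a < lo a + pi"
    "is_arg (fst (fst a)) (lo a)" "is_arg (snd (fst a)) (hi a)"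
  using assms by (auto simp: lifts_def lo_def hi_def)

lemma cone_lift:
  assumes "s \<in> states D" "is_arg (snd s) \<phi>"
  obtains b where "b \<in> lifts" "lo b < \<phi>" "\<phi> < hi b" "in_cone (snd s) (fst b)"
proof -
  let ?b = "turn D s"
  define b where "b = (if det3 (fst ?b) (snd ?b) v > 0 then ?b else prod.swap ?b)"
  have b: "b \<in> states D" "in_cone (snd s) b" "det3 (fst b) (snd b) v > 0"
    using turn(1,2)[OF assms(1)] generic[OF turn(1)[OF assms(1)]] swap_states in_cone_swap det3_swap(1)[of "fst ?b" "snd ?b" v]
    by (auto simp: b_def)
  obtain \<alpha> \<beta> where "(b, \<alpha>, \<beta>) \<in> lifts" "\<alpha> < \<phi>" "\<phi> < \<beta>" using lift_at[OF b(1,3,2) assms(2)] .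
  then show thesis using that[of "(b, \<alpha>, \<beta>)"] b by (simp add: lo_def hi_def)
qed

lemma right_blocker:
  assumes "a \<in> lifts"
  shows "right_blocker a \<in> lifts" "lo (right_blocker a) < hi a" "hi a < hi (right_blocker a)"
    "in_cone (snd (fst a)) (fst (right_blocker a))"
proof -
  obtain b where "b \<in> lifts \<and> lo b < hi a \<and> hi a < hi b \<and> in_cone (snd (fst a)) (fst b)"
    using cone_lift[OF liftsD(1,6)[OF assms]] by metis
  from someI[of "\<lambda>b. b \<in> lifts \<and> lo b < hi a \<and> hi a < hi b \<and> in_cone (snd (fst a)) (fst b)", OF this]
  show "right_blocker a \<in> lifts" "lo (right_blocker a) < hi a" "hi a < hi (right_blocker a)"
    "in_cone (snd (fst a)) (fst (right_blocker a))" by (simp_all add: right_blocker_def)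
qed

lemma left_blocker:
  assumes "a \<in> lifts"
  shows "left_blocker a \<in> lifts" "lo (left_blocker a) < lo a" "lo a < hi (left_blocker a)"
    "in_cone (fst (fst a)) (fst (left_blocker a))"
proof -
  obtain b where "b \<in> lifts \<and> lo b < lo a \<and> lo a < hi b \<and> in_cone (fst (fst a)) (fst b)"
    using cone_lift[of "prod.swap (fst a)" "lo a"] liftsD(1,5)[OF assms] swap_states by (metis snd_swap)
  from someI[of "\<lambda>b. b \<in> lifts \<and> lo b < lo a \<and> lo a < hi b \<and> in_cone (fst (fst a)) (fst b)", OF this]
  show "left_blocker a \<in> lifts" "lo (left_blocker a) < lo a" "lo a < hi (left_blocker a)"
    "in_cone (fst (fst a)) (fst (left_blocker a))" by (simp_all add: left_blocker_def)
qed

lemma pnt_scale_inj: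
  assumes "\<rho> > 0" "\<rho>' > 0" "\<rho> *\<^sub>R pnt \<theta> z = \<rho>' *\<^sub>R pnt \<theta> z'" shows "z = z'"
proof -
  have e: "\<rho> * cos \<theta> = \<rho>' * cos \<theta>" "\<rho> * sin \<theta> = \<rho>' * sin \<theta>" "\<rho> * z = \<rho>' * z'"
    using arg_cong[OF assms(3), of "\<lambda>p. p \<bullet> e1"] arg_cong[OF assms(3), of "\<lambda>p. p \<bullet> e2"]
      arg_cong[OF assms(3), of "\<lambda>p. p \<bullet> v"] by (simp_all add: pnt_inner)
  have "\<rho> = \<rho>'" using e(1,2) sin_cos_squared_add3[of \<theta>] by (metis mult_right_cancel mult_zero_left add.right_neutral zero_neq_one)
  then show ?thesis using e assms by simp
qed

lemma hgt_eq:
  assumes "a \<in> lifts" "b \<in> lifts" "is_arg p \<theta>" "det3 (fst (fst a)) (snd (fst a)) p = 0" "det3 (fst (fst b)) (snd (fst b)) p = 0"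
  shows "hgt a \<theta> = hgt b \<theta>"
  using hgt_hit[OF assms(1,3,4)] hgt_hit[OF assms(2,3,5)] pnt_scale_inj by metis

text \<open>A common point projects to a point of both arcs, so these agree; two overlapping
  intervals shorter than \<open>pi\<close> cannot differ by a nonzero multiple of
  \<open>2 * pi\<close>.\<close>

lemma lifts_differ:
  assumes "a \<in> lifts" "b \<in> lifts" "lo a < t" "t < hi a" "lo b < t" "t < hi b" "hgt a t = hgt b t"
  shows "a = b"
proof -
  have "in_cone (pnt t (hgt a t)) (fst a)" "in_cone (pnt t (hgt a t)) (fst b)"
    using on_lift[OF assms(1,3,4)] on_lift[OF assms(2,5,6)] assms(7) unfolding in_cone_def by metis+
  then have "fst b = fst a \<or> fst b = prod.swap (fst a)" using cones_disjoint liftsD(1) assms by blast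
  then have s: "fst b = fst a"
    using liftsD(2)[OF assms(1)] liftsD(2)[OF assms(2)] det3_swap(1)[of "fst (fst a)" "snd (fst a)" v] by auto
  have "cis (lo a) = cis (lo b)" "cis (hi a) = cis (hi b)"
    using is_arg_shift liftsD(5,6)[OF assms(1)] liftsD(5,6)[OF assms(2)] s by metis+
  then have "lo a = lo b" "hi a = hi b"
    using cis_inj_near[of "lo a" "lo b"] cis_inj_near[of "hi a" "hi b"] liftsD(3,4)[OF assms(1)] liftsD(3,4)[OF assms(2)] assms
    by (auto simp: abs_if)
  then show ?thesis using s by (simp add: prod_eq_iff lo_def hi_def)
qed

text \<open>There are infinitely many lifts, but a gap between arguments depends modulo
  \<open>2 * pi\<close> only on the pair of endpoints. This finiteness supplies the uniform
  \<open>\<delta>\<close> of \<open>strip\<close>.\<close>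

lemma arg_gap_finite: "finite {d. 0 < d \<and> d < pi \<and> (\<exists>p\<in>fst ` states D. \<exists>q\<in>fst ` states D. \<exists>\<theta>. is_arg p \<theta> \<and> is_arg q (\<theta> + d))}"
proof -
  define G where "G = (\<lambda>(p, q). THE d. 0 < d \<and> d < pi \<and> (\<exists>\<theta>. is_arg p \<theta> \<and> is_arg q (\<theta> + d)))"
  have "d \<in> G ` (fst ` states D \<times> fst ` states D)"
    if "0 < d" "d < pi" "p \<in> fst ` states D" "q \<in> fst ` states D" "is_arg p \<theta>" "is_arg q (\<theta> + d)" for d p q \<theta>
  proof -
    have "G (p, q) = d"
      unfolding G_def prod.case
    proof (rule the_equality)
      show "0 < d \<and> d < pi \<and> (\<exists>\<theta>. is_arg p \<theta> \<and> is_arg q (\<theta> + d))" using that by blast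
      fix d' assume d': "0 < d' \<and> d' < pi \<and> (\<exists>\<theta>. is_arg p \<theta> \<and> is_arg q (\<theta> + d'))"
      then obtain \<theta>' where \<theta>': "is_arg p \<theta>'" "is_arg q (\<theta>' + d')" by blast
      have "cis \<theta>' * cis d' = cis \<theta> * cis d"
        unfolding cis_mult by (rule is_arg_shift[OF \<theta>'(2) that(6)])
      then have "cis d' = cis d" using is_arg_shift[OF \<theta>'(1) that(5)] cis_neq_zero[of \<theta>] by simp
      then show "d' = d" by (rule cis_inj_near) (use d' that in \<open>auto simp: abs_if\<close>)
    qed
    then show ?thesis using that by blast
  qed
  then have "{d. 0 < d \<and> d < pi \<and> (\<exists>p\<in>fst ` states D. \<exists>q\<in>fst ` states D. \<exists>\<theta>. is_arg p \<theta> \<and> is_arg q (\<theta> + d))}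
     \<subseteq> G ` (fst ` states D \<times> fst ` states D)" by blast
  then show ?thesis by (rule finite_subset) (use finite_states in auto)
qed

lemma is_strip: obtains \<delta> where "strip lifts lo hi hgt left_blocker right_blocker \<delta>"
proof -
  define F where "F = {d. 0 < d \<and> d < pi \<and> (\<exists>p\<in>fst ` states D. \<exists>q\<in>fst ` states D. \<exists>\<theta>. is_arg p \<theta> \<and> is_arg q (\<theta> + d))}"
  \<comment> \<open>The element 1 guards against an empty \<open>F\<close>.\<close>
  define \<delta> where "\<delta> = Min (insert 1 F)"
  have F: "finite F" unfolding F_def by (rule arg_gap_finite)
  have pos: "\<delta> > 0" unfolding \<delta>_def using F by (subst Min_gr_iff) (auto simp: F_def)
  have gap: "\<theta> + \<delta> \<le> \<theta>'" if "is_arg p \<theta>" "is_arg q \<theta>'" "p \<in> fst ` states D" "q \<in> fst ` states D" "\<theta> < \<theta>'" "\<theta>' < \<theta> + pi" for p q \<theta> \<theta>'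
  proof -
    have "\<theta>' - \<theta> \<in> F" unfolding F_def using that by (intro CollectI conjI bexI[of _ p] bexI[of _ q] exI[of _ \<theta>]) auto
    then have "\<delta> \<le> \<theta>' - \<theta>" unfolding \<delta>_def using F by (intro Min_le) auto
    then show ?thesis by simp
  qed
  have P: "fst (fst a) \<in> fst ` states D" "snd (fst a) \<in> fst ` states D" if "a \<in> lifts" for a
    using liftsD(1)[OF that] swap_states by (force, metis fst_swap image_eqI)
  have "strip lifts lo hi hgt left_blocker right_blocker \<delta>"
  proof
    fix a assume a: "a \<in> lifts"
    show "lo a < hi a" by (rule liftsD(3)[OF a])
    show "continuous_on UNIV (hgt a)"
      unfolding hgt_def[abs_def] det3_def pnt_def inner_add_right inner_scaleR_right divide_inverse by (intro continuous_intros)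
    note R = right_blocker[OF a] and L = left_blocker[OF a]
    show "right_blocker a \<in> lifts" "lo (right_blocker a) < hi a" "left_blocker a \<in> lifts" "lo a < hi (left_blocker a)"
      using R L by auto
    show "hi a + \<delta> \<le> hi (right_blocker a)"
      by (rule gap[OF liftsD(6)[OF a] liftsD(6)[OF R(1)]]) (use P[OF a] P[OF R(1)] R liftsD[OF R(1)] in auto)
    show "lo (left_blocker a) + \<delta> \<le> lo a"
      by (rule gap[OF liftsD(5)[OF L(1)] liftsD(5)[OF a]]) (use P[OF a] P[OF L(1)] L liftsD[OF L(1)] in auto)
    show "hgt (right_blocker a) (hi a) = hgt a (hi a)"
      by (rule hgt_eq[OF R(1) a liftsD(6)[OF a] det3_in_cone[OF R(4)]]) (simp add: det3_same)
    show "hgt (left_blocker a) (lo a) = hgt a (lo a)"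
      by (rule hgt_eq[OF L(1) a liftsD(5)[OF a] det3_in_cone[OF L(4)]]) (simp add: det3_same)
  next
    fix a b t
    assume "a \<in> lifts" "b \<in> lifts" "lo a < t" "t < hi a" "lo b < t" "t < hi b" "hgt a t = hgt b t"
    then show "a = b" by (rule lifts_differ)
  qed (rule pos)
  then show thesis by (rule that)
qed

definition proj :: "(arc \<times> real \<times> real) \<times> bool \<Rightarrow> arc" where
  "proj s = (if snd s then fst (fst s) else prod.swap (fst (fst s)))"

lemma proj_in: "fst s \<in> lifts \<Longrightarrow> proj s \<in> states D"
  using liftsD(1) swap_states by (auto simp: proj_def)

text \<open>\<open>D1\<close> and \<open>D2\<close> are the values of a linear functional at the two
  ends of an arc, with its zero at coordinates \<open>(x0, y0)\<close>. The last hypothesis says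
  that \<open>(x, y)\<close> lies between the first end and this zero, so the functional there has
  the sign opposite to \<open>D2\<close>.\<close>

lemma cross_sign:
  assumes "x > 0" "y > 0" "x0 > 0" "y0 > (0::real)" "x0 * D1 + y0 * D2 = 0" "x * y0 - y * x0 > 0"
  shows "x * D1 + y * D2 < 0 \<longleftrightarrow> D2 > 0" "D1 > 0 \<longleftrightarrow> D2 < 0"
proof -
  have "x0 * (x * D1 + y * D2) = - ((x * y0 - y * x0) * D2)" using assms(5) by algebra
  moreover have "x * D1 + y * D2 < 0 \<longleftrightarrow> x0 * (x * D1 + y * D2) < 0" using assms(3) by (simp add: mult_less_0_iff)
  moreover have "D2 > 0 \<longleftrightarrow> (x * y0 - y * x0) * D2 > 0" using assms(6) by (simp only: zero_less_mult_iff) auto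
  ultimately show "x * D1 + y * D2 < 0 \<longleftrightarrow> D2 > 0" by simp
  have "x0 * D1 = - (y0 * D2)" using assms(5) by simp
  moreover have "D1 > 0 \<longleftrightarrow> x0 * D1 > 0" using assms(3) by (simp add: zero_less_mult_iff)
  moreover have "D2 < 0 \<longleftrightarrow> y0 * D2 < 0" using assms(4) by (simp add: mult_less_0_iff)
  ultimately show "D1 > 0 \<longleftrightarrow> D2 < 0" by simp
qed

text \<open>Both choices of direction read off the same sign: \<open>bel\<close> compares heights at
  an abscissa on one side of the junction, \<open>turn\<close> tests the head of the blocker, and
  along the blocker the determinant changes sign only at the junction.\<close>

lemma proj_nxt:
  assumes "fst s \<in> lifts"
  shows "proj (strip.nxt lo hi hgt left_blocker right_blocker s) = turn D (proj s)"
proof -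
  obtain \<delta> where "strip lifts lo hi hgt left_blocker right_blocker \<delta>" by (rule is_strip)
  then interpret S: strip lifts lo hi hgt left_blocker right_blocker \<delta> .
  define a where "a = fst s"
  have a: "a \<in> lifts" using assms by (simp add: a_def)
  note la = liftsD[OF a]
  obtain t h where th: "fst a = (t, h)" by fastforce
  define b where "b = (if snd s then right_blocker a else left_blocker a)"
  have b: "b \<in> lifts" using right_blocker(1) left_blocker(1) a by (auto simp: b_def)
  note lb = liftsD[OF b]
  obtain tb hb where thb: "fst b = (tb, hb)" by fastforce
  have nxt: "S.nxt s = (b, S.bel b a)" by (simp add: S.nxt_def Let_def b_def a_def)
  have ps: "proj s \<in> states D" using proj_in assms by simp
  define J where "J = snd (proj s)"
  have J: "in_cone J (fst b)" using right_blocker(4)[OF a] left_blocker(4)[OF a] by (auto simp: J_def b_def proj_def a_def)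
  obtain x0 y0 where xy0: "x0 > 0" "y0 > 0" "J = x0 *\<^sub>R tb + y0 *\<^sub>R hb" using J by (auto simp: in_cone_def thb)
  define d where "d = det3 (fst (proj s)) (snd (proj s))"
  have d0: "x0 * d tb + y0 * d hb = 0"
  proof -
    have "d J = 0" by (simp add: d_def J_def det3_same)
    then show ?thesis unfolding xy0(3) d_def by (simp add: det3_linear)
  qed
  have "d tb \<noteq> 0" using transversal[OF ps, of "fst b"] lb(1) J by (simp add: d_def J_def thb)
  then have hb0: "d hb \<noteq> 0" using d0 xy0 by auto
  have bel: "S.bel b a \<longleftrightarrow> d hb > 0 \<and> (d tb > 0 \<longleftrightarrow> d hb < 0)"
  proof (cases "snd s")
    case True
    have bb: "lo b < hi a" "hi a < hi b" using right_blocker[OF a] True by (auto simp: b_def)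
    have pr: "proj s = (t, h)" "J = h" using True th by (auto simp: proj_def a_def J_def)
    obtain \<theta> where \<theta>: "max (lo a) (lo b) < \<theta>" "\<theta> < hi a" using dense[of "max (lo a) (lo b)" "hi a"] bb la by auto
    have \<theta>b: "lo b < \<theta>" "\<theta> < hi b" using \<theta> bb by auto
    obtain x y where xy: "x > 0" "y > 0" "pnt \<theta> (hgt b \<theta>) = x *\<^sub>R tb + y *\<^sub>R hb"
      using on_lift[OF b \<theta>b] thb by auto
    obtain c where c: "c > 0" "det3 (pnt \<theta> (hgt b \<theta>)) J v = c * sin (hi a - \<theta>)"
      using det3_v_args[OF pnt_is_arg[of 1 \<theta> "hgt b \<theta>", simplified], of J "hi a"] la(6) th pr by auto
    have "sin (hi a - \<theta>) > 0" by (rule sin_gt_zero) (use \<theta> la in auto)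
    moreover have "det3 (pnt \<theta> (hgt b \<theta>)) J v = (x * y0 - y * x0) * det3 tb hb v"
      unfolding xy(3) xy0(3) by (simp add: det3_linear det3_same det3_swap(1)[of tb hb v] algebra_simps)
    ultimately have "0 < (x * y0 - y * x0) * det3 tb hb v" using c by (metis mult_pos_pos)
    then have "x * y0 - y * x0 > 0" by (rule zero_less_mult_pos2) (use lb(2) thb in simp)
    note cs = cross_sign[OF xy(1,2) xy0(1,2) d0 this]
    have "S.bel b a \<longleftrightarrow> hgt b \<theta> < hgt a \<theta>" using S.bel_iff[OF b a, of \<theta>] \<theta> \<theta>b by auto
    also have "\<dots> \<longleftrightarrow> d (pnt \<theta> (hgt b \<theta>)) < 0"
      using height_det3[OF a, of \<theta> "hgt b \<theta>"] la(2) by (simp add: d_def pr th mult_less_0_iff)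
    also have "\<dots> \<longleftrightarrow> d hb > 0" using cs(1) unfolding xy(3) by (simp add: d_def det3_linear)
    finally show ?thesis using cs(2) by blast
  next
    case False
    have bb: "lo b < lo a" "lo a < hi b" using left_blocker[OF a] False by (auto simp: b_def)
    have pr: "proj s = (h, t)" "J = t" using False th by (auto simp: proj_def a_def J_def)
    obtain \<theta> where \<theta>: "lo a < \<theta>" "\<theta> < min (hi a) (hi b)" using dense[of "lo a" "min (hi a) (hi b)"] bb la by auto
    have \<theta>b: "lo b < \<theta>" "\<theta> < hi b" using \<theta> bb by auto
    obtain x y where xy: "x > 0" "y > 0" "pnt \<theta> (hgt b \<theta>) = x *\<^sub>R tb + y *\<^sub>R hb"
      using on_lift[OF b \<theta>b] thb by auto
    obtain c where c: "c > 0" "det3 J (pnt \<theta> (hgt b \<theta>)) v = c * sin (\<theta> - lo a)"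
      using det3_v_args[of J "lo a", OF _ pnt_is_arg[of 1 \<theta> "hgt b \<theta>", simplified]] la(5) th pr by auto
    have "sin (\<theta> - lo a) > 0" by (rule sin_gt_zero) (use \<theta> la in auto)
    moreover have "det3 J (pnt \<theta> (hgt b \<theta>)) v = (x0 * y - y0 * x) * det3 tb hb v"
      unfolding xy(3) xy0(3) by (simp add: det3_linear det3_same det3_swap(1)[of tb hb v] algebra_simps)
    ultimately have "0 < (x0 * y - y0 * x) * det3 tb hb v" using c by (metis mult_pos_pos)
    then have "x0 * y - y0 * x > 0" by (rule zero_less_mult_pos2) (use lb(2) thb in simp)
    then have "y * x0 - x * y0 > 0" by (simp add: algebra_simps)
    moreover have "y0 * d hb + x0 * d tb = 0" using d0 by simp
    ultimately have cs: "y * d hb + x * d tb < 0 \<longleftrightarrow> d tb > 0" and cs2: "d hb > 0 \<longleftrightarrow> d tb < 0"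
      using cross_sign[OF xy(2,1) xy0(2,1)] by blast+
    have "S.bel b a \<longleftrightarrow> hgt b \<theta> < hgt a \<theta>" using S.bel_iff[OF b a, of \<theta>] \<theta> \<theta>b by auto
    also have "\<dots> \<longleftrightarrow> \<not> hgt a \<theta> < hgt b \<theta>" 
      using lifts_differ[OF a b, of \<theta>] \<theta> \<theta>b bb by (metis linorder_less_linear min_less_iff_conj order_less_asym)
    also have "\<dots> \<longleftrightarrow> \<not> d (pnt \<theta> (hgt b \<theta>)) < 0"
      using height_det3[OF a, of \<theta> "hgt b \<theta>"] la(2) det3_swap(1)[of t h] by (auto simp: d_def pr th zero_less_mult_iff mult_less_0_iff)
    also have "\<dots> \<longleftrightarrow> \<not> d tb > 0" using cs unfolding xy(3) by (simp add: d_def det3_linear add.commute)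
    finally show ?thesis using cs2 \<open>d tb \<noteq> 0\<close> by auto
  qed
  show ?thesis
  proof (rule turn_unique[OF ps])
    show "proj (S.nxt s) \<in> states D" using proj_in[of "S.nxt s"] b nxt by simp
    show "in_cone (snd (proj s)) (proj (S.nxt s))" using J in_cone_swap by (auto simp: nxt proj_def J_def)
    show "det3 (fst (proj s)) (snd (proj s)) (snd (proj (S.nxt s))) > 0"
    proof (cases "S.bel b a")
      case True then show ?thesis using bel by (simp add: nxt proj_def thb d_def)
    next
      case False
      have "d tb > 0"
      proof (rule ccontr)
        assume "\<not> d tb > 0"
        then have "x0 * d tb < 0" using \<open>d tb \<noteq> 0\<close> xy0(1) by (simp add: mult_less_0_iff)
        then have "y0 * d hb > 0" using d0 by linarith
        then have "d hb > 0" using xy0(2) by (simp add: zero_less_mult_iff)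
        then show False using bel False \<open>\<not> d tb > 0\<close> by auto
      qed
      then show ?thesis using False by (simp add: nxt proj_def thb d_def)
    qed
  qed
qed

end

subsection \<open>Periodic walks\<close>

text \<open>The pole \<open>v\<close> lies infinitesimally close to \<open>u0\<close>, a point of \<open>s\<close> so near to the head of \<open>s\<close> that
  no arc hits \<open>s\<close> between \<open>u0\<close> and the head.\<close>

locale near_pole = pole +
  fixes s :: arc and u0 :: pt and x0 y0 :: real
  assumes s: "s \<in> states D" "det3 (fst s) (snd s) v > 0"
    and u0: "x0 > 0" "y0 > 0" "u0 = x0 *\<^sub>R fst s + y0 *\<^sub>R snd s"
    and clear: "b \<in> states D \<Longrightarrow> \<kappa> > 0 \<Longrightarrow> det3 (fst b) (snd b) (u0 + \<kappa> *\<^sub>R v) \<noteq> 0"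
    and hits_before: "b \<in> states D \<Longrightarrow> x > 0 \<Longrightarrow> y > 0 \<Longrightarrow> snd b = x *\<^sub>R fst s + y *\<^sub>R snd s \<Longrightarrow> y * x0 < x * y0"
begin

lemma u0_arg:
  assumes "a \<in> lifts" "fst a = s"
  obtains u where "is_arg u0 u" "lo a < u" "u < hi a"
proof -
  have d: "det3 u0 (fst s) v < 0" "det3 u0 (snd s) v > 0"
    using s(2) u0 det3_swap(1)[of "fst s" "snd s" v] by (auto simp: det3_linear det3_same mult_pos_neg)
  obtain u where u: "is_arg u0 u" "lo a - pi < u" "u < lo a + pi" "u > lo a"
    using arg_exists[OF liftsD(5)[OF assms(1)], of u0] d assms(2) by (metis less_irrefl)
  obtain c where c: "c > 0" "det3 u0 (snd s) v = c * sin (hi a - u)"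
    using det3_v_args[OF u(1) liftsD(6)[OF assms(1)]] assms(2) by metis
  then have "sin (hi a - u) > 0" using d by (simp add: zero_less_mult_iff)
  have "u < hi a"
  proof (rule ccontr)
    assume "\<not> u < hi a"
    then have "sin (u - hi a) \<ge> 0" using u liftsD(3)[OF assms(1)] by (intro sin_ge_zero) auto
    then show False using \<open>sin (hi a - u) > 0\<close> sin_minus[of "hi a - u"] by simp
  qed
  then show thesis using that u by blast
qed

text \<open>A higher graph over \<open>u\<close> would meet, up to positive scaling, a point
  \<open>u0 + \<kappa> v\<close> with positive \<open>\<kappa>\<close>, which \<open>clear\<close>
  forbids.\<close>

lemma top_at_u0:
  assumes "a \<in> lifts" "fst a = s" "is_arg u0 u" and c: "c \<in> lifts"
  shows "hgt c u \<le> hgt a u"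
proof (rule ccontr)
  assume "\<not> hgt c u \<le> hgt a u"
  have "det3 (fst (fst a)) (snd (fst a)) u0 = 0" by (simp add: assms u0 det3_linear det3_same)
  then obtain \<rho> where \<rho>: "\<rho> > 0" "u0 = \<rho> *\<^sub>R pnt u (hgt a u)" using hgt_hit[OF assms(1,3)] by blast
  define \<kappa> where "\<kappa> = \<rho> * (hgt c u - hgt a u)"
  have "\<kappa> > 0" using \<rho> \<open>\<not> hgt c u \<le> hgt a u\<close> by (simp add: \<kappa>_def)
  have "u0 + \<kappa> *\<^sub>R v = \<rho> *\<^sub>R pnt u (hgt c u)"
    using pnt_shift[of u "hgt c u" "hgt a u"] \<rho> by (simp add: \<kappa>_def scaleR_add_right)
  then have "det3 (fst (fst c)) (snd (fst c)) (u0 + \<kappa> *\<^sub>R v) = 0"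
    using height_det3[OF c, of u "hgt c u"] by (simp add: det3_scaleR)
  then show False using clear[OF liftsD(1)[OF c] \<open>\<kappa> > 0\<close>] by simp
qed

lemma entry_before_u0:
  assumes a: "a \<in> lifts" "fst a = s" and u: "is_arg u0 u" "lo a < u" "u < hi a"
    and b: "b \<in> states D" "in_cone (snd b) s" "is_arg (snd b) e" "lo a < e" "e < hi a"
  shows "e < u"
proof -
  obtain x y where xy: "x > 0" "y > 0" "snd b = x *\<^sub>R fst s + y *\<^sub>R snd s" using b by (auto simp: in_cone_def)
  have "det3 (snd b) u0 v = (x * y0 - y * x0) * det3 (fst s) (snd s) v"
    unfolding xy(3) u0(3) by (simp add: det3_linear det3_same det3_swap(1)[of "fst s" "snd s" v] algebra_simps)
  moreover have "x * y0 - y * x0 > 0" using hits_before[OF b(1) xy] by simp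
  ultimately have "det3 (snd b) u0 v > 0" using s(2) by simp
  moreover obtain c where "c > 0" "det3 (snd b) u0 v = c * sin (u - e)" using det3_v_args[OF b(3) u(1)] .
  ultimately have "sin (u - e) > 0" by (simp add: zero_less_mult_iff)
  show "e < u"
  proof (rule ccontr)
    assume "\<not> e < u"
    then have "sin (e - u) \<ge> 0" using b u liftsD(4)[OF a(1)] by (intro sin_ge_zero) auto
    then show False using \<open>sin (u - e) > 0\<close> sin_minus[of "u - e"] by simp
  qed
qed

lemma s_lift: obtains a where "a \<in> lifts" "fst a = s"
proof -
  have "is_arg u0 \<phi> \<Longrightarrow> thesis" for \<phi>
    using lift_at[OF s, of u0 \<phi>] that u0 unfolding in_cone_def by (metis fst_conv)
  moreover have "det3 u0 (snd s) v \<noteq> 0" using s(2) u0 by (simp add: det3_linear det3_same)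
  ultimately show thesis using arg_exists_plain by blast
qed

definition step :: "(arc \<times> real \<times> real) \<times> bool \<Rightarrow> (arc \<times> real \<times> real) \<times> bool" where
  "step = strip.nxt lo hi hgt left_blocker right_blocker"

lemma step_lifts: "fst z \<in> lifts \<Longrightarrow> fst ((step ^^ i) z) \<in> lifts"
proof (induction i)
  case (Suc i)
  obtain \<delta> where "strip lifts lo hi hgt left_blocker right_blocker \<delta>" by (rule is_strip)
  then interpret S: strip lifts lo hi hgt left_blocker right_blocker \<delta> .
  show ?case using S.nxt_in Suc by (simp add: step_def)
qed simp

lemma step_proj: "fst z \<in> lifts \<Longrightarrow> proj ((step ^^ i) z) = (turn D ^^ i) (proj z)"
proof (induction i)
  case (Suc i)
  then show ?case using proj_nxt[OF step_lifts[OF Suc.prems, of i]] by (simp add: step_def)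
qed simp

text \<open>Every arrival on \<open>s\<close> happens before \<open>u0\<close>, so the topmost point
  over \<open>u0\<close> is still ahead. This is the form in which \<open>no_fold\<close> and
  \<open>stay_below\<close> use the pole.\<close>

lemma step_at_s:
  assumes z: "fst z \<in> lifts" and i: "proj ((step ^^ Suc i) z) = s"
  obtains a u where "(step ^^ Suc i) z = (a, True)" "a \<in> lifts" "fst a = s" "is_arg u0 u" "u < hi a"
    "strip.entry lo hi ((step ^^ i) z) < u" "\<And>c. c \<in> lifts \<Longrightarrow> hgt c u \<le> hgt a u"
proof -
  obtain \<delta> where "strip lifts lo hi hgt left_blocker right_blocker \<delta>" by (rule is_strip)
  then interpret S: strip lifts lo hi hgt left_blocker right_blocker \<delta> .
  let ?y = "(step ^^ i) z"
  obtain a d where ad: "(step ^^ Suc i) z = (a, d)" by fastforce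
  have a: "a \<in> lifts" using step_lifts[OF z, of "Suc i"] ad by simp
  have d: "d"
  proof (rule ccontr)
    assume "\<not> d"
    then have "fst a = prod.swap s" using i ad by (auto simp: proj_def)
    then show False using liftsD(2)[OF a] s(2) det3_swap(1)[of "fst s" "snd s" v] by simp
  qed
  then have as: "fst a = s" using i ad by (simp add: proj_def)
  obtain u where u: "is_arg u0 u" "lo a < u" "u < hi a" using u0_arg[OF a as] .
  have y: "fst ?y \<in> lifts" by (rule step_lifts[OF z])
  have nx: "(a, d) = S.nxt ?y" using ad by (simp add: step_def)
  then have fa: "fst (S.nxt ?y) = a" by (metis fst_conv)
  have "turn D (proj ?y) = s" using i step_proj[OF z, of "Suc i"] step_proj[OF z, of i] by simp
  then have "in_cone (snd (proj ?y)) s" using turn(2)[OF proj_in[OF y]] by simp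
  moreover have "is_arg (snd (proj ?y)) (S.entry ?y)"
    using liftsD(5,6)[OF y] by (simp add: proj_def S.entry_def)
  ultimately have "S.entry ?y < u"
    using entry_before_u0[OF a as u proj_in[OF y]] S.entry_bounds[OF y] fa by simp
  then show thesis by (intro that[of a u]) (use ad d a as u top_at_u0[OF a as u(1)] in auto)
qed

text \<open>Start and return of the period are both eastbound with a topmost point ahead, so
  \<open>no_fold\<close> excludes westbound steps in between; eastbound means that \<open>v\<close>
  is on the left.\<close>

theorem periodic_left_of_pole:
  assumes "p > 0" "(turn D ^^ p) s = s" "i \<le> p"
  shows "det3 (fst ((turn D ^^ i) s)) (snd ((turn D ^^ i) s)) v > 0"
proof -
  obtain \<delta> where "strip lifts lo hi hgt left_blocker right_blocker \<delta>" by (rule is_strip)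
  then interpret S: strip lifts lo hi hgt left_blocker right_blocker \<delta> .
  obtain a where a: "a \<in> lifts" "fst a = s" by (rule s_lift)
  obtain u where u: "is_arg u0 u" "lo a < u" "u < hi a" using u0_arg[OF a] .
  define z where "z = (\<lambda>i. (step ^^ i) (a, True))"
  have zA: "fst (a, True) \<in> lifts" using a by simp
  have pz: "proj (z i) = (turn D ^^ i) s" for i using step_proj[OF zA, of i] a by (simp add: z_def proj_def)
  obtain q where q: "p = Suc q" using assms(1) by (cases p) auto
  have "proj (z (Suc q)) = s" using pz[of "Suc q"] assms(2) q by simp
  then obtain a' u' where a': "z p = (a', True)" "u' < hi a'" "S.entry (z q) < u'"
      "\<And>c. c \<in> lifts \<Longrightarrow> hgt c u' \<le> hgt a' u'"
    using step_at_s[OF zA, of q] unfolding z_def q by metis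
  have "snd (z i)"
    by (rule S.no_fold[of z a u p a' u' i])
       (use a u a' top_at_u0[OF a u(1)] assms q in \<open>auto simp: z_def step_def\<close>)
  then show ?thesis using liftsD(2)[OF step_lifts[OF zA, of i]] pz[of i] by (simp add: proj_def z_def)
qed

text \<open>The westbound walk \<open>g\<close> from the middle of a lift of \<open>s\<close> serves
  as a boundary. The wanted walk is released on it more than \<open>N * pi\<close> further west and
  cannot get above it in \<open>N\<close> steps, whereas arriving on a lift of \<open>s\<close>
  would put it on a topmost point.\<close>

theorem walk_avoiding:
  obtains z where "z \<in> states D" "\<And>i. 0 < i \<Longrightarrow> i < N \<Longrightarrow> (turn D ^^ i) z \<noteq> s"
proof -
  obtain \<delta> where "strip lifts lo hi hgt left_blocker right_blocker \<delta>" by (rule is_strip)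
  then interpret S: strip lifts lo hi hgt left_blocker right_blocker \<delta> .
  obtain a where a: "a \<in> lifts" "fst a = s" by (rule s_lift)
  define \<phi> where "\<phi> = (lo a + hi a) / 2"
  define g where "g = (\<lambda>k. (left_blocker ^^ k) a)"
  have g: "strip.walk lifts (\<lambda>a. - hi a) (\<lambda>a. - lo a) left_blocker g (- \<phi>)"
    unfolding strip.walk_def[OF S.mirror] using a liftsD(3)[OF a(1)] by (auto simp: g_def \<phi>_def)
  have gA: "g k \<in> lifts" for k by (induction k) (auto simp: g_def a left_blocker)
  have dec: "lo (g k) \<le> lo a - real k * \<delta>" for k
  proof (induction k)
    case (Suc k) then show ?case using S.L_l[OF gA[of k]] by (simp add: g_def algebra_simps)
  qed (simp add: g_def)
  obtain k where k: "lo a - \<phi> + real N * pi < real k * \<delta>" using reals_Archimedean3[OF S.\<delta>_pos] by blast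
  define z where "z = (\<lambda>i. (step ^^ i) (g (Suc k), False))"
  have zA: "fst (g (Suc k), False) \<in> lifts" using gA by simp
  have pz: "proj (z i) = (turn D ^^ i) (proj (z 0))" for i using step_proj[OF zA, of i] by (simp add: z_def)
  have "(turn D ^^ i) (proj (z 0)) \<noteq> s" if i: "0 < i" "i < N" for i
  proof
    assume eq: "(turn D ^^ i) (proj (z 0)) = s"
    obtain q where q: "i = Suc q" using i by (cases i) auto
    have "proj (z (Suc q)) = s" using pz[of "Suc q"] eq q by simp
    then obtain a' u' where a': "z i = (a', True)" "u' < hi a'" "S.entry (z q) < u'"
        "\<And>c. c \<in> lifts \<Longrightarrow> hgt c u' \<le> hgt a' u'"
      using step_at_s[OF zA, of q] unfolding z_def q by metis
    have len: "hi c - lo c \<le> pi" if "c \<in> lifts" for c using liftsD(4)[OF that] by simp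
    have start: "lo (g (Suc k - 1)) \<le> \<phi> - real N * pi" using dec[of k] k by simp
    show False
      by (rule S.stay_below[OF g len _ start, of z i a' u']) (use a' q i in \<open>auto simp: z_def step_def\<close>)
  qed
  moreover have "proj (z 0) \<in> states D" using proj_in zA by (simp add: z_def)
  ultimately show thesis using that by blast
qed

end

section \<open>Existence of a generic pole close to a directed arc, and periodic walks\<close>

lemma cross3_perp_both:
  assumes "m \<noteq> 0" "cross3 t h \<noteq> 0" "m \<bullet> t = 0" "m \<bullet> h = 0"
  shows "m \<bullet> cross3 t h \<noteq> 0"
proof
  assume "m \<bullet> cross3 t h = 0"
  have "cross3 m (cross3 t h) = 0" unfolding Lagrange using assms by simp
  then have "cross3 m (cross3 t h) \<bullet> cross3 m (cross3 t h) = 0" by simp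
  then have "(m \<bullet> m) * (cross3 t h \<bullet> cross3 t h) = 0" unfolding dot_cross[of m "cross3 t h" m] using \<open>m \<bullet> cross3 t h = 0\<close> by simp
  then show False using assms by simp
qed

context diagram
begin

lemma near_pole_exists:
  assumes s: "s \<in> states D"
  obtains e1 e2 v u0 x0 y0 where "near_pole D e1 e2 v s u0 x0 y0"
proof -
  define t h n where "t = fst s" and "h = snd s" and "n = cross3 t h"
  have n0: "n \<noteq> 0" using state_indep[OF s] by (simp add: indep_def t_def h_def n_def)
  define d where "d = (\<lambda>b p. det3 (fst b) (snd b) p)"
  have dlin: "d b (x *\<^sub>R p + y *\<^sub>R q) = x * d b p + y * d b q" for b x y p q by (simp add: d_def det3_linear)
  \<comment> \<open>The point \<open>u0\<close> will be \<open>(1 - l) t + l h\<close> with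
    \<open>l\<close> close to 1: off every great circle that does not contain both \<open>t\<close>
    and \<open>h\<close>, and beyond every point at which an arc hits \<open>s\<close>.\<close>
  have lim: "((\<lambda>l. (1 - l) * a + l * b) \<longlongrightarrow> b) (at_left 1)" for a b :: real
    by (auto intro!: tendsto_eq_intros)
  have "\<forall>\<^sub>F l in at_left 1. \<forall>b\<in>states D. d b t \<noteq> 0 \<or> d b h \<noteq> 0 \<longrightarrow> (1 - l) * d b t + l * d b h \<noteq> 0"
  proof (intro eventually_ball_finite[OF finite_states] ballI)
    fix b
    consider "d b h \<noteq> 0" | "d b h = 0" by blast
    then show "\<forall>\<^sub>F l in at_left 1. d b t \<noteq> 0 \<or> d b h \<noteq> 0 \<longrightarrow> (1 - l) * d b t + l * d b h \<noteq> 0"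
    proof cases
      case 1
      show ?thesis using tendsto_imp_eventually_ne[OF lim 1] by eventually_elim auto
    next
      case 2
      have "\<forall>\<^sub>F l in at_left 1. l < (1::real)" by (simp add: eventually_at_filter)
      then show ?thesis by eventually_elim (use 2 in auto)
    qed
  qed
  moreover have "\<forall>\<^sub>F l in at_left 1. \<forall>b\<in>states D. \<forall>x y. x > 0 \<and> y > 0 \<and> snd b = x *\<^sub>R t + y *\<^sub>R h \<longrightarrow> y * (1 - l) < x * l"
  proof (intro eventually_ball_finite[OF finite_states] ballI)
    fix b
    show "\<forall>\<^sub>F l in at_left 1. \<forall>x y. x > 0 \<and> y > 0 \<and> snd b = x *\<^sub>R t + y *\<^sub>R h \<longrightarrow> y * (1 - l) < x * l"
    proof (cases "\<exists>x y. x > 0 \<and> y > 0 \<and> snd b = x *\<^sub>R t + y *\<^sub>R h")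
      case True
      then obtain x y where xy: "x > 0" "y > 0" "snd b = x *\<^sub>R t + y *\<^sub>R h" by blast
      have "\<forall>\<^sub>F l in at_left 1. 0 < (1 - l) * (- y) + l * x"
        by (rule order_tendstoD(1)[OF lim]) (rule xy)
      then show ?thesis
      proof eventually_elim
        case (elim l)
        show ?case
        proof (intro allI impI)
          fix x' y' assume "x' > 0 \<and> y' > 0 \<and> snd b = x' *\<^sub>R t + y' *\<^sub>R h"
          then have eq: "x' *\<^sub>R fst s + y' *\<^sub>R snd s = x *\<^sub>R fst s + y *\<^sub>R snd s"
            using xy(3) unfolding t_def h_def by metis
          have "x' = x" "y' = y" by (rule indep_comb_unique[OF state_indep[OF s] eq])+
          then show "y' * (1 - l) < x' * l" using elim by (simp add: algebra_simps)
        qed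
      qed
    next
      case False
      then have F: "\<not> (x > 0 \<and> y > 0 \<and> snd b = x *\<^sub>R t + y *\<^sub>R h)" for x y by blast
      show ?thesis by (simp only: F) simp
    qed
  qed
  moreover have "\<forall>\<^sub>F l in at_left 1. (0::real) < l \<and> l < 1"
    using eventually_at_leftI[of 0 1 "\<lambda>l. (0::real) < l \<and> l < 1"] by simp
  ultimately have "\<forall>\<^sub>F l in at_left 1. (\<forall>b\<in>states D. d b t \<noteq> 0 \<or> d b h \<noteq> 0 \<longrightarrow> (1 - l) * d b t + l * d b h \<noteq> 0) \<and>
     (\<forall>b\<in>states D. \<forall>x y. x > 0 \<and> y > 0 \<and> snd b = x *\<^sub>R t + y *\<^sub>R h \<longrightarrow> y * (1 - l) < x * l) \<and> 0 < l \<and> l < 1"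
    by eventually_elim blast
  then obtain l where l: "\<And>b. b \<in> states D \<Longrightarrow> d b t \<noteq> 0 \<or> d b h \<noteq> 0 \<Longrightarrow> (1 - l) * d b t + l * d b h \<noteq> 0"
      "\<And>b x y. b \<in> states D \<Longrightarrow> x > 0 \<Longrightarrow> y > 0 \<Longrightarrow> snd b = x *\<^sub>R t + y *\<^sub>R h \<Longrightarrow> y * (1 - l) < x * l"
      "0 < l" "l < 1"
    using eventually_happens'[OF trivial_limit_at_left_real[of "1::real"]] by blast
  \<comment> \<open>A great circle of the diagram through \<open>u0\<close> contains
    \<open>t\<close> and \<open>h\<close>, hence not the normal \<open>n\<close>. A small push along
    \<open>n\<close> therefore leaves all circles, and \<open>\<epsilon>'\<close> bounds the
    admissible pushes.\<close>
  define u0 where "u0 = (1 - l) *\<^sub>R t + l *\<^sub>R h"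
  have "\<forall>\<^sub>F e in at_right 0. \<forall>b\<in>states D. d b u0 + e * d b n \<noteq> 0"
  proof (intro eventually_ball_finite[OF finite_states] ballI)
    fix b assume b: "b \<in> states D"
    show "\<forall>\<^sub>F e in at_right 0. d b u0 + e * d b n \<noteq> 0"
    proof (cases "d b u0 = 0")
      case False
      have "((\<lambda>e. d b u0 + e * d b n) \<longlongrightarrow> d b u0) (at_right 0)" by (auto intro!: tendsto_eq_intros)
      then show ?thesis using tendsto_imp_eventually_ne False by blast
    next
      case True
      then have "d b t = 0" "d b h = 0" using l(1)[OF b] by (auto simp: u0_def dlin)
      then have "d b n \<noteq> 0" using cross3_perp_both[of "cross3 (fst b) (snd b)" t h] state_indep[OF b] n0
        by (auto simp: d_def det3_def n_def indep_def)
      have "\<forall>\<^sub>F e in at_right 0. 0 < (e::real)" by (rule eventually_at_right_less)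
      then show ?thesis by eventually_elim (use True \<open>d b n \<noteq> 0\<close> in auto)
    qed
  qed
  then obtain \<epsilon>' where e': "\<epsilon>' > 0" "\<And>e b. 0 < e \<Longrightarrow> e < \<epsilon>' \<Longrightarrow> b \<in> states D \<Longrightarrow> d b u0 + e * d b n \<noteq> 0"
    unfolding eventually_at_right_field by blast
  define \<epsilon> where "\<epsilon> = \<epsilon>' / 2"
  have e: "\<epsilon> > 0" "\<epsilon> < \<epsilon>'" using e' by (auto simp: \<epsilon>_def)
  define w where "w = u0 + \<epsilon> *\<^sub>R n"
  have dw: "d b w = d b u0 + \<epsilon> * d b n" for b using dlin[of b 1 u0 \<epsilon> n] by (simp add: w_def)
  have un: "u0 \<bullet> n = 0" by (simp add: u0_def n_def inner_add_left dot_cross_self)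
  have u00: "u0 \<noteq> 0" using indep_comb_eq_0(2)[OF state_indep[OF s], of "1 - l" l] l by (auto simp: u0_def t_def h_def)
  have dsw: "d s w > 0"
  proof -
    have "d s u0 = 0" by (simp add: d_def u0_def det3_linear det3_same t_def h_def)
    moreover have "d s n = n \<bullet> n" by (simp add: d_def det3_def n_def t_def h_def)
    ultimately show ?thesis using e n0 by (simp add: dw)
  qed
  then have w0: "w \<noteq> 0" by (auto simp: d_def det3_def)
  define v where "v = sgn w"
  have vw: "v = inverse (norm w) *\<^sub>R w" by (simp add: v_def sgn_div_norm)
  have dv: "d b v = inverse (norm w) * d b w" for b by (simp add: vw d_def det3_scaleR)
  have nv: "norm v = 1" using w0 by (simp add: v_def norm_sgn)
  \<comment> \<open>Orthogonal to both \<open>n\<close> and \<open>u0\<close>, hence to their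
    combination \<open>w\<close>.\<close>
  define e1 where "e1 = sgn (cross3 n u0)"
  have c0: "cross3 n u0 \<noteq> 0"
  proof
    assume "cross3 n u0 = 0"
    then have "cross3 n u0 \<bullet> cross3 n u0 = 0" by simp
    then show False unfolding dot_cross using un n0 u00 by (simp add: inner_commute)
  qed
  have e1: "norm e1 = 1" "e1 \<bullet> v = 0"
    using c0 by (simp_all add: e1_def norm_sgn vw w_def sgn_div_norm inner_add_right dot_cross_self)
  define e2 where "e2 = cross3 v e1"
  have sq: "e1 \<bullet> e1 = 1" "v \<bullet> v = 1" using e1 nv by (simp_all add: power2_norm_eq_inner[symmetric])
  have "e2 \<bullet> e2 = 1" unfolding e2_def dot_cross using sq e1 by (simp add: inner_commute)
  then have e2: "norm e2 = 1" by (simp add: norm_eq_1)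
  have e12: "e1 \<bullet> e2 = 0" by (simp add: e2_def dot_cross_self)
  have v: "v = cross3 e1 e2" unfolding e2_def Lagrange using sq e1 by simp
  have "near_pole D e1 e2 v s u0 (1 - l) l"
  proof
    show "norm e1 = 1" "norm e2 = 1" "e1 \<bullet> e2 = 0" "v = cross3 e1 e2" by fact+
    fix b assume b: "b \<in> states D"
    show "det3 (fst b) (snd b) v \<noteq> 0" using dv[of b] dw[of b] e'(2)[OF e b] w0 by (simp add: d_def)
    show "det3 (fst b) (snd b) (u0 + \<kappa> *\<^sub>R v) \<noteq> 0" if "\<kappa> > 0" for \<kappa>
    proof -
      define c where "c = \<kappa> * inverse (norm w)"
      have c: "c > 0" using that w0 by (simp add: c_def)
      \<comment> \<open>\<open>u0 + \<kappa> v\<close> is \<open>1 + c\<close> times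
        \<open>u0 + e'' n\<close>, and \<open>e'' \<le> \<epsilon>\<close>: up to scaling, the ray
        from \<open>u0\<close> towards \<open>v\<close> stays among the admissible pushes.\<close>
      define e'' where "e'' = c * \<epsilon> / (1 + c)"
      have "e'' > 0" using c e by (simp add: e''_def)
      moreover have "e'' \<le> \<epsilon>" using c e by (simp add: e''_def field_simps)
      ultimately have ne: "d b u0 + e'' * d b n \<noteq> 0" using e'(2)[of e'' b] e b by auto
      have "d b (u0 + \<kappa> *\<^sub>R v) = d b u0 + c * (d b u0 + \<epsilon> * d b n)"
        using dlin[of b 1 u0 \<kappa> v] by (simp add: dv dw c_def)
      also have "\<dots> = (1 + c) * (d b u0 + e'' * d b n)" using c by (simp add: e''_def field_simps)
      finally show ?thesis using ne c by (simp add: d_def)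
    qed
    show "y * (1 - l) < x * l" if "x > 0" "y > 0" "snd b = x *\<^sub>R fst s + y *\<^sub>R snd s" for x y
      using l(2)[OF b that(1,2)] that(3) by (simp add: t_def h_def)
  next
    show "det3 (fst s) (snd s) v > 0" using dv[of s] dsw w0 by (simp add: d_def)
    show "s \<in> states D" by fact
    show "0 < 1 - l" "0 < l" using l by auto
    show "u0 = (1 - l) *\<^sub>R fst s + l *\<^sub>R snd s" by (simp add: u0_def t_def h_def)
  qed
  then show thesis by (rule that)
qed

theorem periodic_convex:
  assumes "s \<in> states D" "p > 0" "(turn D ^^ p) s = s"
  obtains v where "\<And>i. det3 (fst ((turn D ^^ i) s)) (snd ((turn D ^^ i) s)) v > 0"
proof -
  obtain e1 e2 v u0 x0 y0 where "near_pole D e1 e2 v s u0 x0 y0" using near_pole_exists[OF assms(1)] .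
  then interpret N: near_pole D e1 e2 v s u0 x0 y0 .
  have "det3 (fst ((turn D ^^ i) s)) (snd ((turn D ^^ i) s)) v > 0" for i
    using N.periodic_left_of_pole[OF assms(2,3), of "i mod p"] funpow_mod_eq[OF assms(3), of i] assms(2)
    by (simp add: less_imp_le)
  then show thesis by (rule that)
qed

theorem periodic_avoiding:
  assumes "s \<in> states D"
  obtains z p where "z \<in> states D" "p > 0" "(turn D ^^ p) z = z" "\<And>i. (turn D ^^ i) z \<noteq> s"
proof -
  obtain e1 e2 v u0 x0 y0 where "near_pole D e1 e2 v s u0 x0 y0" using near_pole_exists[OF assms(1)] .
  then interpret N: near_pole D e1 e2 v s u0 x0 y0 .
  define M where "M = card (states D)"
  obtain z where z: "z \<in> states D" "\<And>i. 0 < i \<Longrightarrow> i < M + 3 \<Longrightarrow> (turn D ^^ i) z \<noteq> s"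
    using N.walk_avoiding[where N = "M + 3"] by blast
  \<comment> \<open>Indices start at 1 because \<open>walk_avoiding\<close> says nothing about the
    start itself. Two of \<open>M + 1\<close> consecutive states coincide, and both indices are in
    the range below \<open>M + 3\<close> where \<open>s\<close> is avoided.\<close>
  have "\<not> inj_on (\<lambda>i. (turn D ^^ i) z) {1..M + 1}"
  proof
    assume "inj_on (\<lambda>i. (turn D ^^ i) z) {1..M + 1}"
    then have "card {1..M + 1} \<le> M"
      unfolding M_def by (rule card_inj_on_le) (use turn_funpow_in[OF z(1)] finite_states in auto)
    then show False by simp
  qed
  then obtain i j where "i \<in> {1..M + 1}" "j \<in> {1..M + 1}" "i \<noteq> j" "(turn D ^^ i) z = (turn D ^^ j) z"
    unfolding inj_on_def by blast
  then have "0 < min i j" "min i j < max i j" "max i j < M + 3" "(turn D ^^ min i j) z = (turn D ^^ max i j) z"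
    by (auto simp: min_def max_def)
  then obtain i j where ij: "0 < i" "i < j" "j < M + 3" "(turn D ^^ i) z = (turn D ^^ j) z" by blast
  define y where "y = (turn D ^^ i) z"
  have per: "(turn D ^^ (j - i)) y = y"
    using ij funpow_add[of "j - i" i "turn D"] by (simp add: y_def)
  show thesis
  proof (rule that[of y "j - i"])
    show "y \<in> states D" using turn_funpow_in[OF z(1)] by (simp add: y_def)
    show "0 < j - i" using ij by simp
    show "(turn D ^^ (j - i)) y = y" by (rule per)
    fix k
    have "(turn D ^^ k) y = (turn D ^^ (k mod (j - i) + i)) z"
      using funpow_mod_eq[OF per, of k] by (simp add: y_def funpow_add)
    moreover have "0 < k mod (j - i) + i" "k mod (j - i) + i < M + 3"
      using ij mod_less_divisor[of "j - i" k] by linarith+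
    ultimately show "(turn D ^^ k) y \<noteq> s" using z(2) by simp
  qed
qed

end

subsection \<open>Every SD has at least six arcs\<close>

definition arc_of :: "arc set \<Rightarrow> arc \<Rightarrow> arc" where
  "arc_of D s = (if s \<in> D then s else prod.swap s)"

text \<open>Injectivity is required of the undirected arcs, as a swirl is a list of distinct arcs;
  it also makes \<open>p\<close> the least period.\<close>

definition left_cycle :: "arc set \<Rightarrow> arc \<Rightarrow> nat \<Rightarrow> bool" where
  "left_cycle D z p \<longleftrightarrow> z \<in> states D \<and> p > 0 \<and> (turn D ^^ p) z = z \<and> inj_on (\<lambda>i. arc_of D ((turn D ^^ i) z)) {..<p}"

definition cycle_arcs :: "arc set \<Rightarrow> arc \<Rightarrow> nat \<Rightarrow> arc set" where
  "cycle_arcs D z p = (\<lambda>i. arc_of D ((turn D ^^ i) z)) ` {..<p}"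

definition touch :: "arc \<Rightarrow> arc \<Rightarrow> bool" where
  "touch a b \<longleftrightarrow> hits a b \<or> hits b a"

context diagram
begin

lemma arc_of_in: "s \<in> states D \<Longrightarrow> arc_of D s \<in> D"
  by (auto simp: arc_of_def elim: states_cases)

lemma arc_of_cases: "arc_of D s = s \<or> arc_of D s = prod.swap s"
  by (auto simp: arc_of_def)

lemma arc_of_eq: "a \<in> D \<Longrightarrow> arc_of D a = a" by (simp add: arc_of_def)

lemma arc_of_swap: "s \<in> states D \<Longrightarrow> arc_of D (prod.swap s) = arc_of D s"
  using swap_not_in by (auto simp: arc_of_def elim!: states_cases)

lemma arc_of_eq_iff:
  assumes "s \<in> states D" "s' \<in> states D"
  shows "arc_of D s = arc_of D s' \<longleftrightarrow> s' = s \<or> s' = prod.swap s"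
  using arc_of_swap[OF assms(1)] arc_of_cases[of s] arc_of_cases[of s'] by (metis swap_swap)

lemma in_cone_arc_of: "in_cone p (arc_of D s) \<longleftrightarrow> in_cone p s"
  using arc_of_cases[of s] in_cone_swap by metis

lemma hits_iff:
  assumes "a \<in> D" "b \<in> D"
  shows "hits a b \<longleftrightarrow> in_cone (fst a) b \<or> in_cone (snd a) b"
  using assms valid by (auto simp: hits_def arc_int_iff valid_arc_def)

lemma hits_state:
  assumes "s \<in> states D" "b \<in> states D" "in_cone (snd s) b"
  shows "hits (arc_of D s) (arc_of D b)"
  using hits_iff[OF arc_of_in[OF assms(1)] arc_of_in[OF assms(2)]] assms(3) in_cone_arc_of arc_of_cases[of s] by auto

lemma hitsE:
  assumes "hits a b" "a \<in> D" "b \<in> D"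
  obtains s where "s \<in> states D" "arc_of D s = a" "in_cone (snd s) b"
proof -
  have a: "a \<in> states D" using assms by (simp add: states_def)
  have "in_cone (fst a) b \<or> in_cone (snd a) b" using hits_iff assms by simp
  then show thesis
    using that[of a] that[of "prod.swap a"] a swap_states[OF a] arc_of_eq[OF assms(2)] arc_of_swap[OF a] by auto
qed

lemma not_both_ends:
  assumes "s \<in> states D" "b \<in> states D" "in_cone (fst s) b" "in_cone (snd s) b"
  shows False
proof -
  obtain x y where "fst s = x *\<^sub>R fst b + y *\<^sub>R snd b" using assms(3) by (auto simp: in_cone_def)
  moreover obtain x' y' where "snd s = x' *\<^sub>R fst b + y' *\<^sub>R snd b" using assms(4) by (auto simp: in_cone_def)
  ultimately have "det3 (fst s) (snd s) (fst b) = 0" by (simp add: det3_linear det3_same)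
  then show False using transversal assms by blast
qed

text \<open>The plane of \<open>s\<close> would contain \<open>snd s\<close> and
  \<open>snd b\<close>, two independent points of the plane of \<open>b\<close>, against
  \<open>transversal\<close>.\<close>

lemma no_mutual:
  assumes "s \<in> states D" "b \<in> states D" "in_cone (snd s) b" "in_cone (snd b) s"
  shows False
proof -
  obtain x y where xy: "x > 0" "snd s = x *\<^sub>R fst b + y *\<^sub>R snd b" using assms(3) by (auto simp: in_cone_def)
  have "det3 (fst s) (snd s) (x *\<^sub>R fst b + y *\<^sub>R snd b) = 0" unfolding xy(2)[symmetric] by (rule det3_same)
  then have "x * det3 (fst s) (snd s) (fst b) = 0" using det3_in_cone[OF assms(4)] by (simp add: det3_linear)
  then show False using transversal[OF assms(1-3)] xy(1) by simp
qed

lemma hits_antisym: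
  assumes "a \<in> D" "b \<in> D" "hits a b" "hits b a" shows False
proof -
  obtain s where s: "s \<in> states D" "arc_of D s = a" "in_cone (snd s) b" by (rule hitsE[OF assms(3,1,2)])
  obtain s' where s': "s' \<in> states D" "arc_of D s' = b" "in_cone (snd s') a" by (rule hitsE[OF assms(4,2,1)])
  show False
    by (rule no_mutual[OF s(1) s'(1)]) (use s s' in_cone_arc_of in metis)+
qed

lemma hits_irrefl: "a \<in> D \<Longrightarrow> \<not> hits a a"
  using hits_antisym by blast

lemma turn_hits: "s \<in> states D \<Longrightarrow> hits (arc_of D s) (arc_of D (turn D s))"
  by (simp add: hits_state turn)

lemma turn_from_left:
  assumes "s \<in> states D" shows "det3 (fst (turn D s)) (snd (turn D s)) (fst s) > 0"
proof -
  let ?b = "turn D s"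
  obtain x y where xy: "x > 0" "snd s = x *\<^sub>R fst ?b + y *\<^sub>R snd ?b" using turn(2)[OF assms] by (auto simp: in_cone_def)
  have "det3 (fst s) (snd s) (snd ?b) = x * det3 (fst ?b) (snd ?b) (fst s)"
    by (subst xy(2)) (simp add: det3_linear det3_same det3_rotate)
  then show ?thesis using turn(3)[OF assms] xy(1) by (simp add: zero_less_mult_iff)
qed

text \<open>Apart from their heads, which lie in the plane of \<open>b\<close>, the two arcs are in
  opposite open half-spaces of it, so no end of one is interior to the other.\<close>

lemma opposite_sides_no_touch:
  assumes "b \<in> states D" "s \<in> states D" "s' \<in> states D" "in_cone (snd s) b" "in_cone (snd s') b"
    and "det3 (fst b) (snd b) (fst s) > 0" "det3 (fst b) (snd b) (fst s') < 0"
  shows "\<not> touch (arc_of D s) (arc_of D s')" "arc_of D s \<noteq> arc_of D s'"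
proof -
  define d where "d = det3 (fst b) (snd b)"
  have d: "d (fst s) > 0" "d (snd s) = 0" "d (fst s') < 0" "d (snd s') = 0"
    using assms det3_in_cone by (auto simp: d_def)
  have c: "d q > 0" if "in_cone q s" for q
    using that d by (auto simp: in_cone_def d_def det3_linear)
  have c': "d q < 0" if "in_cone q s'" for q
    using that d by (auto simp: in_cone_def d_def det3_linear mult_pos_neg)
  have "\<not> hits (arc_of D s) (arc_of D s')"
    using hits_iff[OF arc_of_in[OF assms(2)] arc_of_in[OF assms(3)]] c'[of "fst s"] c'[of "snd s"] d arc_of_cases[of s]
    by (auto simp: in_cone_arc_of)
  moreover have "\<not> hits (arc_of D s') (arc_of D s)"
    using hits_iff[OF arc_of_in[OF assms(3)] arc_of_in[OF assms(2)]] c[of "fst s'"] c[of "snd s'"] d arc_of_cases[of s']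
    by (auto simp: in_cone_arc_of)
  ultimately show "\<not> touch (arc_of D s) (arc_of D s')" by (simp add: touch_def)
  have "s' \<noteq> s" "s' \<noteq> prod.swap s" using d by auto
  then show "arc_of D s \<noteq> arc_of D s'" using arc_of_eq_iff[OF assms(2,3)] by simp
qed

text \<open>The pole on the left of the whole walk rules out that an arc is used in both directions,
  so a repeated arc would be a repeated state and shorten the least period.\<close>

lemma periodic_left_cycle:
  assumes "z \<in> states D" "p > 0" "(turn D ^^ p) z = z"
  obtains q where "left_cycle D z q"
proof -
  define q where "q = (LEAST q. q > 0 \<and> (turn D ^^ q) z = z)"
  have q: "q > 0" "(turn D ^^ q) z = z" unfolding q_def by (rule LeastI2[of _ p]; use assms in blast)+
  have least: "q \<le> m" if "m > 0" "(turn D ^^ m) z = z" for m unfolding q_def by (rule Least_le) (use that in blast)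
  obtain v where v: "\<And>i. det3 (fst ((turn D ^^ i) z)) (snd ((turn D ^^ i) z)) v > 0"
    using periodic_convex[OF assms(1) q] by blast
  have "i = j" if "i < j" "j < q" "arc_of D ((turn D ^^ i) z) = arc_of D ((turn D ^^ j) z)" for i j
  proof -
    have "(turn D ^^ j) z = (turn D ^^ i) z \<or> (turn D ^^ j) z = prod.swap ((turn D ^^ i) z)"
      using arc_of_eq_iff[OF turn_funpow_in turn_funpow_in, OF assms(1) assms(1)] that(3) by simp
    moreover have "(turn D ^^ j) z \<noteq> prod.swap ((turn D ^^ i) z)"
      using v[of i] v[of j] det3_swap(1)[of "fst ((turn D ^^ i) z)" "snd ((turn D ^^ i) z)" v] by auto
    ultimately have "(turn D ^^ (q - j)) ((turn D ^^ i) z) = (turn D ^^ (q - j)) ((turn D ^^ j) z)" by simp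
    also have "\<dots> = z" using q(2) that funpow_add[of "q - j" j "turn D"] by simp
    finally have "(turn D ^^ (q - j + i)) z = z" by (simp add: funpow_add)
    then show ?thesis using least[of "q - j + i"] that by simp
  qed
  then have "inj_on (\<lambda>i. arc_of D ((turn D ^^ i) z)) {..<q}"
    by (intro inj_onI) (metis lessThan_iff linorder_neqE_nat)
  then show thesis using that q assms(1) by (simp add: left_cycle_def)
qed

lemma left_cycle_shift:
  assumes "left_cycle D z p" shows "left_cycle D ((turn D ^^ i) z) p"
proof -
  have mod_shift: "j = k" if "j \<le> k" "k < p" "(j + i) mod p = (k + i) mod p" for j k
  proof -
    have "p dvd k - j" using mod_eq_dvd_iff_nat[of "j + i" "k + i" p] that by simp
    then show ?thesis using that dvd_imp_le[of p "k - j"] by (cases "k = j") auto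
  qed
  have "(turn D ^^ p) ((turn D ^^ i) z) = (turn D ^^ i) z"
    using assms unfolding left_cycle_def by (metis add.commute comp_apply funpow_add)
  moreover have "inj_on (\<lambda>j. arc_of D ((turn D ^^ j) ((turn D ^^ i) z))) {..<p}"
  proof (rule inj_onI)
    fix j k assume jk: "j \<in> {..<p}" "k \<in> {..<p}" "arc_of D ((turn D ^^ j) ((turn D ^^ i) z)) = arc_of D ((turn D ^^ k) ((turn D ^^ i) z))"
    have "arc_of D ((turn D ^^ ((j + i) mod p)) z) = arc_of D ((turn D ^^ ((k + i) mod p)) z)"
      using jk(3) assms by (simp add: funpow_mod_eq left_cycle_def funpow_add)
    then have "(j + i) mod p = (k + i) mod p" using assms by (auto simp: left_cycle_def inj_on_def)
    then show "j = k" using jk(1,2) by (metis lessThan_iff mod_shift nat_le_linear)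
  qed
  ultimately show ?thesis using assms turn_funpow_in by (simp add: left_cycle_def)
qed

text \<open>The second periodic walk is chosen to avoid the state \<open>z\<close> of the first. A
  shared state would lead it to \<open>z\<close>, as both orbits continue identically.\<close>

lemma disjoint_left_cycles:
  obtains z p z' p' where "left_cycle D z p" "left_cycle D z' p'" "\<And>i j. (turn D ^^ i) z \<noteq> (turn D ^^ j) z'"
proof -
  have "D \<noteq> {}" using SD by (simp add: SD_def)
  then obtain a where "a \<in> states D" by (auto simp: states_def)
  then obtain z p where z: "z \<in> states D" "p > 0" "(turn D ^^ p) z = z" by (rule periodic_avoiding)
  obtain q where q: "left_cycle D z q" using periodic_left_cycle[OF z] .
  obtain z' p' where z': "z' \<in> states D" "p' > 0" "(turn D ^^ p') z' = z'" "\<And>i. (turn D ^^ i) z' \<noteq> z"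
    using periodic_avoiding[OF z(1)] by blast
  obtain q' where q': "left_cycle D z' q'" using periodic_left_cycle[OF z'(1-3)] .
  have "(turn D ^^ i) z \<noteq> (turn D ^^ j) z'" for i j
  proof
    assume "(turn D ^^ i) z = (turn D ^^ j) z'"
    then have "(turn D ^^ (p * i - i)) ((turn D ^^ i) z) = (turn D ^^ (p * i - i + j)) z'" by (simp add: funpow_add)
    moreover have "(turn D ^^ (p * i - i)) ((turn D ^^ i) z) = (turn D ^^ (p * i)) z"
    proof -
      have "p * i - i + i = p * i" using z(2) by (cases p) auto
      then show ?thesis using funpow_add[of "p * i - i" i "turn D"] by simp
    qed
    moreover have "\<dots> = z" using funpow_mod_eq[OF z(3), of "p * i"] by simp
    ultimately show False using z'(4) by metis
  qed
  then show thesis using that[OF q q'] by blast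
qed

lemma card_cycle_arcs: "left_cycle D z p \<Longrightarrow> card (cycle_arcs D z p) = p"
  unfolding left_cycle_def cycle_arcs_def using card_image[of _ "{..<p}"] by (metis card_lessThan)

lemma cycle_arcs_subset: "left_cycle D z p \<Longrightarrow> cycle_arcs D z p \<subseteq> D"
  unfolding left_cycle_def cycle_arcs_def using arc_of_in[OF turn_funpow_in] by blast

lemma left_cycle_length:
  assumes "left_cycle D z p" shows "3 \<le> p"
proof (rule ccontr)
  assume "\<not> 3 \<le> p"
  moreover have "p > 0" using assms by (simp add: left_cycle_def)
  ultimately consider "p = 1" | "p = 2" by linarith
  then show False
  proof cases
    case 1
    then have "turn D z = z" "z \<in> states D" using assms by (auto simp: left_cycle_def)
    then show False using turn_hits[of z] hits_irrefl arc_of_in by metis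
  next
    case 2
    then have "turn D (turn D z) = z" "z \<in> states D" using assms by (auto simp: left_cycle_def numeral_2_eq_2)
    then show False using turn_hits[of z] turn_hits[of "turn D z"] hits_antisym turn(1) arc_of_in by metis
  qed
qed

lemma left_cycle_pred:
  assumes "left_cycle D z p" obtains j where "turn D ((turn D ^^ j) z) = (turn D ^^ i) z"
proof -
  have p: "p > 0" "(turn D ^^ p) z = z" using assms by (auto simp: left_cycle_def)
  have "(turn D ^^ (p + i)) z = (turn D ^^ i) z" using funpow_mod_eq[OF p(2), of "p + i"] funpow_mod_eq[OF p(2), of i] by simp
  then show thesis using that[of "p + i - 1"] p by (cases p) auto
qed

section \<open>Counting hitting pairs\<close>

definition hit_pairs :: "arc set set" where
  "hit_pairs = (\<lambda>s. {arc_of D s, arc_of D (turn D s)}) ` states D"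

lemma hit_pair_inj: "inj_on (\<lambda>s. {arc_of D s, arc_of D (turn D s)}) (states D)"
proof (rule inj_onI)
  fix s s' assume s: "s \<in> states D" "s' \<in> states D" and eq: "{arc_of D s, arc_of D (turn D s)} = {arc_of D s', arc_of D (turn D s')}"
  have t: "turn D s \<in> states D" "turn D s' \<in> states D" using turn s by auto
  from eq consider "arc_of D s = arc_of D s'" "arc_of D (turn D s) = arc_of D (turn D s')"
    | "arc_of D s = arc_of D (turn D s')" "arc_of D (turn D s) = arc_of D s'" by (auto simp: doubleton_eq_iff)
  then show "s = s'"
  proof cases
    case 1
    show ?thesis
    proof (rule ccontr)
      assume "s \<noteq> s'"
      then have "s' = prod.swap s" using arc_of_eq_iff[OF s] 1 by auto
      moreover have "in_cone (snd s') (turn D s)" using turn(2)[OF s(2)] 1(2) in_cone_arc_of by metis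
      ultimately show False using not_both_ends[OF s(1) t(1) _ turn(2)[OF s(1)]] by simp
    qed
  next
    case 2
    then show ?thesis using turn_hits[OF s(1)] turn_hits[OF s(2)] hits_antisym arc_of_in s t by metis
  qed
qed

lemma card_states: "card (states D) = 2 * card D"
proof -
  have "D \<inter> prod.swap ` D = {}" using swap_not_in by auto
  then show ?thesis unfolding states_def using finite_D
    by (subst card_Un_disjoint) (auto simp: card_image)
qed

lemma hit_pairs_subset: "hit_pairs \<subseteq> {P. P \<subseteq> D \<and> card P = 2}"
proof -
  have "arc_of D s \<noteq> arc_of D (turn D s)" "arc_of D s \<in> D" "arc_of D (turn D s) \<in> D" if "s \<in> states D" for s
    using turn_hits[OF that] hits_irrefl arc_of_in[OF that] arc_of_in[OF turn(1)[OF that]] by metis+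
  then show ?thesis unfolding hit_pairs_def by (intro image_subsetI) simp
qed

lemma card_ge_6: "6 \<le> card D"
proof (rule ccontr)
  assume n: "\<not> 6 \<le> card D"
  have ch: "card {P. P \<subseteq> D \<and> card P = 2} = card D choose 2" by (rule n_subsets[OF finite_D])
  have ph: "card hit_pairs = 2 * card D" unfolding hit_pairs_def using card_image[OF hit_pair_inj] card_states by simp
  have fin: "finite {P. P \<subseteq> D \<and> card P = 2}" using finite_D by auto
  have le: "2 * card D \<le> card D choose 2" using card_mono[OF fin hit_pairs_subset] ch ph by simp
  have pos: "card D > 0" using finite_D SD by (auto simp: SD_def card_gt_0_iff)
  \<comment> \<open>Twice \<open>n\<close> is at most \<open>n\<close> choose 2 only if
    \<open>n\<close> is at least 5.\<close>
  have n5: "card D = 5"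
  proof -
    have "card D \<in> {1, 2, 3, 4, 5}" using n pos by auto
    then show ?thesis using le by (auto simp: choose_two)
  qed
  have all: "hit_pairs = {P. P \<subseteq> D \<and> card P = 2}"
    by (rule card_subset_eq[OF fin hit_pairs_subset]) (simp add: ch ph n5 choose_two)
  have touch: "touch a b" if "a \<in> D" "b \<in> D" "a \<noteq> b" for a b
  proof -
    have "{a, b} \<in> hit_pairs" unfolding all using that by simp
    then obtain s where "s \<in> states D" "{a, b} = {arc_of D s, arc_of D (turn D s)}" by (auto simp: hit_pairs_def)
    then show ?thesis using turn_hits[of s] by (auto simp: touch_def doubleton_eq_iff)
  qed
  obtain z p z' p' where c: "left_cycle D z p" "left_cycle D z' p'" "\<And>i j. (turn D ^^ i) z \<noteq> (turn D ^^ j) z'"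
    using disjoint_left_cycles by blast
  have zs: "(turn D ^^ i) z \<in> states D" "(turn D ^^ i) z' \<in> states D" for i
    using c turn_funpow_in by (auto simp: left_cycle_def)
  \<comment> \<open>The orbits share no state, so a shared arc is traversed in opposite directions
    and its two predecessors reach it from opposite sides. Such arcs do not touch, although here
    every pair does.\<close>
  have "cycle_arcs D z p \<inter> cycle_arcs D z' p' = {}"
  proof (rule ccontr)
    assume "cycle_arcs D z p \<inter> cycle_arcs D z' p' \<noteq> {}"
    then obtain a where "a \<in> cycle_arcs D z p" "a \<in> cycle_arcs D z' p'" by blast
    then obtain i j where ij: "arc_of D ((turn D ^^ i) z) = arc_of D ((turn D ^^ j) z')" unfolding cycle_arcs_def by blast
    define b where "b = (turn D ^^ i) z"
    have bj: "(turn D ^^ j) z' = prod.swap b" using arc_of_eq_iff[OF zs, of i j] ij c(3)[of i j] by (auto simp: b_def)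
    obtain k where k: "turn D ((turn D ^^ k) z) = b" using left_cycle_pred[OF c(1)] unfolding b_def .
    obtain k' where k': "turn D ((turn D ^^ k') z') = prod.swap b" using left_cycle_pred[OF c(2)] unfolding bj[symmetric] .
    let ?s = "(turn D ^^ k) z" and ?s' = "(turn D ^^ k') z'"
    have b: "b \<in> states D" using zs by (simp add: b_def)
    have b1: "in_cone (snd ?s) b" "det3 (fst b) (snd b) (fst ?s) > 0"
      using turn(2)[OF zs(1), of k] turn_from_left[OF zs(1), of k] unfolding k by auto
    have b2: "in_cone (snd ?s') b" "det3 (fst b) (snd b) (fst ?s') < 0"
      using turn(2)[OF zs(2), of k'] turn_from_left[OF zs(2), of k'] det3_swap(1)[of "fst b" "snd b" "fst ?s'"]
      unfolding k' in_cone_swap by auto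
    have "\<not> touch (arc_of D ?s) (arc_of D ?s')" "arc_of D ?s \<noteq> arc_of D ?s'"
      by (rule opposite_sides_no_touch[OF b zs(1) zs(2) b1(1) b2(1) b1(2) b2(2)])+
    then show False using touch[OF arc_of_in arc_of_in, OF zs(1) zs(2)] by blast
  qed
  then have "card (cycle_arcs D z p \<union> cycle_arcs D z' p') = p + p'"
    using card_Un_disjoint[of "cycle_arcs D z p" "cycle_arcs D z' p'"] card_cycle_arcs c finite_subset[OF cycle_arcs_subset finite_D] by simp
  moreover have "card (cycle_arcs D z p \<union> cycle_arcs D z' p') \<le> card D"
    by (rule card_mono[OF finite_D]) (use cycle_arcs_subset c in blast)
  ultimately show False using left_cycle_length[OF c(1)] left_cycle_length[OF c(2)] n by linarith
qed

end

subsection \<open>Two swirls of each orientation\<close>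

context diagram
begin

lemma hits_at_state:
  assumes "s \<in> states D" "b \<in> states D" "in_cone (snd s) b"
  shows "hits_at (arc_of D s) (arc_of D b) (snd s) (fst s)"
proof -
  have "snd s \<in> arc_int (arc_of D b)"
    using arc_int_iff[OF valid[OF arc_of_in[OF assms(2)]]] state_S2(2)[OF assms(1)] assms(3) in_cone_arc_of by auto
  then show ?thesis using arc_of_cases[of s] by (auto simp: hits_at_def)
qed

definition cycle_list :: "arc \<Rightarrow> nat \<Rightarrow> arc list" where
  "cycle_list z p = map (\<lambda>i. arc_of D ((turn D ^^ i) z)) [0..<p]"

lemma cycle_list_nth:
  assumes "left_cycle D z p" shows "cycle_list z p ! (i mod p) = arc_of D ((turn D ^^ i) z)"
proof -
  have "p > 0" "(turn D ^^ p) z = z" using assms by (auto simp: left_cycle_def)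
  then have "(turn D ^^ (i mod p)) z = (turn D ^^ i) z" "i mod p < p" by (simp_all add: funpow_mod_eq)
  then show ?thesis by (simp add: cycle_list_def)
qed

lemma cycle_list_swirl:
  assumes c: "left_cycle D z p" shows "ccw_swirl D (cycle_list z p)"
proof -
  have z: "(turn D ^^ i) z \<in> states D" for i using c turn_funpow_in by (simp add: left_cycle_def)
  have p: "p > 0" using c by (simp add: left_cycle_def)
  have len: "length (cycle_list z p) = p" by (simp add: cycle_list_def)
  have "set (cycle_list z p) \<subseteq> D" using arc_of_in[OF z] by (auto simp: cycle_list_def)
  moreover have "distinct (cycle_list z p)"
    using c by (auto simp: cycle_list_def distinct_map left_cycle_def atLeast0LessThan)
  moreover have "\<exists>q' q e r. hits_at (cycle_list z p ! i) (cycle_list z p ! ((i + 1) mod p)) q' q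
      \<and> hits_at (cycle_list z p ! ((i + 1) mod p)) (cycle_list z p ! ((i + 2) mod p)) e r \<and> det3 q q' e > 0" if "i < p" for i
  proof -
    have i: "cycle_list z p ! i = arc_of D ((turn D ^^ i) z)" using cycle_list_nth[OF c, of i] that by simp
    let ?s = "(turn D ^^ i) z"
    have "hits_at (arc_of D ?s) (arc_of D (turn D ?s)) (snd ?s) (fst ?s)"
      "hits_at (arc_of D (turn D ?s)) (arc_of D (turn D (turn D ?s))) (snd (turn D ?s)) (fst (turn D ?s))"
      using hits_at_state[OF z turn(1)[OF z] turn(2)[OF z]]
        hits_at_state[OF turn(1)[OF z] turn(1)[OF turn(1)[OF z]] turn(2)[OF turn(1)[OF z]]] by auto
    moreover have "(turn D ^^ (i + 1)) z = turn D ?s" "(turn D ^^ (i + 2)) z = turn D (turn D ?s)"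
      by (simp_all add: numeral_2_eq_2)
    ultimately show ?thesis unfolding i cycle_list_nth[OF c] using turn(3)[OF z[of i]] by metis
  qed
  ultimately show ?thesis using p len unfolding ccw_swirl_def swirl_dir_def by auto
qed

lemma finite_swirls: "finite {xs. swirl_dir D good xs}"
  by (rule finite_subset[OF _ finite_subset_distinct[OF finite_D]]) (auto simp: swirl_dir_def)

text \<open>Arc lists forget directions. Disjoint orbits with equal lists up to rotation would
  traverse an arc in opposite directions with the same arc following, so that one arc would hit
  another with both ends.\<close>

lemma cycle_list_cyc_neq:
  assumes c: "left_cycle D z p" "left_cycle D z' p'" and ne: "\<And>i j. (turn D ^^ i) z \<noteq> (turn D ^^ j) z'"
  shows "cyc (cycle_list z p) \<noteq> cyc (cycle_list z' p')"
proof
  assume eq: "cyc (cycle_list z p) = cyc (cycle_list z' p')"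
  have "cycle_list z p \<in> cyc (cycle_list z p)" unfolding cyc_def by (metis rangeI rotate0 id_apply)
  then obtain k where k: "cycle_list z p = rotate k (cycle_list z' p')" unfolding eq by (auto simp: cyc_def)
  have len: "length (cycle_list y q) = q" for y q by (simp add: cycle_list_def)
  have pp: "p = p'" using arg_cong[OF k, of length] by (simp add: len)
  have p: "p > 0" using c by (simp add: left_cycle_def)
  have rot: "arc_of D ((turn D ^^ i) z) = arc_of D ((turn D ^^ (k + i)) z')" if "i < p" for i
    using cycle_list_nth[OF c(1), of i] cycle_list_nth[OF c(2), of "k + i"] that nth_rotate[of i "cycle_list z' p'" k]
    by (simp add: k[symmetric] len pp)
  have z: "(turn D ^^ i) z \<in> states D" "(turn D ^^ i) z' \<in> states D" for i
    using c turn_funpow_in by (auto simp: left_cycle_def)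
  let ?s' = "(turn D ^^ k) z'"
  have "arc_of D z = arc_of D ?s'" using rot[of 0] p by simp
  then have s': "?s' = prod.swap z" using arc_of_eq_iff[OF z(1)[of 0] z(2)[of k]] ne[of 0 k] by simp
  have "arc_of D (turn D z) = arc_of D (turn D ?s')"
    using rot[of 1] left_cycle_length[OF c(1)] by simp
  then have "in_cone (snd ?s') (turn D z)" using turn(2)[OF z(2)[of k]] in_cone_arc_of by metis
  then show False using not_both_ends[OF z(1)[of 0] _ _ turn(2)] turn z(1)[of 0] s' by simp
qed

lemma num_ccw_ge_2: "2 \<le> num_ccw_swirls D"
proof -
  obtain z p z' p' where c: "left_cycle D z p" "left_cycle D z' p'" "\<And>i j. (turn D ^^ i) z \<noteq> (turn D ^^ j) z'"
    using disjoint_left_cycles by blast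
  have "{cyc (cycle_list z p), cyc (cycle_list z' p')} \<subseteq> cyc ` {xs. ccw_swirl D xs}"
    using cycle_list_swirl c by blast
  then have "card {cyc (cycle_list z p), cyc (cycle_list z' p')} \<le> num_ccw_swirls D"
    unfolding num_ccw_swirls_def ccw_swirl_def by (intro card_mono finite_imageI finite_swirls) simp
  then show ?thesis using cycle_list_cyc_neq[OF c] by simp
qed

end

section \<open>The antipodal map\<close>

definition neg_arc :: "arc \<Rightarrow> arc" where
  "neg_arc a = (- fst a, - snd a)"

lemma neg_arc_simps [simp]: "neg_arc (neg_arc a) = a" "fst (neg_arc a) = - fst a" "snd (neg_arc a) = - snd a"
  "prod.swap (neg_arc a) = neg_arc (prod.swap a)"
  by (simp_all add: neg_arc_def)

lemma inj_neg_arc: "inj neg_arc"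
  by (metis injI neg_arc_simps(1))

lemma sgn_neg_comb: "sgn ((1 - t) *\<^sub>R - a + t *\<^sub>R - b) = - sgn ((1 - t) *\<^sub>R a + t *\<^sub>R (b::pt))"
proof -
  have "(1 - t) *\<^sub>R - a + t *\<^sub>R - b = - ((1 - t) *\<^sub>R a + t *\<^sub>R b)" by simp
  then show ?thesis by (simp only: sgn_minus)
qed

lemma eq_uminus_iff: "p = - q \<longleftrightarrow> - p = (q::pt)" by auto

lemma mem_uminus_image: "p \<in> uminus ` X \<longleftrightarrow> - p \<in> (X::pt set)"
proof
  assume "- p \<in> X"
  then have "- (- p) \<in> uminus ` X" by (rule imageI)
  then show "p \<in> uminus ` X" by simp
qed auto

lemma arc_int_neg: "arc_int (neg_arc a) = uminus ` arc_int a"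
  unfolding arc_int_def neg_arc_simps sgn_neg_comb by auto

lemma arc_int_neg_iff: "p \<in> arc_int (neg_arc a) \<longleftrightarrow> - p \<in> arc_int a"
  unfolding arc_int_neg by (rule mem_uminus_image)

lemma in_cone_neg: "in_cone p (neg_arc a) \<longleftrightarrow> in_cone (- p) a"
proof -
  have "p = x *\<^sub>R - fst a + y *\<^sub>R - snd a \<longleftrightarrow> - p = x *\<^sub>R fst a + y *\<^sub>R snd a" for x y
    using eq_uminus_iff[of p "x *\<^sub>R fst a + y *\<^sub>R snd a"] by simp
  then show ?thesis by (simp add: in_cone_def)
qed

lemma det3_neg: "det3 (- a) (- b) (- c) = - det3 a b c"
  by (simp add: det3_coords algebra_simps)

lemma valid_arc_neg: "valid_arc (neg_arc a) \<longleftrightarrow> valid_arc a"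
  by (auto simp: valid_arc_def S2_def minus_equation_iff[of "fst a"])

lemma SD_neg: assumes "SD D" shows "SD (neg_arc ` D)"
proof -
  have "arc_int (neg_arc a) \<inter> arc_int (neg_arc b) = {}" if "a \<in> D" "b \<in> D" "neg_arc a \<noteq> neg_arc b" for a b
    using assms that unfolding SD_def arc_int_neg by (metis (no_types, lifting) image_Int image_empty inj_uminus)
  moreover have "(\<exists>a\<in>neg_arc ` D. fst b \<in> arc_int a) \<and> (\<exists>a\<in>neg_arc ` D. snd b \<in> arc_int a)" if b: "b \<in> neg_arc ` D" for b
  proof -
    obtain b0 where b0: "b0 \<in> D" "b = neg_arc b0" using b by blast
    then obtain a a' where "a \<in> D" "fst b0 \<in> arc_int a" "a' \<in> D" "snd b0 \<in> arc_int a'"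
      using assms unfolding SD_def by blast
    then have "neg_arc a \<in> neg_arc ` D" "fst b \<in> arc_int (neg_arc a)" "neg_arc a' \<in> neg_arc ` D" "snd b \<in> arc_int (neg_arc a')"
      using b0 by (simp_all add: arc_int_neg_iff)
    then show ?thesis by blast
  qed
  ultimately show ?thesis using assms unfolding SD_def by (auto simp: valid_arc_neg)
qed

lemma hits_at_neg: "hits_at (neg_arc b) (neg_arc a) p q \<longleftrightarrow> hits_at b a (- p) (- q)"
  unfolding hits_at_def arc_int_neg_iff neg_arc_simps eq_uminus_iff by (rule refl)

text \<open>The antipodal map preserves hits and changes the sign of \<open>det3\<close>, so it
  exchanges left and right turns at every junction.\<close>

lemma cw_swirl_neg: "cw_swirl D (map neg_arc ys) \<longleftrightarrow> ccw_swirl (neg_arc ` D) ys"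
proof -
  have junction: "(\<exists>p q e r. hits_at (neg_arc a) (neg_arc b) p q \<and> hits_at (neg_arc b) (neg_arc c) e r \<and> det3 q p e < 0)
     \<longleftrightarrow> (\<exists>p q e r. hits_at a b p q \<and> hits_at b c e r \<and> 0 < det3 q p e)" for a b c
  proof
    assume "\<exists>p q e r. hits_at (neg_arc a) (neg_arc b) p q \<and> hits_at (neg_arc b) (neg_arc c) e r \<and> det3 q p e < 0"
    then obtain p q e r where "hits_at a b (- p) (- q)" "hits_at b c (- e) (- r)" "det3 q p e < 0"
      unfolding hits_at_neg by blast
    moreover have "det3 (- q) (- p) (- e) > 0" using det3_neg[of q p e] \<open>det3 q p e < 0\<close> by simp
    ultimately show "\<exists>p q e r. hits_at a b p q \<and> hits_at b c e r \<and> 0 < det3 q p e" by blast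
  next
    assume "\<exists>p q e r. hits_at a b p q \<and> hits_at b c e r \<and> 0 < det3 q p e"
    then obtain p q e r where *: "hits_at a b p q" "hits_at b c e r" "det3 q p e > 0" by blast
    have "hits_at (neg_arc a) (neg_arc b) (- p) (- q) \<and> hits_at (neg_arc b) (neg_arc c) (- e) (- r) \<and> det3 (- q) (- p) (- e) < 0"
      using * det3_neg[of q p e] by (simp add: hits_at_neg)
    then show "\<exists>p q e r. hits_at (neg_arc a) (neg_arc b) p q \<and> hits_at (neg_arc b) (neg_arc c) e r \<and> det3 q p e < 0" by blast
  qed
  have sub: "neg_arc ` set ys \<subseteq> D \<longleftrightarrow> set ys \<subseteq> neg_arc ` D"
  proof -
    have nn: "neg_arc ` neg_arc ` X = X" for X by (simp add: image_image)
    show ?thesis using image_mono[of "neg_arc ` set ys" D neg_arc] image_mono[of "set ys" "neg_arc ` D" neg_arc] unfolding nn by blast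
  qed
  have bound: "(i + j) mod length ys < length ys" if "i < length ys" for i j
    using that by (intro mod_less_divisor) auto
  have "(\<forall>i<length ys. \<exists>p q e r. hits_at (map neg_arc ys ! i) (map neg_arc ys ! ((i + 1) mod length ys)) p q \<and>
      hits_at (map neg_arc ys ! ((i + 1) mod length ys)) (map neg_arc ys ! ((i + 2) mod length ys)) e r \<and> det3 q p e < 0)
    \<longleftrightarrow> (\<forall>i<length ys. \<exists>p q e r. hits_at (ys ! i) (ys ! ((i + 1) mod length ys)) p q \<and>
      hits_at (ys ! ((i + 1) mod length ys)) (ys ! ((i + 2) mod length ys)) e r \<and> 0 < det3 q p e)"
  proof (intro all_cong)
    fix i assume i: "i < length ys"
    show "(\<exists>p q e r. hits_at (map neg_arc ys ! i) (map neg_arc ys ! ((i + 1) mod length ys)) p q \<and>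
      hits_at (map neg_arc ys ! ((i + 1) mod length ys)) (map neg_arc ys ! ((i + 2) mod length ys)) e r \<and> det3 q p e < 0)
     \<longleftrightarrow> (\<exists>p q e r. hits_at (ys ! i) (ys ! ((i + 1) mod length ys)) p q \<and>
      hits_at (ys ! ((i + 1) mod length ys)) (ys ! ((i + 2) mod length ys)) e r \<and> 0 < det3 q p e)"
      unfolding nth_map[OF i] nth_map[OF bound[OF i]] by (rule junction)
  qed
  then show ?thesis
    unfolding cw_swirl_def ccw_swirl_def swirl_dir_def length_map set_map sub distinct_map
    using inj_on_subset[OF inj_neg_arc] by simp
qed

lemma cyc_map: "cyc (map f xs) = map f ` cyc xs"
  by (auto simp: cyc_def rotate_map)

lemma num_cw_swirls_neg: "num_cw_swirls D = num_ccw_swirls (neg_arc ` D)"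
proof -
  have "map neg_arc ` {ys. ccw_swirl (neg_arc ` D) ys} = {xs. cw_swirl D xs}"
  proof (intro equalityI subsetI)
    fix xs assume "xs \<in> {xs. cw_swirl D xs}"
    moreover have "map neg_arc (map neg_arc xs) = xs" by (simp add: map_idI)
    ultimately have "ccw_swirl (neg_arc ` D) (map neg_arc xs)" using cw_swirl_neg[of D "map neg_arc xs"] by simp
    then show "xs \<in> map neg_arc ` {ys. ccw_swirl (neg_arc ` D) ys}"
      using \<open>map neg_arc (map neg_arc xs) = xs\<close> by (metis image_eqI mem_Collect_eq)
  qed (auto simp: cw_swirl_neg)
  then have "cyc ` {xs. cw_swirl D xs} = (\<lambda>C. map neg_arc ` C) ` cyc ` {ys. ccw_swirl (neg_arc ` D) ys}"
    by (metis (no_types, lifting) cyc_map image_cong image_image)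
  moreover have "inj_on (\<lambda>C. map neg_arc ` C) X" for X
    by (rule inj_onI) (simp add: inj_image_eq_iff[OF inj_mapI[OF inj_neg_arc]])
  ultimately show ?thesis unfolding num_cw_swirls_def num_ccw_swirls_def by (simp add: card_image)
qed

lemma num_swirls_ge_2: assumes "SD D" shows "2 \<le> num_cw_swirls D" "2 \<le> num_ccw_swirls D"
  using diagram.num_ccw_ge_2[of D] diagram.num_ccw_ge_2[of "neg_arc ` D"] SD_neg assms
  by (simp_all add: num_cw_swirls_neg diagram_def)

subsection \<open>Every SOD has at least eight arcs\<close>

text \<open>\<open>\<sigma> = 1\<close> for cycles turning left at every junction, \<open>\<sigma> = -1\<close> for right turns.\<close>

definition hit_cycle :: "arc set \<Rightarrow> real \<Rightarrow> (nat \<Rightarrow> arc) \<Rightarrow> nat \<Rightarrow> bool" where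
  "hit_cycle D \<sigma> w p \<longleftrightarrow> 3 \<le> p \<and> (\<forall>i. w i \<in> states D \<and> w (i + p) = w i \<and> in_cone (snd (w i)) (w (Suc i))
     \<and> \<sigma> * det3 (fst (w (Suc i))) (snd (w (Suc i))) (fst (w i)) > 0)
     \<and> inj_on (\<lambda>i. arc_of D (w i)) {..<p}
     \<and> (p = 4 \<longrightarrow> (\<forall>i. \<not> touch (arc_of D (w i)) (arc_of D (w (i + 2)))))"

definition walk_arcs :: "arc set \<Rightarrow> (nat \<Rightarrow> arc) \<Rightarrow> nat \<Rightarrow> arc set" where
  "walk_arcs D w p = (\<lambda>i. arc_of D (w i)) ` {..<p}"

context diagram
begin

text \<open>If \<open>z\<close> hit the opposite arc \<open>c\<close>, it would do so with its tail.
  Along \<open>c\<close>, the great circle of \<open>z\<close> then puts the head of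
  \<open>b\<close> beyond the tail of \<open>z\<close>, while the great circle of \<open>b\<close>
  gives the reverse order. This justifies the clause for length four in
  \<open>hit_cycle\<close>.\<close>

lemma four_cycle_no_hit:
  assumes "z \<in> states D" "(turn D ^^ 4) z = z"
  shows "\<not> hits (arc_of D z) (arc_of D (turn D (turn D z)))"
proof
  assume hit: "hits (arc_of D z) (arc_of D (turn D (turn D z)))"
  define b c d where "b = turn D z" and "c = turn D b" and "d = turn D c"
  have st: "b \<in> states D" "c \<in> states D" "d \<in> states D" using assms(1) turn(1) by (auto simp: b_def c_def d_def)
  have dz: "turn D d = z" using assms(2) by (simp add: b_def c_def d_def numeral_eq_Suc)
  have cone: "in_cone (snd z) b" "in_cone (snd b) c" "in_cone (snd c) d" "in_cone (snd d) z"
    using turn(2)[OF assms(1)] turn(2)[OF st(1)] turn(2)[OF st(2)] turn(2)[OF st(3)] by (simp_all add: b_def[symmetric] c_def[symmetric] d_def[symmetric] dz)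
  have "c \<noteq> b" "c \<noteq> prod.swap b"
  proof -
    have "arc_of D b \<noteq> arc_of D c" using turn_hits[OF st(1)] hits_irrefl arc_of_in st by (metis c_def)
    then show "c \<noteq> b" "c \<noteq> prod.swap b" using arc_of_eq_iff[OF st(1,2)] by auto
  qed
  then have "\<not> in_cone (snd z) c" using cones_disjoint[OF st(1,2) cone(1)] by blast
  moreover have "in_cone (fst z) c \<or> in_cone (snd z) c"
    using hit hits_iff[OF arc_of_in[OF assms(1)] arc_of_in[OF st(2)]] in_cone_arc_of arc_of_cases[of z]
    unfolding b_def[symmetric] c_def[symmetric] by auto
  ultimately have wc: "in_cone (fst z) c" by blast
  define A where "A = det3 (fst z) (snd z)"
  define B where "B = det3 (fst b) (snd b)"
  obtain \<alpha> \<beta> where ab: "\<alpha> > 0" "\<beta> > 0" "snd b = \<alpha> *\<^sub>R fst c + \<beta> *\<^sub>R snd c" using cone(2) by (auto simp: in_cone_def)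
  obtain \<gamma> \<delta> where gd: "\<gamma> > 0" "\<delta> > 0" "fst z = \<gamma> *\<^sub>R fst c + \<delta> *\<^sub>R snd c" using wc by (auto simp: in_cone_def)
  have A1: "\<alpha> * A (fst c) + \<beta> * A (snd c) > 0"
    using turn(3)[OF assms(1)] ab(3) by (simp add: A_def det3_linear(3)[symmetric] b_def[symmetric])
  have A2: "\<gamma> * A (fst c) + \<delta> * A (snd c) = 0"
    using det3_same(2)[of "fst z" "snd z"] gd(3) unfolding A_def det3_linear(3)[symmetric] by metis
  \<comment> \<open>\<open>c\<close> ends inside \<open>d\<close>, whose head is on \<open>z\<close>
    and whose tail is to the left of \<open>z\<close>.\<close>
  have A3: "A (snd c) > 0"
  proof -
    obtain x y where xy: "x > 0" "y > 0" "snd c = x *\<^sub>R fst d + y *\<^sub>R snd d" using cone(3) by (auto simp: in_cone_def)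
    have "A (snd d) = 0" using det3_in_cone[OF cone(4)] by (simp add: A_def)
    moreover have "A (fst d) > 0" using turn_from_left[OF st(3)] by (simp add: A_def dz)
    ultimately show ?thesis unfolding xy(3) using xy(1) by (simp add: A_def det3_linear)
  qed
  have B1: "\<alpha> * B (fst c) + \<beta> * B (snd c) = 0"
    using det3_same(3)[of "fst b" "snd b"] ab(3) unfolding B_def det3_linear(3)[symmetric] by metis
  have B2: "\<gamma> * B (fst c) + \<delta> * B (snd c) > 0"
    using turn_from_left[OF assms(1)] gd(3) unfolding B_def det3_linear(3)[symmetric] b_def by simp
  have B3: "B (snd c) > 0" using turn(3)[OF st(1)] by (simp add: B_def c_def)
  have "\<gamma> * (\<alpha> * A (fst c) + \<beta> * A (snd c)) - \<alpha> * (\<gamma> * A (fst c) + \<delta> * A (snd c)) = (\<gamma> * \<beta> - \<alpha> * \<delta>) * A (snd c)" by (simp add: algebra_simps)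
  then have "(\<gamma> * \<beta> - \<alpha> * \<delta>) * A (snd c) > 0" using mult_pos_pos[OF gd(1) A1] A2 by simp
  then have 1: "\<gamma> * \<beta> - \<alpha> * \<delta> > 0" using A3 by (simp add: zero_less_mult_iff)
  have "\<alpha> * (\<gamma> * B (fst c) + \<delta> * B (snd c)) - \<gamma> * (\<alpha> * B (fst c) + \<beta> * B (snd c)) = (\<alpha> * \<delta> - \<gamma> * \<beta>) * B (snd c)" by (simp add: algebra_simps)
  then have "(\<alpha> * \<delta> - \<gamma> * \<beta>) * B (snd c) > 0" using mult_pos_pos[OF ab(1) B2] B1 by simp
  then have "\<alpha> * \<delta> - \<gamma> * \<beta> > 0" using B3 by (simp add: zero_less_mult_iff)
  then show False using 1 by simp
qed

lemma left_cycle_hit_cycle: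
  assumes c: "left_cycle D z p" shows "hit_cycle D 1 (\<lambda>i. (turn D ^^ i) z) p"
proof -
  have z: "(turn D ^^ i) z \<in> states D" for i using c turn_funpow_in by (simp add: left_cycle_def)
  have per: "(turn D ^^ (i + p)) z = (turn D ^^ i) z" for i using c by (simp add: left_cycle_def funpow_add)
  have "\<not> touch (arc_of D ((turn D ^^ i) z)) (arc_of D ((turn D ^^ (i + 2)) z))" if "p = 4" for i
  proof -
    have four: "(turn D ^^ 4) ((turn D ^^ j) z) = (turn D ^^ j) z" for j
      using per[of j] that by (simp add: funpow_add[symmetric, THEN fun_cong, unfolded comp_def] add.commute)
    have two: "(turn D ^^ (j + 2)) z = turn D (turn D ((turn D ^^ j) z))" for j by (simp add: numeral_2_eq_2)
    have "turn D (turn D ((turn D ^^ (i + 2)) z)) = (turn D ^^ i) z"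
      using per[of i] that by (simp add: numeral_eq_Suc)
    then show ?thesis
      using four_cycle_no_hit[OF z four, of i] four_cycle_no_hit[OF z four, of "i + 2"] unfolding touch_def two[of i, symmetric] by simp
  qed
  then show ?thesis
    using left_cycle_length[OF c] z per turn(2)[OF z] turn_from_left[OF z] c
    by (auto simp: hit_cycle_def left_cycle_def)
qed

end

lemma SOD_same_side:
  assumes "SOD D" and b: "b \<in> states D" and s: "s \<in> states D" "s' \<in> states D" "in_cone (snd s) b" "in_cone (snd s') b"
  shows "sgn (det3 (fst b) (snd b) (fst s)) = sgn (det3 (fst b) (snd b) (fst s'))"
proof -
  interpret diagram D using assms(1) by (simp add: diagram_def SOD_def)
  have "hits_at (arc_of D s) (arc_of D b) (snd s) (fst s) \<and> hits_at (arc_of D s') (arc_of D b) (snd s') (fst s')"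
    using hits_at_state b s by blast
  then have "sgn (det3 (fst (arc_of D b)) (snd (arc_of D b)) (fst s)) = sgn (det3 (fst (arc_of D b)) (snd (arc_of D b)) (fst s'))"
    using assms(1) arc_of_in b s unfolding SOD_def by blast
  then show ?thesis
    using arc_of_cases[of b] det3_swap(1)[of "fst b" "snd b"] by (auto simp: sgn_minus)
qed

text \<open>In a SOD an arc is reached from one side only; this side and the turning sense of a
  cycle determine the direction in which the cycle traverses the arc.\<close>

lemma hit_cycle_orientation:
  assumes "SOD D" "hit_cycle D \<sigma> w p" "hit_cycle D \<sigma>' w' p'" and eq: "arc_of D (w i) = arc_of D (w' j)"
    and \<sigma>: "\<sigma> \<in> {1, -1}" "\<sigma>' \<in> {1, -1}"
  shows "w' j = (if \<sigma> = \<sigma>' then w i else prod.swap (w i))"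
proof -
  interpret diagram D using assms(1) by (simp add: diagram_def SOD_def)
  have st: "w k \<in> states D" "w' k \<in> states D" for k using assms by (auto simp: hit_cycle_def)
  \<comment> \<open>Cyclic predecessors, shifted by a full period to stay within the
    naturals.\<close>
  define m where "m = i + p - 1"
  define m' where "m' = j + p' - 1"
  have m: "w (Suc m) = w i" "w' (Suc m') = w' j" using assms(2,3) by (auto simp: m_def m'_def hit_cycle_def)
  have cone: "in_cone (snd (w m)) (w i)" "in_cone (snd (w' m')) (w' j)"
    and side: "\<sigma> * det3 (fst (w i)) (snd (w i)) (fst (w m)) > 0" "\<sigma>' * det3 (fst (w' j)) (snd (w' j)) (fst (w' m')) > 0"
    using assms(2,3) unfolding hit_cycle_def by (metis m)+
  have c: "w' j = w i \<or> w' j = prod.swap (w i)" using arc_of_eq_iff[OF st] eq by simp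
  have cone': "in_cone (snd (w' m')) (w i)" using c cone(2) in_cone_swap by metis
  have same: "sgn (det3 (fst (w i)) (snd (w i)) (fst (w m))) = sgn (det3 (fst (w i)) (snd (w i)) (fst (w' m')))"
    by (rule SOD_same_side[OF assms(1) st(1) st(1) st(2) cone(1) cone'])
  show ?thesis
  proof (cases "w' j = w i")
    case True
    then have "\<sigma> = \<sigma>'" using side same \<sigma> by (auto simp: sgn_if split: if_splits)
    then show ?thesis using True by simp
  next
    case False
    then have sw: "w' j = prod.swap (w i)" using c by simp
    have "\<sigma> \<noteq> \<sigma>'"
      using side same \<sigma> det3_swap(1)[of "fst (w i)" "snd (w i)"] unfolding sw by (auto simp: sgn_if split: if_splits)
    then show ?thesis using sw by simp
  qed
qed

text \<open>Two arcs of a triangle are consecutive, and the other cycle traverses both backwards.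
  There they cannot be consecutive: in one order an arc would hit another with both ends, in the
  other two arcs would hit each other. So they are opposite arcs of a 4-cycle, which do not
  touch.\<close>

lemma triangle_meets_cycle_once:
  assumes "SOD D" "hit_cycle D \<sigma> w 3" "hit_cycle D \<sigma>' w' p'" "p' \<le> 4" "\<sigma>' = - \<sigma>" "\<sigma> \<in> {1, -1}"
  shows "card (walk_arcs D w 3 \<inter> walk_arcs D w' p') \<le> 1"
proof (rule ccontr)
  interpret diagram D using assms(1) by (simp add: diagram_def SOD_def)
  have st: "w k \<in> states D" "w' k \<in> states D" for k using assms by (auto simp: hit_cycle_def)
  have per: "w (k + 3) = w k" "w' (k + p') = w' k" for k using assms(2,3) by (auto simp: hit_cycle_def)
  have p': "p' = 3 \<or> p' = 4" using assms(3,4) by (auto simp: hit_cycle_def)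
  have cone: "in_cone (snd (w k)) (w (Suc k))" "in_cone (snd (w' k)) (w' (Suc k))" for k
    using assms by (auto simp: hit_cycle_def)
  have ori: "w' j = prod.swap (w i)" if "arc_of D (w i) = arc_of D (w' j)" for i j
    using hit_cycle_orientation[OF assms(1-3) that] assms(5,6) by auto
  have no: False if "arc_of D (w i) = arc_of D (w' j)" "arc_of D (w (Suc i)) = arc_of D (w' l)" "l < p'" "j < p'" "j \<noteq> l" for i j l
  proof -
    have sw: "w' j = prod.swap (w i)" "w' l = prod.swap (w (Suc i))" using ori that(1,2) by auto
    have hit: "hits (arc_of D (w i)) (arc_of D (w (Suc i)))" by (rule hits_state[OF st(1) st(1) cone(1)])
    have A: "w' (Suc j) \<noteq> w' l"
    proof
      assume "w' (Suc j) = w' l"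
      then have "in_cone (fst (w i)) (w (Suc i))" using cone(2)[of j] sw in_cone_swap by simp
      then show False using not_both_ends[OF st(1) st(1) _ cone(1)] by blast
    qed
    have B: "w' (Suc l) \<noteq> w' j"
    proof
      assume "w' (Suc l) = w' j"
      then have "hits (arc_of D (w' l)) (arc_of D (w' j))" using hits_state[OF st(2) st(2) cone(2), of l] by simp
      then show False using hit hits_antisym arc_of_in st that by metis
    qed
    have wrap: "w' p' = w' 0" using per(2)[of 0] by simp
    have "p' = 4 \<and> (l = j + 2 \<or> j = l + 2)"
    proof -
      have "l \<noteq> Suc j" "j \<noteq> Suc l" using A B by auto
      moreover have "\<not> (Suc j = p' \<and> l = 0)" using A wrap by metis
      moreover have "\<not> (Suc l = p' \<and> j = 0)" using B wrap by metis
      ultimately show ?thesis using that(3-5) p' by auto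
    qed
    moreover have "\<forall>i. \<not> touch (arc_of D (w' i)) (arc_of D (w' (i + 2)))"
      using assms(3) calculation by (simp only: hit_cycle_def) blast
    ultimately have "\<not> touch (arc_of D (w' j)) (arc_of D (w' l))"
      unfolding touch_def by blast
    then show False using hit that by (simp add: touch_def)
  qed
  assume "\<not> card (walk_arcs D w 3 \<inter> walk_arcs D w' p') \<le> 1"
  then have "2 \<le> card (walk_arcs D w 3 \<inter> walk_arcs D w' p')" by simp
  then obtain P where "P \<subseteq> walk_arcs D w 3 \<inter> walk_arcs D w' p'" "card P = 2" by (rule obtain_subset_with_card_n)
  then obtain a b where ab: "a \<noteq> b" "a \<in> walk_arcs D w 3" "b \<in> walk_arcs D w 3" "a \<in> walk_arcs D w' p'" "b \<in> walk_arcs D w' p'"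
    unfolding card_2_iff by blast
  obtain i k where ik: "i < 3" "k < 3" "a = arc_of D (w i)" "b = arc_of D (w k)" using ab unfolding walk_arcs_def by auto
  obtain j l where jl: "j < p'" "l < p'" "a = arc_of D (w' j)" "b = arc_of D (w' l)" using ab unfolding walk_arcs_def by auto
  have ne: "i \<noteq> k" "j \<noteq> l" using ab ik jl by auto
  have "w k = w (Suc i) \<or> w i = w (Suc k)"
  proof -
    have w3: "w 3 = w 0" using per(1)[of 0] by simp
    have "k = Suc i \<or> i = Suc k \<or> (i = 2 \<and> k = 0) \<or> (k = 2 \<and> i = 0)" using ik(1,2) ne(1) by auto
    then show ?thesis using w3 by (auto simp: numeral_3_eq_3 numeral_2_eq_2)
  qed
  then show False
  proof
    assume "w k = w (Suc i)"
    then show False using no[of i j l] ik jl ne by simp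
  next
    assume "w i = w (Suc k)"
    then show False using no[of k l j] ik jl ne by simp
  qed
qed

lemma hit_cycle_card: "hit_cycle D \<sigma> w p \<Longrightarrow> card (walk_arcs D w p) = p"
  unfolding hit_cycle_def walk_arcs_def using card_image[of _ "{..<p}"] by (metis card_lessThan)

lemma (in diagram) hit_cycle_subset: "hit_cycle D \<sigma> w p \<Longrightarrow> walk_arcs D w p \<subseteq> D"
  unfolding hit_cycle_def walk_arcs_def using arc_of_in by blast

text \<open>Cycles sharing an arc would share it with its direction by
  \<open>hit_cycle_orientation\<close>, but the orbits are disjoint.\<close>

lemma left_hit_cycles:
  assumes "SOD D"
  obtains w p w' p' where "hit_cycle D 1 w p" "hit_cycle D 1 w' p'" "walk_arcs D w p \<inter> walk_arcs D w' p' = {}"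
proof -
  interpret diagram D using assms(1) by (simp add: diagram_def SOD_def)
  obtain z p z' p' where c: "left_cycle D z p" "left_cycle D z' p'" "\<And>i j. (turn D ^^ i) z \<noteq> (turn D ^^ j) z'"
    using disjoint_left_cycles by blast
  note h = left_cycle_hit_cycle[OF c(1)] left_cycle_hit_cycle[OF c(2)]
  have "walk_arcs D (\<lambda>i. (turn D ^^ i) z) p \<inter> walk_arcs D (\<lambda>i. (turn D ^^ i) z') p' = {}"
  proof (rule ccontr)
    assume "\<not> ?thesis"
    then obtain a where "a \<in> walk_arcs D (\<lambda>i. (turn D ^^ i) z) p" "a \<in> walk_arcs D (\<lambda>i. (turn D ^^ i) z') p'" by blast
    then obtain i j where "arc_of D ((turn D ^^ i) z) = arc_of D ((turn D ^^ j) z')" unfolding walk_arcs_def by blast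
    from hit_cycle_orientation[OF assms h this] show False using c(3)[of i j] by simp
  qed
  then show thesis using that h by blast
qed

section \<open>Transfer of hit cycles to right turns\<close>

lemma states_neg: "states (neg_arc ` D) = neg_arc ` states D"
  unfolding states_def image_Un image_image neg_arc_simps ..

lemma neg_arc_mem: "neg_arc a \<in> neg_arc ` X \<longleftrightarrow> a \<in> X"
  using inj_image_mem_iff[OF inj_neg_arc] .

lemma arc_of_neg: "arc_of (neg_arc ` D) (neg_arc s) = neg_arc (arc_of D s)"
  by (simp add: arc_of_def neg_arc_mem)

lemma hits_neg: "hits (neg_arc a) (neg_arc b) \<longleftrightarrow> hits a b"
  by (simp add: hits_def arc_int_neg_iff)

lemma hit_cycle_neg:
  assumes "hit_cycle (neg_arc ` D) \<sigma> w p" shows "hit_cycle D (- \<sigma>) (\<lambda>i. neg_arc (w i)) p"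
proof -
  have a: "arc_of D (neg_arc s) = neg_arc (arc_of (neg_arc ` D) s)" for s
    using arc_of_neg[of D "neg_arc s"] by (metis neg_arc_simps(1))
  have st: "neg_arc s \<in> states D" if "s \<in> states (neg_arc ` D)" for s using that by (auto simp: states_neg)
  have t: "touch (neg_arc a) (neg_arc b) \<longleftrightarrow> touch a b" for a b by (simp add: touch_def hits_neg)
  have inj: "inj_on (\<lambda>i. arc_of D (neg_arc (w i))) {..<p} \<longleftrightarrow> inj_on (\<lambda>i. arc_of (neg_arc ` D) (w i)) {..<p}"
    unfolding a inj_on_def using inj_eq[OF inj_neg_arc] by simp
  show ?thesis using assms unfolding hit_cycle_def inj by (simp add: st in_cone_neg det3_neg a t)
qed

lemma walk_arcs_neg: "walk_arcs D (\<lambda>i. neg_arc (w i)) p = neg_arc ` walk_arcs (neg_arc ` D) w p"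
proof -
  have "arc_of D (neg_arc s) = neg_arc (arc_of (neg_arc ` D) s)" for s
    using arc_of_neg[of D "neg_arc s"] by (metis neg_arc_simps(1))
  then show ?thesis by (simp add: walk_arcs_def image_image)
qed

lemma SOD_neg: assumes "SOD D" shows "SOD (neg_arc ` D)"
proof -
  have SD: "SD (neg_arc ` D)" using assms SD_neg by (simp add: SOD_def)
  have "sgn (det3 (fst (neg_arc a)) (snd (neg_arc a)) q) = sgn (det3 (fst (neg_arc a)) (snd (neg_arc a)) q')"
    if "a \<in> D" "b \<in> D" "c \<in> D" "hits_at (neg_arc b) (neg_arc a) p q \<and> hits_at (neg_arc c) (neg_arc a) p' q'" for a b c p q p' q'
  proof -
    have "sgn (det3 (fst a) (snd a) (- q)) = sgn (det3 (fst a) (snd a) (- q'))"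
      using assms that unfolding SOD_def hits_at_neg by blast
    then show ?thesis using det3_neg[of "fst a" "snd a" "- q"] det3_neg[of "fst a" "snd a" "- q'"] by (simp add: sgn_minus)
  qed
  then show ?thesis using SD unfolding SOD_def by blast
qed

lemma right_hit_cycles:
  assumes "SOD D"
  obtains w p w' p' where "hit_cycle D (- 1) w p" "hit_cycle D (- 1) w' p'" "walk_arcs D w p \<inter> walk_arcs D w' p' = {}"
proof -
  obtain w p w' p' where w: "hit_cycle (neg_arc ` D) 1 w p" "hit_cycle (neg_arc ` D) 1 w' p'"
    "walk_arcs (neg_arc ` D) w p \<inter> walk_arcs (neg_arc ` D) w' p' = {}"
    by (rule left_hit_cycles[OF SOD_neg[OF assms]])
  have "walk_arcs D (\<lambda>i. neg_arc (w i)) p \<inter> walk_arcs D (\<lambda>i. neg_arc (w' i)) p' = {}"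
    unfolding walk_arcs_neg image_Int[OF inj_neg_arc, symmetric] w(3) by simp
  then show thesis using that hit_cycle_neg[OF w(1)] hit_cycle_neg[OF w(2)] by blast
qed

lemma triangle_outside:
  assumes "SOD D" "hit_cycle D \<sigma> w 3" "hit_cycle D (- \<sigma>) r q" "hit_cycle D (- \<sigma>) r' q'" "q \<le> 4" "q' \<le> 4" "\<sigma> \<in> {1, -1}"
  shows "1 \<le> card (walk_arcs D w 3 - (walk_arcs D r q \<union> walk_arcs D r' q'))"
proof -
  let ?W = "walk_arcs D w 3" and ?R = "walk_arcs D r q" and ?R' = "walk_arcs D r' q'"
  have f: "finite ?W" by (simp add: walk_arcs_def)
  have "?W = (?W - (?R \<union> ?R')) \<union> (?W \<inter> ?R) \<union> (?W \<inter> ?R')" by blast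
  then have "card ?W = card ((?W - (?R \<union> ?R')) \<union> (?W \<inter> ?R) \<union> (?W \<inter> ?R'))" by simp
  then have "card ?W \<le> card (?W - (?R \<union> ?R')) + card (?W \<inter> ?R) + card (?W \<inter> ?R')"
    using card_Un_le[of "(?W - (?R \<union> ?R')) \<union> (?W \<inter> ?R)" "?W \<inter> ?R'"] card_Un_le[of "?W - (?R \<union> ?R')" "?W \<inter> ?R"] by linarith
  then show ?thesis
    using triangle_meets_cycle_once[OF assms(1,2,3,5) refl assms(7)] triangle_meets_cycle_once[OF assms(1,2,4,6) refl assms(7)]
      hit_cycle_card[OF assms(2)] by simp
qed

text \<open>With at most seven arcs, the two disjoint cycles of one orientation have lengths 3 and 3
  or 3 and 4. A triangle among them has an arc outside the two cycles of the other orientation,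
  which leaves these only six arcs. Hence all four cycles are triangles, and each left one adds an
  arc of its own to the six arcs of the right ones.\<close>

lemma SOD_card_ge_8: assumes "SOD D" shows "8 \<le> card D"
proof (rule ccontr)
  interpret diagram D using assms(1) by (simp add: diagram_def SOD_def)
  assume "\<not> 8 \<le> card D"
  then have n: "card D \<le> 7" by simp
  have lower: "3 \<le> p" if "hit_cycle D \<sigma> w p" for \<sigma> w p using that by (simp add: hit_cycle_def)
  have sum: "card (walk_arcs D w p \<union> walk_arcs D w' p') = p + p' \<and> p + p' \<le> 7"
    if "hit_cycle D \<sigma> w p" "hit_cycle D \<sigma> w' p'" "walk_arcs D w p \<inter> walk_arcs D w' p' = {}" for \<sigma> w p w' p'
  proof -
    have "card (walk_arcs D w p \<union> walk_arcs D w' p') = p + p'"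
      using card_Un_disjoint[OF _ _ that(3)] hit_cycle_card[OF that(1)] hit_cycle_card[OF that(2)] by (simp add: walk_arcs_def)
    moreover have "card (walk_arcs D w p \<union> walk_arcs D w' p') \<le> card D"
      using hit_cycle_subset that by (intro card_mono[OF finite_D]) blast
    ultimately show ?thesis using n by simp
  qed
  have both3: "r + r' = 6"
    if "\<sigma> \<in> {1, -1}" "hit_cycle D \<sigma> w p" "hit_cycle D \<sigma> w' p'" "walk_arcs D w p \<inter> walk_arcs D w' p' = {}"
      "hit_cycle D (- \<sigma>) v r" "hit_cycle D (- \<sigma>) v' r'" "walk_arcs D v r \<inter> walk_arcs D v' r' = {}" for \<sigma> w p w' p' v r v' r'
  proof -
    note bounds = sum[OF that(2-4)] sum[OF that(5-7)] lower[OF that(2)] lower[OF that(3)] lower[OF that(5)] lower[OF that(6)]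
    have le4: "r \<le> 4" "r' \<le> 4" using bounds by auto
    have "\<exists>t. hit_cycle D \<sigma> t 3"
    proof (cases "p = 3")
      case True then show ?thesis using that(2) by blast
    next
      case False then have "p' = 3" using bounds by auto
      then show ?thesis using that(3) by blast
    qed
    then obtain t where t: "hit_cycle D \<sigma> t 3" by blast
    have "1 \<le> card (walk_arcs D t 3 - (walk_arcs D v r \<union> walk_arcs D v' r'))"
      by (rule triangle_outside[OF assms t that(5,6) le4 that(1)])
    moreover have "card (walk_arcs D t 3 - (walk_arcs D v r \<union> walk_arcs D v' r')) \<le> card (D - (walk_arcs D v r \<union> walk_arcs D v' r'))"
      using hit_cycle_subset[OF t] finite_D by (intro card_mono) auto
    moreover have "card (D - (walk_arcs D v r \<union> walk_arcs D v' r')) = card D - (r + r')"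
      using hit_cycle_subset[OF that(5)] hit_cycle_subset[OF that(6)] bounds(2) by (subst card_Diff_subset) (auto simp: walk_arcs_def)
    ultimately show ?thesis using n bounds by auto
  qed
  obtain w p w' p' where w: "hit_cycle D 1 w p" "hit_cycle D 1 w' p'" "walk_arcs D w p \<inter> walk_arcs D w' p' = {}"
    by (rule left_hit_cycles[OF assms])
  obtain v r v' r' where v: "hit_cycle D (- 1) v r" "hit_cycle D (- 1) v' r'" "walk_arcs D v r \<inter> walk_arcs D v' r' = {}"
    by (rule right_hit_cycles[OF assms])
  have "r + r' = 6" by (rule both3[of 1, OF _ w v]) simp
  moreover have "p + p' = 6" by (rule both3[of "- 1", OF _ v]) (use w in auto)
  ultimately have 3: "p = 3" "p' = 3" "r = 3" "r' = 3" using lower[OF w(1)] lower[OF w(2)] lower[OF v(1)] lower[OF v(2)] by auto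
  let ?V = "walk_arcs D v 3 \<union> walk_arcs D v' 3"
  have out: "1 \<le> card (walk_arcs D w 3 - ?V)" "1 \<le> card (walk_arcs D w' 3 - ?V)"
    using triangle_outside[OF assms, of 1 w v 3 v' 3] triangle_outside[OF assms, of 1 w' v 3 v' 3] w v 3 by auto
  have fin: "finite (walk_arcs D x y)" for x y by (simp add: walk_arcs_def)
  have "card ((walk_arcs D w 3 - ?V) \<union> (walk_arcs D w' 3 - ?V) \<union> ?V)
     = card (walk_arcs D w 3 - ?V) + card (walk_arcs D w' 3 - ?V) + card ?V"
    using w(3) 3 fin by (subst card_Un_disjoint; (subst card_Un_disjoint)?) auto
  moreover have "card ((walk_arcs D w 3 - ?V) \<union> (walk_arcs D w' 3 - ?V) \<union> ?V) \<le> card D"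
    using hit_cycle_subset[OF w(1)] hit_cycle_subset[OF w(2)] hit_cycle_subset[OF v(1)] hit_cycle_subset[OF v(2)] 3
    by (intro card_mono[OF finite_D]) auto
  ultimately show False using out sum[OF v] n 3 by simp
qed

subsection \<open>Upper bounds on the number of swirls\<close>

context diagram
begin

lemma left_cycle_period_unique:
  assumes "left_cycle D z p" "left_cycle D z q" shows "p = q"
proof (rule ccontr)
  assume "p \<noteq> q"
  have *: False if "left_cycle D z p" "left_cycle D z q" "p < q" for p q
  proof -
    have "(\<lambda>i. arc_of D ((turn D ^^ i) z)) p = (\<lambda>i. arc_of D ((turn D ^^ i) z)) 0"
      using that(1) by (simp add: left_cycle_def)
    moreover have "p \<in> {..<q}" "0 \<in> {..<q}" using that by auto
    ultimately have "p = 0" using that(2) unfolding left_cycle_def by (metis (no_types, lifting) inj_onD)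
    then show False using that(1) by (simp add: left_cycle_def)
  qed
  show False using \<open>p \<noteq> q\<close> *[OF assms] *[OF assms(2,1)] by linarith
qed

lemma cyc_cycle_list_shift:
  assumes c: "left_cycle D z p" shows "cyc (cycle_list ((turn D ^^ k) z) p) = cyc (cycle_list z p)"
proof -
  have p: "p > 0" "(turn D ^^ p) z = z" using c by (auto simp: left_cycle_def)
  have rot: "cycle_list ((turn D ^^ k) z) p = rotate k (cycle_list z p)" for k
  proof (rule nth_equalityI)
    show len: "length (cycle_list ((turn D ^^ k) z) p) = length (rotate k (cycle_list z p))" by (simp add: cycle_list_def)
    fix i assume "i < length (cycle_list ((turn D ^^ k) z) p)"
    then have i: "i < p" by (simp add: cycle_list_def)
    have "rotate k (cycle_list z p) ! i = cycle_list z p ! ((k + i) mod p)"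
      using nth_rotate[of i "cycle_list z p" k] i by (simp add: cycle_list_def)
    also have "\<dots> = arc_of D ((turn D ^^ i) ((turn D ^^ k) z))"
      using cycle_list_nth[OF c, of "k + i"] by (simp add: add.commute[of k] funpow_add)
    also have "\<dots> = cycle_list ((turn D ^^ k) z) p ! i"
      using cycle_list_nth[OF left_cycle_shift[OF c], of k i] i by simp
    finally show "cycle_list ((turn D ^^ k) z) p ! i = rotate k (cycle_list z p) ! i" by simp
  qed
  have "(turn D ^^ (p * k - k)) ((turn D ^^ k) z) = z"
  proof -
    have "p * k - k + k = p * k" using p(1) by (cases p) auto
    then have "(turn D ^^ (p * k - k)) ((turn D ^^ k) z) = (turn D ^^ (p * k)) z"
      using funpow_add[of "p * k - k" k "turn D"] by simp
    then show ?thesis using funpow_mod_eq[OF p(2), of "p * k"] by simp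
  qed
  then have "cycle_list z p = rotate (p * k - k) (cycle_list ((turn D ^^ k) z) p)"
    using rot[of "p * k - k + k"] rot[of k] by (metis funpow_add comp_apply rotate_rotate)
  moreover have "cyc (rotate j ys) \<subseteq> cyc ys" for j and ys :: "arc list" by (auto simp: cyc_def rotate_rotate)
  ultimately show ?thesis using rot[of k] by (metis subset_antisym)
qed

text \<open>The definition of a swirl provides endpoints separately at each junction. They fit
  together to one orbit of \<open>turn\<close>, because an arc hits the next one with only one of
  its ends.\<close>

lemma ccw_swirl_cycle:
  assumes "ccw_swirl D xs" obtains z p where "left_cycle D z p" "xs = cycle_list z p"
proof -
  define p where "p = length xs"
  have p: "p > 0" using assms by (simp add: ccw_swirl_def swirl_dir_def p_def)
  have dist: "distinct xs" "set xs \<subseteq> D" using assms by (auto simp: ccw_swirl_def swirl_dir_def)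
  have xD: "xs ! (i mod p) \<in> D" for i using dist(2) nth_mem[of "i mod p" xs] p unfolding p_def by (meson mod_less_divisor subsetD)
  have J: "\<exists>a b c d. hits_at (xs ! i) (xs ! ((i + 1) mod p)) a b \<and> hits_at (xs ! ((i + 1) mod p)) (xs ! ((i + 2) mod p)) c d \<and> det3 b a c > 0"
    if "i < p" for i using assms that by (auto simp: ccw_swirl_def swirl_dir_def p_def)
  have state: "(b, a) \<in> states D \<and> arc_of D (b, a) = x \<and> in_cone a y" if "hits_at x y a b" "x \<in> D" "y \<in> D" for x y a b
  proof -
    have "(b, a) = x \<or> (b, a) = prod.swap x" using that(1) by (cases x) (auto simp: hits_at_def)
    moreover have "in_cone a y" using that arc_int_iff[OF valid[OF that(3)]] by (auto simp: hits_at_def)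
    moreover have "x \<in> states D" using that by (simp add: states_def)
    ultimately show ?thesis using swap_states arc_of_eq[OF that(2)] arc_of_swap by metis
  qed
  have ex: "\<exists>s\<in>states D. arc_of D s = xs ! (i mod p) \<and> in_cone (snd s) (xs ! ((i + 1) mod p))
      \<and> (\<exists>s'\<in>states D. arc_of D s' = xs ! ((i + 1) mod p) \<and> in_cone (snd s') (xs ! ((i + 2) mod p)) \<and> s' = turn D s)" for i
  proof -
    have m: "((i mod p) + 1) mod p = (i + 1) mod p" "((i mod p) + 2) mod p = (i + 2) mod p" by (rule mod_add_left_eq)+
    obtain a b c d where ab: "hits_at (xs ! (i mod p)) (xs ! ((i + 1) mod p)) a b"
      "hits_at (xs ! ((i + 1) mod p)) (xs ! ((i + 2) mod p)) c d" "det3 b a c > 0"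
      using J[of "i mod p"] p unfolding m by auto
    note s = state[OF ab(1) xD xD] and s' = state[OF ab(2) xD xD]
    have "in_cone a (d, c)" using s s' in_cone_arc_of by metis
    then have "(d, c) = turn D (b, a)" using turn_unique[of "(b, a)" "(d, c)"] s s' ab(3) by simp
    then show ?thesis using s s' by (metis snd_conv)
  qed
  define S where "S = (\<lambda>i. SOME s. s \<in> states D \<and> arc_of D s = xs ! (i mod p) \<and> in_cone (snd s) (xs ! ((i + 1) mod p)))"
  have S: "S i \<in> states D \<and> arc_of D (S i) = xs ! (i mod p) \<and> in_cone (snd (S i)) (xs ! ((i + 1) mod p))" for i
    unfolding S_def by (rule someI_ex) (use ex[of i] in blast)
  have uniq: "s = s'" if "s \<in> states D" "s' \<in> states D" "arc_of D s = arc_of D s'" "in_cone (snd s) y" "in_cone (snd s') y" "y \<in> D" for s s' y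
  proof (rule ccontr)
    assume "s \<noteq> s'"
    then have "s' = prod.swap s" using arc_of_eq_iff[OF that(1,2)] that(3) by auto
    then show False using not_both_ends[OF that(1) _ _ that(4)] that(5,6) by (simp add: states_def)
  qed
  have step: "S (Suc i) = turn D (S i)" for i
  proof -
    obtain s s' where s: "s \<in> states D" "arc_of D s = xs ! (i mod p)" "in_cone (snd s) (xs ! ((i + 1) mod p))"
      "s' \<in> states D" "arc_of D s' = xs ! ((i + 1) mod p)" "in_cone (snd s') (xs ! ((i + 2) mod p))" "s' = turn D s"
      using ex[of i] by blast
    have "s = S i" by (rule uniq[OF s(1) _ _ s(3)]) (use S[of i] s xD in auto)
    moreover have "s' = S (Suc i)" by (rule uniq[OF s(4) _ _ s(6)]) (use S[of "Suc i"] s xD in \<open>auto simp: numeral_2_eq_2\<close>)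
    ultimately show ?thesis using s by simp
  qed
  have it: "(turn D ^^ i) (S 0) = S i" for i by (induction i) (simp_all add: step)
  have "(p + 1) mod p = (0 + 1) mod p" by (metis add_0 mod_add_self1)
  then have "S p = S 0" unfolding S_def by simp
  moreover have "inj_on (\<lambda>i. arc_of D (S i)) {..<p}"
  proof (rule inj_onI)
    fix i j assume "i \<in> {..<p}" "j \<in> {..<p}" "arc_of D (S i) = arc_of D (S j)"
    then show "i = j" using S[of i] S[of j] dist(1) by (simp add: nth_eq_iff_index_eq p_def)
  qed
  ultimately have "left_cycle D (S 0) p" using p S[of 0] by (simp add: left_cycle_def it)
  moreover have "xs = cycle_list (S 0) p"
    by (rule nth_equalityI) (use S in \<open>auto simp: cycle_list_def it p_def\<close>)
  ultimately show thesis by (rule that)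
qed

text \<open>Every cycle of \<open>turn\<close> contains \<open>z1\<close> or \<open>z2\<close>, and
  up to rotation it is determined by any of its states.\<close>

lemma num_ccw_le_2:
  assumes reach: "\<And>s. s \<in> states D \<Longrightarrow> \<exists>k. (turn D ^^ k) s \<in> {z1, z2}"
  shows "num_ccw_swirls D \<le> 2"
proof -
  define C where "C = (\<lambda>z. cyc (cycle_list z (SOME p. left_cycle D z p)))"
  have "cyc ` {xs. ccw_swirl D xs} \<subseteq> C ` {z1, z2}"
  proof (rule image_subsetI)
    fix xs assume "xs \<in> {xs. ccw_swirl D xs}"
    then obtain z p where z: "left_cycle D z p" "xs = cycle_list z p" using ccw_swirl_cycle[of xs] by blast
    have "z \<in> states D" using z(1) by (simp add: left_cycle_def)
    then obtain k where k: "(turn D ^^ k) z \<in> {z1, z2}" using reach by blast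
    let ?y = "(turn D ^^ k) z"
    have y: "left_cycle D ?y p" by (rule left_cycle_shift[OF z(1)])
    then have "(SOME p. left_cycle D ?y p) = p" using left_cycle_period_unique by (metis someI)
    then have "cyc xs = C ?y" using cyc_cycle_list_shift[OF z(1), of k] z(2) by (simp add: C_def)
    then show "cyc xs \<in> C ` {z1, z2}" using k by blast
  qed
  then have "num_ccw_swirls D \<le> card (C ` {z1, z2})" unfolding num_ccw_swirls_def by (intro card_mono) auto
  also have "\<dots> \<le> card {z1, z2}" by (intro card_image_le) simp
  also have "\<dots> \<le> 2" by (simp add: card_insert_if)
  finally show ?thesis .
qed

text \<open>The reversed left turn is the right turn, which the antipodal map makes a left
  turn.\<close>

lemma turn_neg:
  assumes "s \<in> states D" shows "turn (neg_arc ` D) (neg_arc s) = neg_arc (prod.swap (turn D s))"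
proof -
  interpret N: diagram "neg_arc ` D" using SD_neg[OF SD] by (simp add: diagram_def)
  have "neg_arc (prod.swap (turn D s)) = turn (neg_arc ` D) (neg_arc s)"
  proof (rule N.turn_unique)
    show "neg_arc s \<in> states (neg_arc ` D)" "neg_arc (prod.swap (turn D s)) \<in> states (neg_arc ` D)"
      using assms turn(1) swap_states by (auto simp: states_neg)
    show "in_cone (snd (neg_arc s)) (neg_arc (prod.swap (turn D s)))"
      using turn(2)[OF assms] in_cone_swap by (simp add: in_cone_neg)
    show "det3 (fst (neg_arc s)) (snd (neg_arc s)) (snd (neg_arc (prod.swap (turn D s)))) > 0"
      using turn(4)[OF assms] by (simp add: det3_neg)
  qed
  then show ?thesis by simp
qed

lemma num_cw_le_2:
  assumes reach: "\<And>s. s \<in> states D \<Longrightarrow> \<exists>k. ((\<lambda>s. prod.swap (turn D s)) ^^ k) s \<in> {z1, z2}"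
  shows "num_cw_swirls D \<le> 2"
proof -
  interpret N: diagram "neg_arc ` D" using SD_neg[OF SD] by (simp add: diagram_def)
  let ?r = "\<lambda>s. prod.swap (turn D s)"
  have r: "(?r ^^ k) s \<in> states D \<and> (turn (neg_arc ` D) ^^ k) (neg_arc s) = neg_arc ((?r ^^ k) s)" if "s \<in> states D" for s k
    by (induction k) (use that turn(1) swap_states turn_neg in auto)
  have "\<exists>k. (turn (neg_arc ` D) ^^ k) s \<in> {neg_arc z1, neg_arc z2}" if s: "s \<in> states (neg_arc ` D)" for s
  proof -
    obtain u where u: "u \<in> states D" "s = neg_arc u" using s by (auto simp: states_neg)
    obtain k where "(?r ^^ k) u \<in> {z1, z2}" using reach[OF u(1)] by blast
    then show ?thesis using r[OF u(1), of k] u(2) by (intro exI[of _ k]) auto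
  qed
  then show ?thesis unfolding num_cw_swirls_neg by (rule N.num_ccw_le_2)
qed

end

subsection \<open>Integer certificates for explicit diagrams\<close>

text \<open>The two inner products are the coefficients of \<open>h\<close> along \<open>p\<close>
  and \<open>q\<close>, multiplied by the squared length of the normal; membership thus becomes a
  test of signs of polynomials.\<close>

lemma in_cone_iff:
  assumes "indep p q"
  shows "in_cone h (p, q) \<longleftrightarrow>
    det3 p q h = 0 \<and> 0 < cross3 h q \<bullet> cross3 p q \<and> 0 < cross3 p h \<bullet> cross3 p q"
proof -
  have n: "0 < cross3 p q \<bullet> cross3 p q" using assms by (simp add: indep_def)
  have c: "cross3 (x *\<^sub>R p + y *\<^sub>R q) q \<bullet> cross3 p q = x * (cross3 p q \<bullet> cross3 p q)"
    "cross3 p (x *\<^sub>R p + y *\<^sub>R q) \<bullet> cross3 p q = y * (cross3 p q \<bullet> cross3 p q)" for x y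
    by (simp_all add: cross_add_left cross_add_right cross_mult_left cross_mult_right)
  show ?thesis
  proof
    assume "in_cone h (p, q)"
    then obtain x y where "x > 0" "y > 0" "h = x *\<^sub>R p + y *\<^sub>R q" by (auto simp: in_cone_def)
    then show "det3 p q h = 0 \<and> 0 < cross3 h q \<bullet> cross3 p q \<and> 0 < cross3 p h \<bullet> cross3 p q"
      using c[of x y] n by (simp add: det3_linear det3_same)
  next
    assume h: "det3 p q h = 0 \<and> 0 < cross3 h q \<bullet> cross3 p q \<and> 0 < cross3 p h \<bullet> cross3 p q"
    then obtain x y where xy: "h = x *\<^sub>R p + y *\<^sub>R q" using indep_decompose[OF assms] by blast
    then have "x > 0" "y > 0" using h c[of x y] n by (auto simp: zero_less_mult_iff)
    then show "in_cone h (p, q)" using xy by (auto simp: in_cone_def)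
  qed
qed

lemma span_pair_eq_plane:
  assumes "indep p q" shows "span {p, q} = {x. cross3 p q \<bullet> x = 0}"
proof
  have "subspace {x. cross3 p q \<bullet> x = 0}" by (rule subspace_hyperplane)
  moreover have "{p, q} \<subseteq> {x. cross3 p q \<bullet> x = 0}"
    using det3_same[of p q] unfolding det3_def by auto
  ultimately show "span {p, q} \<subseteq> {x. cross3 p q \<bullet> x = 0}" by (simp add: span_minimal)
  show "{x. cross3 p q \<bullet> x = 0} \<subseteq> span {p, q}"
  proof
    fix z assume "z \<in> {x. cross3 p q \<bullet> x = 0}"
    then obtain x y where "z = x *\<^sub>R p + y *\<^sub>R q" using indep_decompose[OF assms] by (auto simp: det3_def)
    then show "z \<in> span {p, q}" by (simp add: span_add span_mul span_base)
  qed
qed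

lemma plane_eq_iff:
  assumes "n \<noteq> 0" "m \<noteq> 0"
  shows "{x. n \<bullet> x = 0} = {x. m \<bullet> x = 0} \<longleftrightarrow> cross3 n m = 0"
proof
  assume e: "{x. n \<bullet> x = 0} = {x. m \<bullet> x = 0}"
  let ?c = "cross3 n m"
  have "n \<bullet> cross3 n ?c = 0" by (rule dot_cross_self)
  then have "m \<bullet> cross3 n ?c = 0" using e by blast
  moreover have "m \<bullet> cross3 n ?c = - (?c \<bullet> ?c)"
    by (simp add: cross3_def inner_vec_def sum_3 algebra_simps)
  ultimately show "?c = 0" by simp
next
  assume "cross3 n m = 0"
  then have "collinear {0, n, m}" by (simp add: cross_eq_0)
  then obtain c where "m = c *\<^sub>R n" using assms by (auto simp: collinear_lemma)
  then show "{x. n \<bullet> x = 0} = {x. m \<bullet> x = 0}" using assms by auto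
qed

text \<open>The points of the arc have nonnegative coefficients. The product in the last hypothesis
  is quadratic in \<open>r\<close>, so the same test also excludes \<open>- r\<close>.\<close>

lemma pole_notin_arc_set:
  assumes "indep p q" "det3 p q r = 0" "(cross3 r q \<bullet> cross3 p q) * (cross3 p r \<bullet> cross3 p q) < 0"
  shows "r \<notin> arc_set (p, q)"
proof
  assume "r \<in> arc_set (p, q)"
  then obtain t where t: "0 \<le> t" "t \<le> 1" "r = sgn ((1 - t) *\<^sub>R p + t *\<^sub>R q)" by (auto simp: arc_set_def)
  define k where "k = inverse (norm ((1 - t) *\<^sub>R p + t *\<^sub>R q))"
  have r: "r = (k * (1 - t)) *\<^sub>R p + (k * t) *\<^sub>R q"
    using t(3) by (simp add: sgn_div_norm k_def scaleR_add_right)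
  have "cross3 r q \<bullet> cross3 p q = (k * (1 - t)) * (cross3 p q \<bullet> cross3 p q)"
    "cross3 p r \<bullet> cross3 p q = (k * t) * (cross3 p q \<bullet> cross3 p q)"
    unfolding r by (simp_all add: cross_add_left cross_add_right cross_mult_left cross_mult_right)
  moreover have "k \<ge> 0" by (simp add: k_def)
  ultimately have "(cross3 r q \<bullet> cross3 p q) * (cross3 p r \<bullet> cross3 p q) \<ge> 0" using t(1,2) by simp
  then show False using assms(3) by simp
qed

section \<open>Integer representatives of directions\<close>

type_synonym ivec = "int \<times> int \<times> int"

fun iv :: "ivec \<Rightarrow> pt" where
  "iv (x, y, z) = vector [of_int x, of_int y, of_int z]"

fun icross :: "ivec \<Rightarrow> ivec \<Rightarrow> ivec" where
  "icross (a, b, c) (x, y, z) = (b * z - c * y, c * x - a * z, a * y - b * x)"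

fun idot :: "ivec \<Rightarrow> ivec \<Rightarrow> int" where
  "idot (a, b, c) (x, y, z) = a * x + b * y + c * z"

lemma iv_simps:
  "cross3 (iv a) (iv b) = iv (icross a b)" "iv a \<bullet> iv b = of_int (idot a b)" "iv a = 0 \<longleftrightarrow> a = (0, 0, 0)"
  by (cases a; cases b; simp add: cross3_def inner_vec_def sum_3 vec_eq_iff forall_3)+

text \<open>Unit endpoints would involve square roots. An integer vector fixes the direction, and
  the signs tested below are unaffected by the positive factor.\<close>

definition ray :: "ivec \<Rightarrow> pt" where "ray a = sgn (iv a)"

definition rays :: "ivec \<times> ivec \<Rightarrow> arc" where "rays s = (ray (fst s), ray (snd s))"

lemma rays_simps: "fst (rays s) = ray (fst s)" "snd (rays s) = ray (snd s)" "rays (prod.swap s) = prod.swap (rays s)"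
  by (simp_all add: rays_def)

lemma ray_scale: obtains k where "k > 0 \<or> iv a = 0" "ray a = k *\<^sub>R iv a"
  by (rule that[of "inverse (norm (iv a))"]) (auto simp: ray_def sgn_div_norm)

definition idet :: "ivec \<Rightarrow> ivec \<Rightarrow> ivec \<Rightarrow> int" where
  "idet a b c = idot (icross a b) c"

definition icoeff1 :: "ivec \<Rightarrow> ivec \<times> ivec \<Rightarrow> int" where
  "icoeff1 h s = idot (icross h (snd s)) (icross (fst s) (snd s))"

definition icoeff2 :: "ivec \<Rightarrow> ivec \<times> ivec \<Rightarrow> int" where
  "icoeff2 h s = idot (icross (fst s) h) (icross (fst s) (snd s))"

text \<open>If \<open>h = x p + y q\<close>, then \<open>icoeff1\<close> and \<open>icoeff2\<close> are \<open>x\<close> and \<open>y\<close> times \<open>|p \<times> q|\<^sup>2\<close>.\<close>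

definition icone :: "ivec \<Rightarrow> ivec \<times> ivec \<Rightarrow> bool" where
  "icone h s \<longleftrightarrow> idet (fst s) (snd s) h = 0 \<and> 0 < icoeff1 h s \<and> 0 < icoeff2 h s"

lemma sgn_scaled:
  fixes x :: real
  assumes "k > 0" shows "sgn (k * x) = sgn x"
  using assms by (simp add: sgn_mult)

lemma of_int_sgn: "(of_int (sgn z) :: real) = sgn (of_int z)"
  by (simp add: sgn_if)

lemma ray_pos: assumes "a \<noteq> (0, 0, 0)" obtains k where "k > 0" "ray a = k *\<^sub>R iv a"
  using ray_scale[of a] assms by (metis iv_simps(3))

lemma sgn_det3_ray:
  assumes "a \<noteq> (0, 0, 0)" "b \<noteq> (0, 0, 0)" "c \<noteq> (0, 0, 0)"
  shows "sgn (det3 (ray a) (ray b) (ray c)) = of_int (sgn (idet a b c))"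
proof -
  obtain k l m where "k > 0" "ray a = k *\<^sub>R iv a" "l > 0" "ray b = l *\<^sub>R iv b" "m > 0" "ray c = m *\<^sub>R iv c"
    using assms ray_pos by metis
  then show ?thesis
    by (simp add: det3_scaleR sgn_scaled of_int_sgn) (simp add: det3_def iv_simps idet_def)
qed

lemma sgn_icoeff:
  assumes "fst s \<noteq> (0, 0, 0)" "snd s \<noteq> (0, 0, 0)" "h \<noteq> (0, 0, 0)"
  shows "sgn (cross3 (ray h) (ray (snd s)) \<bullet> cross3 (ray (fst s)) (ray (snd s))) = of_int (sgn (icoeff1 h s))"
    and "sgn (cross3 (ray (fst s)) (ray h) \<bullet> cross3 (ray (fst s)) (ray (snd s))) = of_int (sgn (icoeff2 h s))"
proof -
  obtain k l m where "k > 0" "ray h = k *\<^sub>R iv h" "l > 0" "ray (fst s) = l *\<^sub>R iv (fst s)" "m > 0" "ray (snd s) = m *\<^sub>R iv (snd s)"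
    using assms ray_pos by metis
  then show "sgn (cross3 (ray h) (ray (snd s)) \<bullet> cross3 (ray (fst s)) (ray (snd s))) = of_int (sgn (icoeff1 h s))"
    "sgn (cross3 (ray (fst s)) (ray h) \<bullet> cross3 (ray (fst s)) (ray (snd s))) = of_int (sgn (icoeff2 h s))"
    by (simp_all add: cross_mult_left cross_mult_right sgn_scaled of_int_sgn iv_simps icoeff1_def icoeff2_def)
qed

definition iindep :: "ivec \<Rightarrow> ivec \<Rightarrow> bool" where
  "iindep a b \<longleftrightarrow> icross a b \<noteq> (0, 0, 0)"

lemma iindep_nonzero: "iindep a b \<Longrightarrow> a \<noteq> (0, 0, 0)" "iindep a b \<Longrightarrow> b \<noteq> (0, 0, 0)"
  by (cases a; cases b; auto simp: iindep_def)+

lemma indep_ray: assumes "iindep a b" shows "indep (ray a) (ray b)"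
proof -
  obtain k l where "k > 0" "ray a = k *\<^sub>R iv a" "l > 0" "ray b = l *\<^sub>R iv b"
    using iindep_nonzero[OF assms] ray_pos by metis
  then show ?thesis using assms by (simp add: indep_def iindep_def cross_mult_left cross_mult_right iv_simps)
qed

lemma ray_S2: "a \<noteq> (0, 0, 0) \<Longrightarrow> ray a \<in> S2"
  by (simp add: ray_def S2_def norm_sgn iv_simps)

lemma valid_arc_rays: assumes "iindep (fst s) (snd s)" shows "valid_arc (rays s)"
proof -
  have "indep (ray (fst s)) (ray (snd s))" by (rule indep_ray[OF assms])
  then show ?thesis using iindep_nonzero[OF assms] cross_refl
    by (auto simp: valid_arc_def rays_def ray_S2 indep_def)
qed

lemma in_cone_rays:
  assumes "iindep (fst s) (snd s)" "h \<noteq> (0, 0, 0)"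
  shows "in_cone (ray h) (rays s) \<longleftrightarrow> icone h s"
proof -
  note nz = iindep_nonzero[OF assms(1)]
  have pos: "0 < u \<longleftrightarrow> 0 < m" and zero: "u = 0 \<longleftrightarrow> m = 0" if "sgn u = of_int (sgn m)" for u :: real and m :: int
    using that by (auto simp: sgn_if split: if_splits)
  show ?thesis
    unfolding rays_def in_cone_iff[OF indep_ray[OF assms(1)]] icone_def
    using pos[OF sgn_icoeff(1)[OF nz assms(2)]] pos[OF sgn_icoeff(2)[OF nz assms(2)]] zero[OF sgn_det3_ray[OF nz assms(2)]]
    by blast
qed

lemma arc_int_rays:
  assumes "iindep (fst s) (snd s)" "h \<noteq> (0, 0, 0)"
  shows "ray h \<in> arc_int (rays s) \<longleftrightarrow> icone h s"
  using arc_int_iff[OF valid_arc_rays[OF assms(1)]] in_cone_rays[OF assms] ray_S2[OF assms(2)] by simp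

text \<open>Strictness at one generator of \<open>s\<close> suffices, as both coefficients in an
  open cone are positive. The closures may touch, as they do where one arc hits another.\<close>

definition isep :: "ivec \<Rightarrow> ivec \<times> ivec \<Rightarrow> ivec \<times> ivec \<Rightarrow> bool" where
  "isep w s t \<longleftrightarrow> 0 \<le> idot w (fst s) \<and> 0 \<le> idot w (snd s) \<and> 0 < idot w (fst s) + idot w (snd s)
     \<and> idot w (fst t) \<le> 0 \<and> idot w (snd t) \<le> 0"

text \<open>Two disjoint planar cones can be separated by a plane through two of their generators.\<close>

definition iseparated :: "ivec \<times> ivec \<Rightarrow> ivec \<times> ivec \<Rightarrow> bool" where
  "iseparated s t \<longleftrightarrow> (let V = [fst s, snd s, fst t, snd t] in
     \<exists>u\<in>set V. \<exists>v\<in>set V. isep (icross u v) s t \<or> isep (icross u v) t s)"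

lemma isep_disjoint:
  assumes "isep w s t" "iindep (fst s) (snd s)" "iindep (fst t) (snd t)" "in_cone h (rays s)" "in_cone h (rays t)"
  shows False
proof -
  have pos: "\<exists>k>0. iv w \<bullet> ray a = k * of_int (idot w a)" if "a \<noteq> (0, 0, 0)" for a
    using ray_pos[OF that] by (metis inner_scaleR_right iv_simps(2))
  obtain k1 k2 k3 k4 where k: "k1 > 0" "iv w \<bullet> ray (fst s) = k1 * of_int (idot w (fst s))"
    "k2 > 0" "iv w \<bullet> ray (snd s) = k2 * of_int (idot w (snd s))"
    "k3 > 0" "iv w \<bullet> ray (fst t) = k3 * of_int (idot w (fst t))"
    "k4 > 0" "iv w \<bullet> ray (snd t) = k4 * of_int (idot w (snd t))"
    using pos[OF iindep_nonzero(1)[OF assms(2)]] pos[OF iindep_nonzero(2)[OF assms(2)]]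
      pos[OF iindep_nonzero(1)[OF assms(3)]] pos[OF iindep_nonzero(2)[OF assms(3)]] by (elim exE conjE) (rule that)
  obtain x y where "x > 0" "y > 0" "h = x *\<^sub>R ray (fst s) + y *\<^sub>R ray (snd s)"
    using assms(4) by (auto simp: in_cone_def rays_def)
  then have h: "iv w \<bullet> h = (x * k1) * of_int (idot w (fst s)) + (y * k2) * of_int (idot w (snd s))" and xy: "x * k1 > 0" "y * k2 > 0"
    using k by (simp_all add: inner_add_right)
  have "iv w \<bullet> h > 0"
  proof (cases "idot w (fst s) > 0")
    case True
    moreover have "real_of_int (idot w (snd s)) \<ge> 0" using assms(1) by (simp add: isep_def)
    ultimately show ?thesis unfolding h using True mult_pos_pos[OF xy(1), of "of_int (idot w (fst s))"] mult_nonneg_nonneg[OF less_imp_le[OF xy(2)]]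
      by (intro add_pos_nonneg) auto
  next
    case False
    then have "real_of_int (idot w (fst s)) = 0" "real_of_int (idot w (snd s)) > 0" using assms(1) by (auto simp: isep_def)
    then show ?thesis unfolding h using xy by simp
  qed
  moreover obtain x' y' where "x' > 0" "y' > 0" "h = x' *\<^sub>R ray (fst t) + y' *\<^sub>R ray (snd t)"
    using assms(5) by (auto simp: in_cone_def rays_def)
  then have "iv w \<bullet> h = (x' * k3) * of_int (idot w (fst t)) + (y' * k4) * of_int (idot w (snd t))" "x' * k3 > 0" "y' * k4 > 0"
    using k by (simp_all add: inner_add_right)
  moreover have "real_of_int (idot w (fst t)) \<le> 0" "real_of_int (idot w (snd t)) \<le> 0" using assms(1) by (simp_all add: isep_def)
  ultimately show False by (smt (verit) mult_nonneg_nonpos)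
qed

definition istates :: "(ivec \<times> ivec) list \<Rightarrow> (ivec \<times> ivec) list" where
  "istates L = L @ map prod.swap L"

lemma states_rays: "states (rays ` set L) = rays ` set (istates L)"
  by (simp add: states_def istates_def image_Un image_image rays_simps)

definition isd :: "(ivec \<times> ivec) list \<Rightarrow> bool" where
  "isd L \<longleftrightarrow> L \<noteq> [] \<and> (\<forall>s\<in>set L. iindep (fst s) (snd s))
     \<and> (\<forall>s\<in>set L. \<forall>t\<in>set L. s \<noteq> t \<longrightarrow> iseparated s t)
     \<and> (\<forall>s\<in>set (istates L). \<exists>t\<in>set L. icone (snd s) t)"

lemma isd_iindep:
  assumes "isd L" "s \<in> set (istates L)" shows "iindep (fst s) (snd s)"
proof -
  have "iindep b a" if "iindep a b" for a b using that by (cases a; cases b) (auto simp: iindep_def mult.commute)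
  then show ?thesis using assms unfolding isd_def istates_def by auto
qed

lemma isd_SD:
  assumes "isd L" shows "SD (rays ` set L)"
proof -
  have ind: "iindep (fst s) (snd s)" if "s \<in> set L" for s using assms that by (simp add: isd_def)
  have disj: "arc_int (rays s) \<inter> arc_int (rays t) = {}" if st: "s \<in> set L" "t \<in> set L" "rays s \<noteq> rays t" for s t
  proof -
    have "iseparated s t" using assms st unfolding isd_def by metis
    then obtain w where "isep w s t \<or> isep w t s" unfolding iseparated_def Let_def by blast
    then show ?thesis using isep_disjoint ind st(1,2) arc_int_iff[OF valid_arc_rays] by blast
  qed
  have hit: "\<exists>a\<in>rays ` set L. ray (snd s) \<in> arc_int a" if "s \<in> set (istates L)" for s
  proof -
    have "\<forall>s\<in>set (istates L). \<exists>t\<in>set L. icone (snd s) t" using assms unfolding isd_def by (elim conjE)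
    from bspec[OF this that] obtain t where "t \<in> set L" "icone (snd s) t" by (rule bexE)
    then show ?thesis using arc_int_rays[OF ind] iindep_nonzero(2)[OF isd_iindep[OF assms that]] by blast
  qed
  have "\<exists>a\<in>rays ` set L. fst (rays s) \<in> arc_int a" "\<exists>a\<in>rays ` set L. snd (rays s) \<in> arc_int a" if "s \<in> set L" for s
    using hit[of s] hit[of "prod.swap s"] that by (auto simp: istates_def rays_simps)
  moreover have "L \<noteq> []" using assms by (simp add: isd_def)
  ultimately show ?thesis unfolding SD_def using valid_arc_rays ind disj by auto
qed

definition istep :: "int \<Rightarrow> ivec \<times> ivec \<Rightarrow> ivec \<times> ivec \<Rightarrow> bool" where
  "istep \<sigma> s t \<longleftrightarrow> icone (snd s) t \<and> 0 < \<sigma> * idet (fst s) (snd s) (snd t)"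

lemma turn_rays:
  assumes "isd L" "s \<in> set (istates L)" "t \<in> set (istates L)"
  shows "istep 1 s t \<Longrightarrow> turn (rays ` set L) (rays s) = rays t"
    and "istep (- 1) s t \<Longrightarrow> prod.swap (turn (rays ` set L) (rays s)) = rays t"
proof -
  interpret diagram "rays ` set L" using isd_SD[OF assms(1)] by (simp add: diagram_def)
  have st: "rays s \<in> states (rays ` set L)" "rays t \<in> states (rays ` set L)" using assms by (simp_all add: states_rays)
  note ind = isd_iindep[OF assms(1,2)] isd_iindep[OF assms(1,3)]
  note nz = iindep_nonzero[OF ind(1)] iindep_nonzero[OF ind(2)]
  have cone: "in_cone (snd (rays s)) (rays t)" if "icone (snd s) t"
    using that in_cone_rays[OF ind(2) nz(2)] by (simp add: rays_simps)
  have sg: "sgn (det3 (fst (rays s)) (snd (rays s)) (snd (rays t))) = of_int (sgn (idet (fst s) (snd s) (snd t)))"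
    using sgn_det3_ray nz by (simp add: rays_simps)
  have or: "rays t = turn (rays ` set L) (rays s) \<or> rays t = prod.swap (turn (rays ` set L) (rays s))" if "icone (snd s) t"
    using cones_disjoint[OF _ st(2) _ cone[OF that]] turn[OF st(1)] by blast
  show "turn (rays ` set L) (rays s) = rays t" if "istep 1 s t"
  proof -
    have "det3 (fst (rays s)) (snd (rays s)) (snd (rays t)) > 0" using that sg by (simp add: istep_def sgn_1_pos)
    then show ?thesis using or that turn(4)[OF st(1)] by (auto simp: istep_def)
  qed
  show "prod.swap (turn (rays ` set L) (rays s)) = rays t" if "istep (- 1) s t"
  proof -
    have "det3 (fst (rays s)) (snd (rays s)) (snd (rays t)) < 0" using that sg by (simp add: istep_def sgn_1_neg)
    then show ?thesis using or that turn(3)[OF st(1)] by (auto simp: istep_def)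
  qed
qed

text \<open>Certifies that every state of the list reaches \<open>z\<close> or \<open>z'\<close>: its successor occurs later in the list.\<close>

fun funnel :: "int \<Rightarrow> ivec \<times> ivec \<Rightarrow> ivec \<times> ivec \<Rightarrow> (ivec \<times> ivec) list \<Rightarrow> bool" where
  "funnel \<sigma> z z' [] \<longleftrightarrow> True"
| "funnel \<sigma> z z' (s # ss) \<longleftrightarrow> (s = z \<or> s = z' \<or> (\<exists>t\<in>set ss. istep \<sigma> s t)) \<and> funnel \<sigma> z z' ss"

lemma funnel_reaches:
  assumes "\<And>s t. s \<in> set ss \<Longrightarrow> t \<in> set ss \<Longrightarrow> istep \<sigma> s t \<Longrightarrow> f (rays s) = rays t"
    and "funnel \<sigma> z z' ss" "s \<in> set ss"
  shows "\<exists>k. (f ^^ k) (rays s) \<in> {rays z, rays z'}"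
  using assms
proof (induction ss arbitrary: s)
  case (Cons a ss)
  have IH: "\<exists>k. (f ^^ k) (rays s) \<in> {rays z, rays z'}" if "s \<in> set ss" for s
    by (rule Cons.IH) (use Cons.prems that in auto)
  show ?case
  proof (cases "s \<in> set ss")
    case False
    then have [simp]: "a = s" using Cons.prems(3) by simp
    have "s = z \<or> s = z' \<or> (\<exists>t\<in>set ss. istep \<sigma> s t)" using Cons.prems(2) by simp
    then consider "s = z \<or> s = z'" | t where "t \<in> set ss" "istep \<sigma> s t" by blast
    then show ?thesis
    proof cases
      case 1
      then show ?thesis by (intro exI[of _ 0]) auto
    next
      case 2
      then have "f (rays s) = rays t" using Cons.prems(1)[of s t] by simp
      moreover obtain k where "(f ^^ k) (rays t) \<in> {rays z, rays z'}" using IH[OF 2(1)] by blast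
      ultimately have "(f ^^ Suc k) (rays s) \<in> {rays z, rays z'}" by (simp add: funpow_swap1)
      then show ?thesis by blast
    qed
  qed (rule IH)
qed simp

text \<open>The funnels give the upper bounds; the lower bounds hold in every SD.\<close>

lemma two_swirls:
  assumes "isd L" "funnel 1 z1 z2 ss" "set ss = set (istates L)" "funnel (- 1) w1 w2 ts" "set ts = set (istates L)"
  shows "num_ccw_swirls (rays ` set L) = 2" "num_cw_swirls (rays ` set L) = 2"
proof -
  interpret diagram "rays ` set L" using isd_SD[OF assms(1)] by (simp add: diagram_def)
  note T = turn_rays[OF assms(1)]
  have "num_ccw_swirls (rays ` set L) \<le> 2"
    by (rule num_ccw_le_2[of "rays z1" "rays z2"]) (use funnel_reaches[OF _ assms(2)] T(1) assms(3) in \<open>auto simp: states_rays simp del: insert_iff\<close>)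
  moreover have "num_cw_swirls (rays ` set L) \<le> 2"
    by (rule num_cw_le_2[of "rays w1" "rays w2"]) (use funnel_reaches[OF _ assms(4), of "\<lambda>s. prod.swap (turn (rays ` set L) s)"] T(2) assms(5) in \<open>auto simp: states_rays simp del: insert_iff\<close>)
  ultimately show "num_ccw_swirls (rays ` set L) = 2" "num_cw_swirls (rays ` set L) = 2"
    using num_swirls_ge_2[OF SD] by linarith+
qed

definition isod :: "(ivec \<times> ivec) list \<Rightarrow> bool" where
  "isod L \<longleftrightarrow> (\<forall>a\<in>set L. \<exists>\<sigma>\<in>set [1, -1]. \<forall>s\<in>set (istates L).
     icone (snd s) a \<longrightarrow> 0 < \<sigma> * idet (fst a) (snd a) (fst s))"

lemma isod_SOD:
  assumes "isd L" "isod L" shows "SOD (rays ` set L)"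
proof -
  have "\<exists>\<sigma>. \<forall>b\<in>set L. \<forall>p q. hits_at (rays b) (rays a) p q \<longrightarrow> sgn (det3 (fst (rays a)) (snd (rays a)) q) = \<sigma>"
    if a: "a \<in> set L" for a
  proof -
    have ia: "iindep (fst a) (snd a)" using assms(1) a by (simp add: isd_def)
    obtain \<sigma> :: int where \<sigma>: "\<sigma> = 1 \<or> \<sigma> = -1"
      "\<And>s. s \<in> set (istates L) \<Longrightarrow> icone (snd s) a \<Longrightarrow> 0 < \<sigma> * idet (fst a) (snd a) (fst s)"
      using assms(2) a unfolding isod_def by fastforce
    have "sgn (det3 (fst (rays a)) (snd (rays a)) q) = of_int \<sigma>" if b: "b \<in> set L" "hits_at (rays b) (rays a) p q" for b p q
    proof -
      obtain s where s: "s \<in> set (istates L)" "p = ray (snd s)" "q = ray (fst s)"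
      proof (cases "p = fst (rays b) \<and> q = snd (rays b)")
        case True
        then show thesis using that[of "prod.swap b"] b(1) by (simp add: istates_def rays_simps)
      next
        case False
        then show thesis using that[of b] b by (auto simp: istates_def rays_simps hits_at_def)
      qed
      note nz = iindep_nonzero[OF isd_iindep[OF assms(1) s(1)]]
      have "icone (snd s) a" using b(2) arc_int_rays[OF ia nz(2)] s(2) by (auto simp: hits_at_def)
      then have "sgn (idet (fst a) (snd a) (fst s)) = \<sigma>" using \<sigma> s(1) by (fastforce simp: sgn_if)
      then show ?thesis using sgn_det3_ray[OF iindep_nonzero[OF ia] nz(1)] s(3) by (simp add: rays_simps)
    qed
    then show ?thesis by blast
  qed
  then show ?thesis unfolding SOD_def using isd_SD[OF assms(1)] by (smt (verit, best) image_iff)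
qed

text \<open>Six poles: the roots of type \<open>A\<^sub>3\<close> up to sign, that is, the vertices of a complete quadrilateral.\<close>

definition a3 :: "ivec list" where
  "a3 = [(1, 1, 0), (1, -1, 0), (1, 0, 1), (1, 0, -1), (0, 1, 1), (0, 1, -1)]"

definition ioriented :: "(ivec \<times> ivec) list \<Rightarrow> bool" where
  "ioriented L \<longleftrightarrow> (\<forall>s\<in>set L. \<exists>r\<in>set a3. idet (fst s) (snd s) r = 0 \<and> icoeff1 r s * icoeff2 r s < 0)"

lemma card_planes_3:
  assumes "0 \<notin> N" "a \<in> N" "b \<in> N" "c \<in> N" "cross3 a b \<noteq> 0" "cross3 a c \<noteq> 0" "cross3 b c \<noteq> 0"
    and "\<And>n. n \<in> N \<Longrightarrow> cross3 n a = 0 \<or> cross3 n b = 0 \<or> cross3 n c = 0"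
  shows "card ((\<lambda>n. {x. n \<bullet> x = 0}) ` N) = 3"
proof -
  let ?h = "\<lambda>n :: pt. {x. n \<bullet> x = 0}"
  have eq: "?h n = ?h m \<longleftrightarrow> cross3 n m = 0" if "n \<in> N" "m \<in> N" for n m
    by (rule plane_eq_iff) (use that assms(1) in auto)
  have "?h ` N = {?h a, ?h b, ?h c}"
  proof
    show "?h ` N \<subseteq> {?h a, ?h b, ?h c}" using assms(8) eq assms(2-4) by blast
    show "{?h a, ?h b, ?h c} \<subseteq> ?h ` N" using assms(2-4) by blast
  qed
  moreover have "?h a \<noteq> ?h b" "?h a \<noteq> ?h c" "?h b \<noteq> ?h c" using eq assms(2-7) by simp_all
  ultimately show ?thesis by simp
qed

lemma a3_iindep: "r \<in> set a3 \<Longrightarrow> q \<in> set a3 \<Longrightarrow> r \<noteq> q \<Longrightarrow> iindep r q"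
  unfolding a3_def iindep_def by auto

text \<open>Each root lies in two planes spanned by subsystems of type \<open>A2\<close>, with two
  further poles each, and in one plane with the single pole orthogonal to it: the five other poles
  split as 2 + 2 + 1.\<close>

lemma a3_planes:
  "\<forall>r\<in>set a3. \<exists>a\<in>set a3. \<exists>b\<in>set a3. \<exists>c\<in>set a3. a \<noteq> r \<and> b \<noteq> r \<and> c \<noteq> r
     \<and> iindep (icross r a) (icross r b) \<and> iindep (icross r a) (icross r c) \<and> iindep (icross r b) (icross r c)
     \<and> (\<forall>q\<in>set a3. q \<noteq> r \<longrightarrow> \<not> iindep (icross r q) (icross r a) \<or> \<not> iindep (icross r q) (icross r b)
          \<or> \<not> iindep (icross r q) (icross r c))"
  unfolding a3_def iindep_def by code_simp

lemma ray_eq: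
  assumes "iindep a b" shows "ray a \<noteq> ray b" "ray a \<noteq> - ray b"
  using valid_arc_rays[of "(a, b)"] assms by (simp_all add: valid_arc_def rays_def)

lemma align_count_a3:
  assumes r: "r \<in> set a3" shows "align_count (ray ` set a3) (ray r) = 3"
proof -
  let ?Q = "{q \<in> set a3. q \<noteq> r}"
  have Q: "iindep r q" if "q \<in> ?Q" for q using a3_iindep r that by blast
  have span: "span {ray r, ray q} = {x. iv (icross r q) \<bullet> x = 0}" if q: "q \<in> ?Q" for q
  proof -
    obtain k l where "k > 0" "ray r = k *\<^sub>R iv r" "l > 0" "ray q = l *\<^sub>R iv q"
      using iindep_nonzero[OF Q[OF q]] ray_pos by metis
    then show ?thesis using span_pair_eq_plane[OF indep_ray[OF Q[OF q]]]
      by (simp add: cross_mult_left cross_mult_right iv_simps)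
  qed
  obtain a b c where abc: "a \<in> ?Q" "b \<in> ?Q" "c \<in> ?Q"
    "iindep (icross r a) (icross r b)" "iindep (icross r a) (icross r c)" "iindep (icross r b) (icross r c)"
    "\<And>q. q \<in> ?Q \<Longrightarrow> \<not> iindep (icross r q) (icross r a) \<or> \<not> iindep (icross r q) (icross r b) \<or> \<not> iindep (icross r q) (icross r c)"
    using bspec[OF a3_planes r] by blast
  have "ray ` set a3 - {ray r} = ray ` ?Q" using ray_eq(1) Q by blast
  then have "(\<lambda>q. span {ray r, q}) ` (ray ` set a3 - {ray r}) = (\<lambda>n. {x. n \<bullet> x = 0}) ` (\<lambda>q. iv (icross r q)) ` ?Q"
    using span by (simp add: image_image)
  also have "card \<dots> = 3"
  proof (rule card_planes_3)
    show "0 \<notin> (\<lambda>q. iv (icross r q)) ` ?Q" using Q iv_simps(3) unfolding iindep_def by (metis (no_types, lifting) imageE)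
    show "iv (icross r a) \<in> (\<lambda>q. iv (icross r q)) ` ?Q" "iv (icross r b) \<in> (\<lambda>q. iv (icross r q)) ` ?Q"
      "iv (icross r c) \<in> (\<lambda>q. iv (icross r q)) ` ?Q" using abc by blast+
  next
    fix n assume "n \<in> (\<lambda>q. iv (icross r q)) ` ?Q"
    then obtain q where "q \<in> ?Q" "n = iv (icross r q)" by blast
    then show "cross3 n (iv (icross r a)) = 0 \<or> cross3 n (iv (icross r b)) = 0 \<or> cross3 n (iv (icross r c)) = 0"
      using abc(7) by (simp only: iv_simps iindep_def) blast
  qed (use abc in \<open>simp_all add: iv_simps iindep_def\<close>)
  finally show ?thesis by (simp add: align_count_def)
qed

lemma ioriented_six:
  assumes "isd L" "ioriented L" shows "six_oriented_align3 (rays ` set L)"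
proof -
  let ?P = "ray ` set a3"
  have "inj_on ray (set a3)" using ray_eq(1) a3_iindep by (meson inj_onI)
  then have card: "card ?P = 6" by (simp add: card_image) (simp add: a3_def)
  have nz: "r \<noteq> (0, 0, 0)" if "r \<in> set a3" for r using that by (auto simp: a3_def)
  have S2: "?P \<subseteq> S2" using ray_S2 nz by blast
  have anti: "- p \<notin> ?P" if p: "p \<in> ?P" for p
  proof
    assume "- p \<in> ?P"
    then obtain q r where qr: "q \<in> set a3" "r \<in> set a3" "p = ray q" "ray r = - ray q" using p by (metis imageE)
    then have "q = r" using ray_eq(2) a3_iindep by metis
    then have "ray q + ray q = 0" using qr(4) by (metis eq_neg_iff_add_eq_0)
    then have "ray q = 0" unfolding scaleR_2[symmetric] by simp
    then show False using ray_S2[OF nz[OF qr(1)]] by (simp add: S2_def)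
  qed
  have "\<exists>p\<in>?P. p \<in> span {fst a, snd a} \<and> p \<notin> arc_set a \<and> - p \<notin> arc_set a" if a: "a \<in> rays ` set L" for a
  proof -
    obtain s where s: "s \<in> set L" "a = rays s" using a by blast
    obtain r where r: "r \<in> set a3" "idet (fst s) (snd s) r = 0" "icoeff1 r s * icoeff2 r s < 0"
      using assms(2) s(1) by (auto simp: ioriented_def)
    have i: "iindep (fst s) (snd s)" using assms(1) s(1) by (simp add: isd_def)
    let ?p = "ray (fst s)" and ?q = "ray (snd s)"
    note ind = indep_ray[OF i] and nzs = iindep_nonzero[OF i]
    have d: "det3 ?p ?q (ray r) = 0" using sgn_det3_ray[OF nzs nz[OF r(1)]] r(2) by (simp add: sgn_0_0)
    have "sgn ((cross3 (ray r) ?q \<bullet> cross3 ?p ?q) * (cross3 ?p (ray r) \<bullet> cross3 ?p ?q)) = of_int (sgn (icoeff1 r s * icoeff2 r s))"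
      using sgn_icoeff[OF nzs nz[OF r(1)]] by (simp add: sgn_mult)
    then have m: "(cross3 (ray r) ?q \<bullet> cross3 ?p ?q) * (cross3 ?p (ray r) \<bullet> cross3 ?p ?q) < 0"
      using r(3) by (simp add: sgn_1_neg)
    have "ray r \<in> span {?p, ?q}" using d by (simp add: span_pair_eq_plane[OF ind] det3_def)
    moreover have "ray r \<notin> arc_set (?p, ?q)" by (rule pole_notin_arc_set[OF ind d m])
    moreover have "- ray r \<notin> arc_set (?p, ?q)"
      by (rule pole_notin_arc_set[OF ind]) (use d m in \<open>simp_all add: det3_def cross_minus_left cross_minus_right\<close>)
    ultimately show ?thesis using r(1) s(2) by (auto simp: rays_def)
  qed
  then obtain f where "\<forall>a\<in>rays ` set L. f a \<in> ?P \<and> f a \<in> span {fst a, snd a} \<and> f a \<notin> arc_set a \<and> - f a \<notin> arc_set a"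
    by metis
  then have "oriented_by (rays ` set L) 6 ?P f" using card S2 anti by (auto simp: oriented_by_def)
  then show ?thesis using align_count_a3 unfolding six_oriented_align3_def by blast
qed

subsection \<open>The examples\<close>

text \<open>Both configurations were found by computer search among arcs on great circles through these poles.\<close>

definition six_arcs :: "(ivec \<times> ivec) list" where
  "six_arcs = [((1, 1, -1), (1, -2, 2)),
    ((-2, 1, 2), (2, 1, -2)),
    ((-2, -3, -2), (3, 2, -2)),
    ((-1, -1, -1), (1, -1, 1)),
    ((-1, -2, -2), (-1, 1, 1)),
    ((2, -3, 2), (-3, 2, 2))]"

lemma six_arcs_isd: "isd six_arcs"
  by code_simp

lemma six_arcs_ioriented: "ioriented six_arcs"
  by code_simp

lemma six_arcs_swirls: "num_ccw_swirls (rays ` set six_arcs) = 2" "num_cw_swirls (rays ` set six_arcs) = 2"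
proof -
  \<comment> \<open>Indices run through the directed arcs, with \<open>i + 6\<close> the reverse of
    \<open>i\<close>. Each list is a topological order of the graph of left or right turns after
    cutting it at one state of each of the two swirls.\<close>
  let ?s = "(!) (istates six_arcs)"
  have "funnel 1 (?s 0) (?s 10) (map ?s [6, 4, 1, 8, 7, 11, 9, 5, 3, 2, 10, 0])"
    "set (map ?s [6, 4, 1, 8, 7, 11, 9, 5, 3, 2, 10, 0]) = set (istates six_arcs)"
    by code_simp+
  note ccw = this
  have "funnel (- 1) (?s 7) (?s 1) (map ?s [10, 8, 3, 2, 0, 11, 9, 6, 5, 4, 1, 7])"
    "set (map ?s [10, 8, 3, 2, 0, 11, 9, 6, 5, 4, 1, 7]) = set (istates six_arcs)"
    by code_simp+
  then show "num_ccw_swirls (rays ` set six_arcs) = 2" "num_cw_swirls (rays ` set six_arcs) = 2"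
    using two_swirls[OF six_arcs_isd] ccw by blast+
qed

definition eight_arcs :: "(ivec \<times> ivec) list" where
  "eight_arcs = [((-5, 5, -8), (5, 5, 2)),
    ((3, -3, -5), (24, 25, 9)),
    ((-5, 5, -4), (5, 5, 6)),
    ((-5, -5, 7), (-30, 35, -23)),
    ((2, -2, -3), (-5, 5, -3)),
    ((3, -1, -3), (-5, -3, 5)),
    ((3, -2, -4), (-5, -2, 4)),
    ((3, 3, 1), (-1, -1, 1))]"

lemma eight_arcs_isd: "isd eight_arcs"
  by code_simp

lemma eight_arcs_ioriented: "ioriented eight_arcs"
  by code_simp

lemma eight_arcs_isod: "isod eight_arcs"
  by code_simp

lemma eight_arcs_swirls: "num_ccw_swirls (rays ` set eight_arcs) = 2" "num_cw_swirls (rays ` set eight_arcs) = 2"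
proof -
  let ?s = "(!) (istates eight_arcs)"
  have "funnel 1 (?s 1) (?s 4) (map ?s [12, 11, 7, 6, 5, 3, 2, 0, 15, 14, 13, 10, 9, 8, 4, 1])"
    "set (map ?s [12, 11, 7, 6, 5, 3, 2, 0, 15, 14, 13, 10, 9, 8, 4, 1]) = set (istates eight_arcs)"
    by code_simp+
  note ccw = this
  have "funnel (- 1) (?s 5) (?s 12) (map ?s [6, 4, 3, 2, 1, 0, 15, 14, 13, 11, 10, 9, 8, 7, 12, 5])"
    "set (map ?s [6, 4, 3, 2, 1, 0, 15, 14, 13, 11, 10, 9, 8, 7, 12, 5]) = set (istates eight_arcs)"
    by code_simp+
  then show "num_ccw_swirls (rays ` set eight_arcs) = 2" "num_cw_swirls (rays ` set eight_arcs) = 2"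
    using two_swirls[OF eight_arcs_isd] ccw by blast+
qed

theorem mainTheorem7:
  shows "(\<forall>D. SD D \<longrightarrow> num_cw_swirls D \<ge> 2 \<and> num_ccw_swirls D \<ge> 2 \<and> card D \<ge> 6)
    \<and> (\<forall>D. SOD D \<longrightarrow> card D \<ge> 8)
    \<and> (\<exists>D. SD D \<and> six_oriented_align3 D \<and> num_cw_swirls D = 2 \<and>
           num_ccw_swirls D = 2 \<and> card D = 6)
    \<and> (\<exists>D. SOD D \<and> six_oriented_align3 D \<and> num_cw_swirls D = 2 \<and>
           num_ccw_swirls D = 2 \<and> card D = 8)"
proof (intro conjI allI impI)
  fix D assume "SD D"
  then show "num_cw_swirls D \<ge> 2" "num_ccw_swirls D \<ge> 2" "card D \<ge> 6"
    using num_swirls_ge_2 diagram.card_ge_6 by (auto simp: diagram_def)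
next
  fix D assume "SOD D"
  then show "card D \<ge> 8" by (rule SOD_card_ge_8)
next
  \<comment> \<open>The reverse inequalities for the examples come from the general lower bounds 6
    and 8.\<close>
  have card: "card (rays ` set L) \<le> length L" for L
    using card_image_le[of "set L" rays] card_length[of L] by simp
  have SD6: "SD (rays ` set six_arcs)" by (rule isd_SD[OF six_arcs_isd])
  have "card (rays ` set six_arcs) \<ge> 6" using diagram.card_ge_6 SD6 by (auto simp: diagram_def)
  moreover have "card (rays ` set six_arcs) \<le> 6" using card[of six_arcs] by (simp add: six_arcs_def)
  ultimately show "\<exists>D. SD D \<and> six_oriented_align3 D \<and> num_cw_swirls D = 2 \<and> num_ccw_swirls D = 2 \<and> card D = 6"
    using SD6 ioriented_six[OF six_arcs_isd six_arcs_ioriented] six_arcs_swirls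
    by (intro exI[of _ "rays ` set six_arcs"]) simp
  have SOD8: "SOD (rays ` set eight_arcs)" by (rule isod_SOD[OF eight_arcs_isd eight_arcs_isod])
  have "card (rays ` set eight_arcs) \<le> 8" using card[of eight_arcs] by (simp add: eight_arcs_def)
  then show "\<exists>D. SOD D \<and> six_oriented_align3 D \<and> num_cw_swirls D = 2 \<and> num_ccw_swirls D = 2 \<and> card D = 8"
    using SOD8 SOD_card_ge_8[OF SOD8] ioriented_six[OF eight_arcs_isd eight_arcs_ioriented] eight_arcs_swirls
    by (intro exI[of _ "rays ` set eight_arcs"]) simp
qed

end
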